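(* Let $d\ge 2$, let $q\ge 1$ be real, and let $Q$ be a probability measure on $\mathbb{R}^+$ with $Q\ne\delta_0$ and $\int R^d\,Q(dR)<+\infty$. (i) There exists $z_0=z_0(Q,q,d)>0$ such that for every $0<z<z_0$, no CRCM$(z,Q,q)$ percolates, i.e. every CRCM$(z,Q,q)$ $P$ satisfies $P(\omega\text{ percolates})=0$. (ii) If in addition $Q(\{0\})=0$, there exists $z_1=z_1(Q,q,d)<\infty$ such that for every $z>z_1$, every CRCM$(z,Q,q)$ percolates, i.e. every CRCM$(z,Q,q)$ $P$ satisfies $P(\omega\text{ percolates})=1$.
   Context: Let $d\ge 2$ and $S=\mathbb{R}^d\times\mathbb{R}^+$ with its Borel $\sigma$-algebra. A configuration is a non-negative integer-valued measure $\omega=\sum_{i\in I}\delta_{(x_i,R_i)}$ on $S$ ($I$ finite or countable) with $\omega(\Lambda\times\mathbb{R}^+)<\infty$ for every bounded $\Lambda\subset\mathbb{R}^d$. $\Omega$ is the set of configurations, with the $\sigma$-algebra $\mathcal{F}$ generated by $\omega\mapsto\omega(\Gamma)$, $\Gamma\subset S$ bounded Borel. For $\Lambda\subset\mathbb{R}^d$, $\omega_\Lambda$ is the restriction of $\omega$ to $\Lambda\times\mathbb{R}^+$, and $\Lambda^c=\mathbb{R}^d\setminus\Lambda$. Write $(x,R)\in\omega$ if $\omega(\{(x,R)\})>0$. Set $L(\omega)=\bigcup_{(x,R)\in\omega}B(x,R)$, where $B(x,R)$ is the closed Euclidean ball. Connected components of $L(\omega)$: $x,y\in\mathbb{R}^d$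 are in the same connected component if there are finitely many $(x_1,R_1),\dots,(x_n,R_n)\in\omega$ with $x\in B(x_1,R_1)$, $y\in B(x_n,R_n)$ and $B(x_i,R_i)\cap B(x_{i+1},R_{i+1})\ne\emptyset$ for $1\le i\le n-1$. The configuration $\omega$ percolates if $L(\omega)$ has at least one unbounded connected component. A probability measure on $\Omega$ percolates (resp. does not percolate) if the event $\{\omega\text{ percolates}\}$ has probability $1$ (resp. $0$). For a finite configuration, $N_{cc}(\omega)$ is the number of connected components of $L(\omega)$. For bounded $\Lambda$ and any configuration $\omega$, $N_{cc}^{\Lambda}(\omega)=\lim_{\Delta\to\mathbb{R}^d}\big(N_{cc}(\omega_\Delta)-N_{cc}(\omega_{\Delta\setminus\Lambda})\big)$, the limit being taken along any increasing sequence of bounded sets $\Delta$ (it is known to be well defined). $\pi^{z,Q}$ is the law on $\Omega$ of the homogeneous Poisson point process with spatial intensity $z$ and independent marks of law $Q$; $\pi^{z,Q}_\Lambda$ is its projection on $\Lambda\times\mathbb{R}^+$. A probability measure $P$ on $(\Omega,\mathcal{F})$ is a CRCM$(z,Q,q)$ (continuum random cluster model) if it is stationary (invariant under translations of $\mathbb{R}^d$) and for every bounded $\Lambda\subset\mathbb{R}^d$ and every bounded measurable $f$, $$\int f\,dP=\int\int f(\omega'_\Lambda+\omega_{\Lambda^c})\frac{q^{N_{cc}^\Lambda(\omega'_\Lambda+\omega_{\Lambda^c})}}{Z_\Lambda(\omega_{\Lambda^c})}\,\pi^{z,Q}_\Lambda(d\omega'_\Lambda)\,P(d\omega),$$ where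 $Z_\Lambda(\omega_{\Lambda^c})=\int q^{N_{cc}^\Lambda(\omega'_\Lambda+\omega_{\Lambda^c})}\pi^{z,Q}_\Lambda(d\omega'_\Lambda)$ is assumed to be non-degenerate. *)

theory Defs
  imports "HOL-Probability.Probability"
begin

section \<open>Configurations of marked points\<close>

text \<open>The marks live in \<open>\<real>\<^sup>+ = [0, \<infinity>)\<close>; the mark \<open>0\<close> is allowed.\<close>

definition mark_space :: "real measure" where
  "mark_space = restrict_space borel {0..}"

definition point_space :: "('a::euclidean_space \<times> real) measure" where
  "point_space = restrict_space borel (UNIV \<times> {0..})"

text \<open>
  The measure \<^term>\<open>distr (count_space I) point_space p\<close> is the sum over \<open>i \<in> I\<close> of the Dirac
  masses at \<open>p i\<close>, so points may be repeated; index sets \<open>I \<subseteq> \<nat>\<close> cover the finite and the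
  countable case.
\<close>

definition configurations :: "('a::euclidean_space \<times> real) measure set" where
  "configurations =
    {\<omega>. (\<exists>(I :: nat set) p. p \<in> I \<rightarrow> space point_space \<and>
            \<omega> = distr (count_space I) point_space p) \<and>
         (\<forall>\<Lambda>. bounded \<Lambda> \<longrightarrow> emeasure \<omega> (\<Lambda> \<times> {0..}) < \<infinity>)}"

definition config_space :: "('a::euclidean_space \<times> real) measure measure" where
  "config_space = sigma configurations
    {(\<lambda>\<omega>. emeasure \<omega> \<Gamma>) -` B \<inter> configurations | \<Gamma> B.
       \<Gamma> \<in> sets point_space \<and> bounded \<Gamma> \<and> B \<in> sets borel}"

text \<open>Restriction to \<open>\<Lambda> \<times> \<real>\<^sup>+\<close>, for Borel sets \<open>\<Lambda>\<close>.\<close>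

definition config_restrict ::
  "'a::euclidean_space set \<Rightarrow> ('a \<times> real) measure \<Rightarrow> ('a \<times> real) measure" where
  "config_restrict \<Lambda> \<omega> = density \<omega> (indicator (\<Lambda> \<times> UNIV))"

definition config_add ::
  "('a::euclidean_space \<times> real) measure \<Rightarrow> ('a \<times> real) measure \<Rightarrow> ('a \<times> real) measure" where
  "config_add \<omega> \<omega>' =
    measure_of (space point_space) (sets point_space) (\<lambda>A. emeasure \<omega> A + emeasure \<omega>' A)"

definition config_shift ::
  "'a::euclidean_space \<Rightarrow> ('a \<times> real) measure \<Rightarrow> ('a \<times> real) measure" where
  "config_shift v \<omega> = distr \<omega> point_space (\<lambda>(x, R). (x + v, R))"

definition atoms :: "('a::euclidean_space \<times> real) measure \<Rightarrow> ('a \<times> real) set" where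
  "atoms \<omega> = {p. emeasure \<omega> {p} > 0}"


section \<open>Connected components and percolation\<close>

abbreviation point_ball :: "'a::euclidean_space \<times> real \<Rightarrow> 'a set" where
  "point_ball p \<equiv> cball (fst p) (snd p)"

definition germ_grain :: "('a::euclidean_space \<times> real) measure \<Rightarrow> 'a set" where
  "germ_grain \<omega> = (\<Union>p \<in> atoms \<omega>. point_ball p)"

definition ball_connected ::
  "('a::euclidean_space \<times> real) measure \<Rightarrow> 'a \<Rightarrow> 'a \<Rightarrow> bool" where
  "ball_connected \<omega> x y \<longleftrightarrow>
    (\<exists>ps. ps \<noteq> [] \<and> set ps \<subseteq> atoms \<omega> \<and>
          x \<in> point_ball (hd ps) \<and> y \<in> point_ball (last ps) \<and>
          (\<forall>i. Suc i < length ps \<longrightarrow> point_ball (ps ! i) \<inter> point_ball (ps ! Suc i) \<noteq> {}))"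

definition ball_components :: "('a::euclidean_space \<times> real) measure \<Rightarrow> 'a set set" where
  "ball_components \<omega> = germ_grain \<omega> // {(x, y). ball_connected \<omega> x y}"

definition percolates :: "('a::euclidean_space \<times> real) measure \<Rightarrow> bool" where
  "percolates \<omega> \<longleftrightarrow> (\<exists>C \<in> ball_components \<omega>. \<not> bounded C)"

text \<open>
  Membership in \<^const>\<open>null_sets\<close> includes measurability, so the probability-zero statement is not
  true by the convention that non-measurable sets have measure \<open>0\<close>.
\<close>

definition measure_percolates :: "('a::euclidean_space \<times> real) measure measure \<Rightarrow> bool" where
  "measure_percolates P \<longleftrightarrow> emeasure P {\<omega> \<in> space P. percolates \<omega>} = 1"

definition measure_not_percolates :: "('a::euclidean_space \<times> real) measure measure \<Rightarrow> bool" where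
  "measure_not_percolates P \<longleftrightarrow> {\<omega> \<in> space P. percolates \<omega>} \<in> null_sets P"

text \<open>Used for finite configurations only.\<close>

definition ncc :: "('a::euclidean_space \<times> real) measure \<Rightarrow> nat" where
  "ncc \<omega> = card (ball_components \<omega>)"

text \<open>
  The common limit along all increasing sequences of bounded Borel sets that exhaust the space.
  It is an integer and may be negative, since the points in \<open>\<Lambda>\<close> can merge components of the rest.
\<close>

definition ncc_local ::
  "'a::euclidean_space set \<Rightarrow> ('a \<times> real) measure \<Rightarrow> int" where
  "ncc_local \<Lambda> \<omega> =
    (THE k. \<forall>\<Delta> :: nat \<Rightarrow> 'a set.
       incseq \<Delta> \<and> (\<forall>n. bounded (\<Delta> n) \<and> \<Delta> n \<in> sets borel) \<and> (\<Union>n. \<Delta> n) = UNIV \<longrightarrow>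
       (\<lambda>n. int (ncc (config_restrict (\<Delta> n) \<omega>)) - int (ncc (config_restrict (\<Delta> n - \<Lambda>) \<omega>)))
         \<longlonglongrightarrow> k)"


section \<open>Poisson processes and the continuum random cluster model\<close>

definition poisson_process_law ::
  "('a::euclidean_space \<times> real) measure \<Rightarrow> ('a \<times> real) measure measure \<Rightarrow> bool" where
  "poisson_process_law \<mu> \<pi> \<longleftrightarrow>
    prob_space \<pi> \<and> sets \<pi> = sets config_space \<and>
    (\<forall>A \<in> sets point_space. emeasure \<mu> A < \<infinity> \<longrightarrow>
      (\<forall>k::nat. measure \<pi> {\<omega> \<in> space \<pi>. emeasure \<omega> A = of_nat k} =
         exp (- measure \<mu> A) * measure \<mu> A ^ k / fact k)) \<and>
    (\<forall>A :: nat \<Rightarrow> ('a \<times> real) set. range A \<subseteq> sets point_space \<and> disjoint_family A \<longrightarrow>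
      prob_space.indep_vars \<pi> (\<lambda>_. borel) (\<lambda>i \<omega>. emeasure \<omega> (A i)) UNIV)"

text \<open>
  The homogeneous Poisson process with spatial intensity \<open>z\<close> and independent marks of law \<open>Q\<close> is
  the Poisson process whose intensity measure is \<open>z\<close> times the product of Lebesgue measure and \<open>Q\<close>.
\<close>

definition marked_poisson_law ::
  "real \<Rightarrow> real measure \<Rightarrow> ('a::euclidean_space \<times> real) measure measure \<Rightarrow> bool" where
  "marked_poisson_law z Q \<pi> \<longleftrightarrow>
    poisson_process_law (scale_measure (ennreal z) (lborel \<Otimes>\<^sub>M Q)) \<pi>"

definition law_restrict ::
  "'a::euclidean_space set \<Rightarrow> ('a \<times> real) measure measure \<Rightarrow> ('a \<times> real) measure measure" where
  "law_restrict \<Lambda> \<pi> = distr \<pi> config_space (config_restrict \<Lambda>)"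

definition stationary :: "('a::euclidean_space \<times> real) measure measure \<Rightarrow> bool" where
  "stationary P \<longleftrightarrow> (\<forall>v. distr P config_space (config_shift v) = P)"

definition crcm_partition ::
  "('a::euclidean_space \<times> real) measure measure \<Rightarrow> real \<Rightarrow> 'a set \<Rightarrow>
   ('a \<times> real) measure \<Rightarrow> ennreal" where
  "crcm_partition \<pi> q \<Lambda> \<eta> =
    (\<integral>\<^sup>+ \<omega>'. ennreal (q powi ncc_local \<Lambda> (config_add (config_restrict \<Lambda> \<omega>') \<eta>))
       \<partial>law_restrict \<Lambda> \<pi>)"

text \<open>
  The Poisson law \<open>\<pi>\<close> with parameters \<open>z\<close> and \<open>Q\<close> exists and is unique, so the quantifier over \<open>\<pi>\<close>
  only gives it a name. Non-degeneracy of the partition function means that it is almost surely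
  positive and finite.
\<close>

definition crcm ::
  "real \<Rightarrow> real measure \<Rightarrow> real \<Rightarrow> ('a::euclidean_space \<times> real) measure measure \<Rightarrow> bool" where
  "crcm z Q q P \<longleftrightarrow>
    prob_space P \<and> sets P = sets config_space \<and> stationary P \<and>
    (\<exists>\<pi>. marked_poisson_law z Q \<pi> \<and>
      (\<forall>\<Lambda>. bounded \<Lambda> \<and> \<Lambda> \<in> sets borel \<longrightarrow>
        (AE \<omega> in P. 0 < crcm_partition \<pi> q \<Lambda> (config_restrict (- \<Lambda>) \<omega>) \<and>
                    crcm_partition \<pi> q \<Lambda> (config_restrict (- \<Lambda>) \<omega>) < \<infinity>) \<and>
        (\<forall>f :: ('a \<times> real) measure \<Rightarrow> real.
          f \<in> borel_measurable config_space \<and> (\<exists>C. \<forall>\<omega> \<in> configurations. \<bar>f \<omega>\<bar> \<le> C) \<longrightarrow>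
          (\<integral>\<omega>. f \<omega> \<partial>P) =
          (\<integral>\<omega>. (\<integral>\<omega>'. f (config_add (config_restrict \<Lambda> \<omega>') (config_restrict (- \<Lambda>) \<omega>)) *
                 (q powi ncc_local \<Lambda>
                    (config_add (config_restrict \<Lambda> \<omega>') (config_restrict (- \<Lambda>) \<omega>)) /
                  enn2real (crcm_partition \<pi> q \<Lambda> (config_restrict (- \<Lambda>) \<omega>)))
               \<partial>law_restrict \<Lambda> \<pi>) \<partial>P))))"


section \<open>Basic facts about the encoding\<close>

lemma sets_lborel_pair_mark:
  assumes "sets Q = sets mark_space"
  shows "sets (lborel \<Otimes>\<^sub>M Q) = sets (point_space :: ('a::euclidean_space \<times> real) measure)"
proof -
  let ?N = "(borel :: 'a measure) \<Otimes>\<^sub>M restrict_space (borel :: real measure) {0..}"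
  let ?P = "point_space :: ('a \<times> real) measure"
  have 1: "sets (lborel \<Otimes>\<^sub>M Q) = sets ?N"
    using assms by (intro sets_pair_measure_cong) (auto simp: mark_space_def)
  have sp: "space ?N = space ?P"
    by (auto simp: space_pair_measure point_space_def space_restrict_space)
  have "(\<lambda>x. (fst x, snd x)) \<in> measurable ?N (borel \<Otimes>\<^sub>M borel)"
    by (intro measurable_Pair measurable_fst measurable_compose[OF measurable_snd]
        measurable_restrict_space1) auto
  then have f: "(\<lambda>x. x) \<in> measurable ?N ?P"
    unfolding point_space_def borel_prod
    by (intro measurable_restrict_space2) (auto simp: space_pair_measure space_restrict_space)
  have b: "fst \<in> measurable (borel :: ('a \<times> real) measure) borel"
          "snd \<in> measurable (borel :: ('a \<times> real) measure) borel"
    unfolding borel_prod[symmetric] by auto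
  have "(\<lambda>x. (fst x, snd x)) \<in> measurable ?P ?N"
    unfolding point_space_def
    by (intro measurable_Pair measurable_restrict_space2 measurable_restrict_space1 b)
       (auto simp: space_restrict_space)
  then have g: "(\<lambda>x. x) \<in> measurable ?P ?N" by simp
  have "sets ?N \<subseteq> sets ?P"
    using measurable_sets[OF g] sets.sets_into_space sp by (fastforce simp: Int_absorb2)
  moreover have "sets ?P \<subseteq> sets ?N"
    using measurable_sets[OF f] sets.sets_into_space sp by (fastforce simp: Int_absorb2)
  ultimately show ?thesis using 1 by auto
qed

lemma sets_configuration: "\<omega> \<in> configurations \<Longrightarrow> sets \<omega> = sets point_space"
  by (auto simp: configurations_def)

lemma space_config_space: "space config_space = configurations"
  unfolding config_space_def by (rule space_measure_of) auto

lemma measurable_slab: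
  fixes \<Lambda> :: "'a::euclidean_space set"
  assumes "\<Lambda> \<in> sets borel"
  shows "(\<Lambda> \<times> UNIV) \<inter> space point_space \<in> sets point_space"
proof -
  have "\<Lambda> \<times> (UNIV::real set) \<in> sets (borel \<Otimes>\<^sub>M borel)" using assms by auto
  then have "\<Lambda> \<times> (UNIV::real set) \<in> sets borel" unfolding borel_prod .
  then show ?thesis
    by (auto simp: point_space_def space_restrict_space sets_restrict_space)
qed

lemma emeasure_config_restrict:
  fixes \<Lambda> :: "'a::euclidean_space set"
  assumes "\<Lambda> \<in> sets borel" "\<omega> \<in> configurations" "A \<in> sets point_space"
  shows "emeasure (config_restrict \<Lambda> \<omega>) A = emeasure \<omega> (A \<inter> \<Lambda> \<times> UNIV)"
proof -
  have [measurable_cong]: "sets \<omega> = sets point_space" using assms sets_configuration by blast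
  have sp: "space \<omega> = space point_space" using sets_eq_imp_space_eq[OF \<open>sets \<omega> = _\<close>] .
  have m: "(indicator (\<Lambda> \<times> UNIV) :: _ \<Rightarrow> ennreal) \<in> borel_measurable \<omega>"
    using measurable_slab[OF assms(1)] \<open>sets \<omega> = _\<close> sp
    by (simp add: borel_measurable_indicator_iff)
  have As: "A \<in> sets \<omega>" using assms(3) \<open>sets \<omega> = _\<close> by simp
  have eq: "A \<inter> \<Lambda> \<times> UNIV = A \<inter> ((\<Lambda> \<times> UNIV) \<inter> space point_space)"
    using sets.sets_into_space[OF assms(3)] by auto
  have "A \<inter> \<Lambda> \<times> UNIV \<in> sets \<omega>"
    unfolding eq using measurable_slab[OF assms(1)] As \<open>sets \<omega> = _\<close> by auto
  then show ?thesis
    unfolding config_restrict_def emeasure_density[OF m As]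
    by (subst mult.commute) (simp del: indicator_times flip: indicator_inter_arith)
qed

lemma emeasure_config_add:
  fixes \<omega> :: "('a::euclidean_space \<times> real) measure"
  assumes "sets \<omega> = sets point_space" "sets \<omega>' = sets point_space" "A \<in> sets point_space"
  shows "emeasure (config_add \<omega> \<omega>') A = emeasure \<omega> A + emeasure \<omega>' A"
proof (rule emeasure_measure_of[OF config_add_def])
  show "countably_additive (sets (config_add \<omega> \<omega>')) (\<lambda>A. emeasure \<omega> A + emeasure \<omega>' A)"
  proof (rule countably_additiveI)
    fix B :: "nat \<Rightarrow> ('a \<times> real) set"
    assume B: "range B \<subseteq> sets (config_add \<omega> \<omega>')" "disjoint_family B"
    have S: "sets (config_add \<omega> \<omega>') = sets point_space"
      by (simp add: config_add_def)
    show "(\<Sum>i. emeasure \<omega> (B i) + emeasure \<omega>' (B i)) = emeasure \<omega> (\<Union> (range B)) + emeasure \<omega>' (\<Union> (range B))"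
      using B assms S by (subst suminf_add[symmetric]) (auto simp: suminf_emeasure)
  qed
qed (use assms sets.space_closed[of point_space] in \<open>auto simp: positive_def config_add_def\<close>)

end

(*
Both parts rest on estimates of P given the configuration outside a bounded set, read off from the
Gibbs specification because Poisson processes on disjoint sets are independent.

Small intensity. Adding k points creates at most k components, so, given the outside, a region G
contains a point with probability at most exp (q z |G|) - 1. This replaces independence in
Gouere's argument for the Boolean model: unless some ball in a region of size 100 a has radius
above a, a crossing at scale 10 a contains crossings at scale a in two disjoint regions, so the
worst conditional crossing probability satisfies c(10 a) <= C c(a)^2 + e(a), where e(a) -> 0 because
R^d is integrable.

Large intensity. Adding balls merges components, but only few components made of balls of radius
above s0 can meet a given bounded region, by packing. The balls of radius at most s0 are rare, as
Q({0}) = 0, and are removed at a comparatively small price. Hence n given cells are all vacant with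
probability at most kappa^n, with kappa -> 0. Call a box of level n + 1 bad if two of its 3 x 3
subboxes of level n are bad. Then level n is bad with probability at most (81 kappa)^(2^n), and the
good subboxes of a good box are connected to one another.
*)

theory Submission
  imports Defs
begin

section \<open>Clusters of a symmetric relation\<close>

text \<open>A configuration is locally finite only in its centres, so infinitely many large balls
  can meet a bounded \<open>\<Lambda>\<close>, and the limit in \<open>ncc_local\<close> needs an
  argument. Finitely many outer balls dominate: an outer ball that touches a given ball over
  \<open>\<Lambda>\<close> touches one of these few that touches the same ball. Beyond them the gain
  in clusters from the points over \<open>\<Lambda>\<close> only grows with the outer set, and it is
  at most their number, so it becomes constant. All changes of the exponent of \<open>q\<close> are
  then read off from finite sets.

  From the Gibbs property only occupation and vacancy of a region are estimated. The bound for
  occupation must hold given any outer event, because two crossings are multiplied by treating one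
  as an outer event for the other. For vacancy the danger is a point that merges many components,
  and packing excludes it only for radii bounded below. Since vacancies are then controlled through
  their number alone, badness of a box is witnessed by sets of exactly \<open>2 ^ n\<close> cells.
  With 9 subboxes there are at most 81 ordered pairs to choose at each branching, the origin of that
  constant.\<close>

definition linked :: "('v \<Rightarrow> 'v \<Rightarrow> bool) \<Rightarrow> 'v set \<Rightarrow> 'v \<Rightarrow> 'v \<Rightarrow> bool" where
  "linked T A = (\<lambda>p p'. p \<in> A \<and> p' \<in> A \<and> T p p')\<^sup>*\<^sup>*"

definition cluster :: "('v \<Rightarrow> 'v \<Rightarrow> bool) \<Rightarrow> 'v set \<Rightarrow> 'v \<Rightarrow> 'v set" where
  "cluster T A p = {p' \<in> A. linked T A p p'}"

definition clusters :: "('v \<Rightarrow> 'v \<Rightarrow> bool) \<Rightarrow> 'v set \<Rightarrow> 'v set set" where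
  "clusters T A = cluster T A ` A"

text \<open>The gain in clusters when \<open>Z\<close> is added to \<open>A\<close>. With
  \<open>Z\<close> the points over \<open>\<Lambda>\<close> and \<open>A\<close> a finite set of
  other points it is the difference whose limit defines \<open>ncc_local\<close>; it is negative
  when \<open>Z\<close> merges more clusters than it creates.\<close>

definition merging :: "('v \<Rightarrow> 'v \<Rightarrow> bool) \<Rightarrow> 'v set \<Rightarrow> 'v set \<Rightarrow> int" where
  "merging T Z A = int (card (clusters T (Z \<union> A))) - int (card (clusters T A))"

locale symmetric_relation =
  fixes T :: "'v \<Rightarrow> 'v \<Rightarrow> bool"
  assumes T_sym: "T x y \<Longrightarrow> T y x"
begin

lemma linked_refl [simp]: "linked T A p p"
  by (simp add: linked_def)

lemma linked_step: "p \<in> A \<Longrightarrow> p' \<in> A \<Longrightarrow> T p p' \<Longrightarrow> linked T A p p'"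
  unfolding linked_def by (rule r_into_rtranclp) simp

lemma linked_trans: "linked T A p p' \<Longrightarrow> linked T A p' p'' \<Longrightarrow> linked T A p p''"
  unfolding linked_def by (rule rtranclp_trans)

lemma linked_sym: "linked T A p p' \<Longrightarrow> linked T A p' p"
  unfolding linked_def
  by (rule sympD[OF symp_rtranclp]) (auto simp: symp_on_def intro: T_sym)

lemma linked_mono: "linked T A p p' \<Longrightarrow> A \<subseteq> B \<Longrightarrow> linked T B p p'"
  unfolding linked_def by (erule rtranclp_mono[THEN predicate2D, rotated]) auto

lemma linked_in: "linked T A p p' \<Longrightarrow> p \<in> A \<longleftrightarrow> p' \<in> A"
  unfolding linked_def by (induction rule: rtranclp_induct) auto

lemma linked_induct [consumes 1, case_names base step]:
  assumes "linked T A p p'" "P p"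
    and "\<And>u v. linked T A p u \<Longrightarrow> u \<in> A \<Longrightarrow> v \<in> A \<Longrightarrow> T u v \<Longrightarrow> P u \<Longrightarrow> P v"
  shows "P p'"
  using assms(1) unfolding linked_def
  by (induction rule: rtranclp_induct) (use assms(2,3) in \<open>auto simp: linked_def\<close>)

lemma cluster_self: "p \<in> A \<Longrightarrow> p \<in> cluster T A p"
  by (simp add: cluster_def)

lemma cluster_eq: "linked T A p p' \<Longrightarrow> cluster T A p = cluster T A p'"
  unfolding cluster_def using linked_trans[of A] linked_sym[of A] by (intro Collect_cong) metis

lemma clusters_cluster: "C \<in> clusters T A \<Longrightarrow> p \<in> C \<Longrightarrow> C = cluster T A p"
  unfolding clusters_def using cluster_eq[of A] by (auto simp: cluster_def)

lemma clusters_sub: "C \<in> clusters T A \<Longrightarrow> C \<subseteq> A"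
  by (auto simp: clusters_def cluster_def)

lemma clusters_ne: "C \<in> clusters T A \<Longrightarrow> C \<noteq> {}"
  by (auto simp: clusters_def dest: cluster_self)

lemma Union_clusters: "\<Union>(clusters T A) = A"
  unfolding clusters_def cluster_def using linked_refl by blast

lemma clusters_disj: "C \<in> clusters T A \<Longrightarrow> C' \<in> clusters T A \<Longrightarrow> C \<noteq> C' \<Longrightarrow> C \<inter> C' = {}"
  using clusters_cluster[of C A] clusters_cluster[of C' A] by blast

lemma finite_clusters: "finite A \<Longrightarrow> finite (clusters T A)"
  by (simp add: clusters_def)

lemma cluster_untouched:
  assumes "C \<in> clusters T A" "A \<subseteq> B" "\<And>p b. p \<in> C \<Longrightarrow> b \<in> B - A \<Longrightarrow> \<not> T p b"
  shows "C \<in> clusters T B"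
proof -
  obtain p where p: "p \<in> A" "C = cluster T A p" using assms(1) by (auto simp: clusters_def)
  have "p' \<in> C" if "linked T B p p'" for p'
    using that
  proof (induction rule: linked_induct)
    case base
    then show ?case using p cluster_self by auto
  next
    case (step u v)
    then have "v \<in> A" using assms(3) by blast
    then show ?case using step p linked_trans[of A p u v] linked_step[of u A v] by (auto simp: cluster_def)
  qed
  then have "cluster T B p = C"
    using linked_mono[OF _ assms(2)] p assms(2) by (auto simp: cluster_def)
  then show ?thesis using p assms(2) by (auto simp: clusters_def)
qed

text \<open>The clusters that \<open>b\<close> touches fuse with \<open>b\<close> into one cluster,
  and the others stay as they are. The equation is additive because the count can drop, which
  subtraction in \<open>nat\<close> would hide.\<close>

lemma card_clusters_insert:
  assumes fin: "finite A" and b: "b \<notin> A"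
  shows "card (clusters T (insert b A)) + card {C \<in> clusters T A. \<exists>p\<in>C. T p b} = card (clusters T A) + 1"
proof -
  let ?T = "{C \<in> clusters T A. \<exists>p\<in>C. T p b}" and ?U = "{C \<in> clusters T A. \<not> (\<exists>p\<in>C. T p b)}"
  let ?B = "insert b A"
  have eq: "clusters T ?B = insert (cluster T ?B b) ?U"
  proof (intro equalityI subsetI)
    fix C assume C: "C \<in> clusters T ?B"
    show "C \<in> insert (cluster T ?B b) ?U"
    proof (cases "b \<in> C")
      case True
      then have "C = cluster T ?B b" by (rule clusters_cluster[OF C])
      then show ?thesis by simp
    next
      case False
      obtain p where p: "p \<in> ?B" "C = cluster T ?B p" using C by (auto simp: clusters_def)
      have pA: "p \<in> A" using p False cluster_self by auto
      have sub: "linked T A p p'" if "linked T ?B p p'" for p'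
        using that
      proof (induction rule: linked_induct)
        case (step u v)
        have "v \<in> C" "u \<in> C" using step p linked_trans[of ?B p u v] linked_step[of u ?B v] by (auto simp: cluster_def)
        then have "u \<in> A" "v \<in> A" using False clusters_sub[OF C] by auto
        then show ?case using step linked_trans[of A p u v] linked_step[of u A v] by blast
      qed simp
      have "C = cluster T A p"
        using sub p pA linked_mono[of A _ _ ?B] linked_in[of A p] by (auto simp: cluster_def)
      moreover have "\<not> T p' b" if "p' \<in> C" for p'
      proof
        assume "T p' b"
        then have "linked T ?B p' b"
          using that clusters_sub[OF C] by (intro linked_step) auto
        then have "b \<in> C" using that p linked_trans[of ?B p p' b] by (auto simp: cluster_def)
        then show False using False by simp
      qed
      ultimately show ?thesis using pA by (auto simp: clusters_def)
    qed
  next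
    fix C assume "C \<in> insert (cluster T ?B b) ?U"
    then show "C \<in> clusters T ?B"
    proof
      assume "C = cluster T ?B b" then show ?thesis by (simp add: clusters_def)
    next
      assume C: "C \<in> ?U"
      show ?thesis
      proof (rule cluster_untouched)
        show "C \<in> clusters T A" using C by simp
        show "\<not> T p x" if "p \<in> C" "x \<in> ?B - A" for p x using that C by blast
      qed auto
    qed
  qed
  have "b \<in> cluster T ?B b" by (simp add: cluster_self)
  then have "cluster T ?B b \<notin> ?U" using clusters_sub[of _ A] b by blast
  then have "card (clusters T ?B) = Suc (card ?U)"
    unfolding eq using finite_clusters[OF fin] by simp
  moreover have "card (clusters T A) = card ?T + card ?U"
    using finite_clusters[OF fin]
    by (subst card_Un_disjoint[symmetric]) (auto intro!: arg_cong[of _ _ card])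
  ultimately show ?thesis by simp
qed

lemma card_clusters_union_le:
  assumes "finite A" "finite B"
  shows "card (clusters T (A \<union> B)) \<le> card (clusters T A) + card B"
  using assms(2)
proof (induction B)
  case (insert b B)
  show ?case
  proof (cases "b \<in> A")
    case True
    then have "A \<union> insert b B = A \<union> B" by auto
    then show ?thesis using insert by simp
  next
    case False
    then show ?thesis
      using card_clusters_insert[of "A \<union> B" b] insert assms(1) by (auto)
  qed
qed simp

text \<open>A cluster that no point of \<open>B\<close> touches survives unchanged, so only touched
  clusters can be lost.\<close>

lemma card_clusters_union_ge:
  assumes "finite A" "finite B"
  shows "card (clusters T A) \<le> card (clusters T (A \<union> B)) + card {C \<in> clusters T A. \<exists>p\<in>C. \<exists>b\<in>B. T p b}"
proof -
  let ?T = "{C \<in> clusters T A. \<exists>p\<in>C. \<exists>b\<in>B. T p b}"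
  have "clusters T A \<subseteq> clusters T (A \<union> B) \<union> ?T"
  proof
    fix C assume C: "C \<in> clusters T A"
    then show "C \<in> clusters T (A \<union> B) \<union> ?T"
      using cluster_untouched[OF C, of "A \<union> B"] by auto
  qed
  then have "card (clusters T A) \<le> card (clusters T (A \<union> B) \<union> ?T)"
    using assms by (intro card_mono finite_UnI finite_clusters) (auto simp: finite_clusters)
  then show ?thesis using card_Un_le le_trans by blast
qed

text \<open>Adding \<open>b\<close> costs as many clusters as it touches, less one, and it touches
  no more clusters of \<open>Z \<union> A\<close> than of \<open>A\<close>: by \<open>dom\<close>,
  whatever touches \<open>b\<close> in \<open>Z\<close> has a neighbour in \<open>A\<close> that
  touches \<open>b\<close> too, so each touched cluster of \<open>Z \<union> A\<close> contains a
  touched cluster of \<open>A\<close>.\<close>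

lemma merging_insert:
  assumes "finite A" "finite Z" "Z \<inter> insert b A = {}" "b \<notin> A"
    and dom: "\<And>x. x \<in> Z \<Longrightarrow> T x b \<Longrightarrow> \<exists>f\<in>A. T x f \<and> T f b"
  shows "merging T Z A \<le> merging T Z (insert b A)"
proof -
  let ?t = "\<lambda>A. {C \<in> clusters T A. \<exists>p\<in>C. T p b}"
  \<comment> \<open>Maps a cluster of \<open>A\<close> to the cluster of \<open>Z \<union> A\<close>
    that contains it, without choosing a representative.\<close>
  let ?g = "\<lambda>C. {p' \<in> Z \<union> A. \<exists>p\<in>C. linked T (Z \<union> A) p p'}"
  have "?t (Z \<union> A) \<subseteq> ?g ` ?t A"
  proof
    fix C assume "C \<in> ?t (Z \<union> A)"
    then obtain p where C: "C \<in> clusters T (Z \<union> A)" and p: "p \<in> C" "T p b" by auto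
    have "\<exists>f\<in>C \<inter> A. T f b"
    proof (cases "p \<in> A")
      case True
      then show ?thesis using p by auto
    next
      case False
      then have "p \<in> Z" using p clusters_sub[OF C] by auto
      then obtain f where f: "f \<in> A" "T p f" "T f b" using dom p by blast
      then have "f \<in> C" unfolding clusters_cluster[OF C p(1)] cluster_def
        using \<open>p \<in> Z\<close> by (auto intro: linked_step)
      then show ?thesis using f by auto
    qed
    then obtain f where f: "f \<in> C" "f \<in> A" "T f b" by auto
    have Cf: "C = cluster T (Z \<union> A) f" using clusters_cluster[OF C f(1)] .
    have "?g (cluster T A f) = C"
      unfolding Cf using f(2) linked_mono[of A f _ "Z \<union> A"] linked_trans[of "Z \<union> A" f]
      by (auto simp: cluster_def intro: exI[of _ f])
    moreover have "cluster T A f \<in> ?t A" using f cluster_self by (auto simp: clusters_def)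
    ultimately show "C \<in> ?g ` ?t A" by blast
  qed
  moreover have fin: "finite (?t A)" using finite_clusters[OF assms(1)] by simp
  ultimately have "card (?t (Z \<union> A)) \<le> card (?g ` ?t A)"
    by (intro card_mono finite_imageI)
  also have "\<dots> \<le> card (?t A)" using fin by (rule card_image_le)
  finally have "card (?t (Z \<union> A)) \<le> card (?t A)" .
  moreover have "card (clusters T (insert b (Z \<union> A))) + card (?t (Z \<union> A)) = card (clusters T (Z \<union> A)) + 1"
    using assms by (intro card_clusters_insert) auto
  moreover have "card (clusters T (insert b A)) + card (?t A) = card (clusters T A) + 1"
    using assms by (intro card_clusters_insert) auto
  ultimately show ?thesis by (simp add: merging_def)
qed

lemma merging_mono:
  assumes "finite B" "A \<subseteq> B" "finite Z" "Z \<inter> B = {}"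
    and dom: "\<And>x b. x \<in> Z \<Longrightarrow> b \<in> B \<Longrightarrow> T x b \<Longrightarrow> \<exists>f\<in>A. T x f \<and> T f b"
  shows "merging T Z A \<le> merging T Z B"
proof -
  have "merging T Z A \<le> merging T Z (A \<union> D)" if "D \<subseteq> B - A" "finite D" for D
    using that(2,1)
  proof (induction D)
    case (insert b D)
    have "merging T Z (A \<union> D) \<le> merging T Z (insert b (A \<union> D))"
      proof (intro merging_insert)
      show "finite (A \<union> D)" using assms(1,2) insert.hyps(1) finite_subset by auto
      show "Z \<inter> insert b (A \<union> D) = {}" "b \<notin> A \<union> D" using assms(2,4) insert.prems insert.hyps by auto
      show "\<exists>f\<in>A \<union> D. T x f \<and> T f b" if "x \<in> Z" "T x b" for x
        using dom[of x b] that insert.prems by auto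
    qed fact
    then show ?case using insert by auto
  qed simp
  from this[of "B - A"] show ?thesis using assms by (simp add: Un_absorb1)
qed

lemma merging_le:
  assumes "finite Z" "finite A"
  shows "merging T Z A \<le> int (card Z)"
  using card_clusters_union_le[OF assms(2,1)] by (simp add: merging_def Un_commute)

text \<open>\<open>merging T Z A\<close> increases with \<open>A\<close> once \<open>F \<subseteq> A\<close>, and it is bounded by \<open>card Z\<close>.\<close>
lemma merging_stable:
  assumes "finite Z" "Z \<inter> H = {}" "finite F" "F \<subseteq> H"
    and dom: "\<And>x b. x \<in> Z \<Longrightarrow> b \<in> H \<Longrightarrow> T x b \<Longrightarrow> \<exists>f\<in>F. T x f \<and> T f b"
  obtains k B where "finite B" "B \<subseteq> H" "\<And>A. finite A \<Longrightarrow> B \<subseteq> A \<Longrightarrow> A \<subseteq> H \<Longrightarrow> merging T Z A = k"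
proof -
  let ?m = "\<lambda>A. nat (int (card Z) - merging T Z A)"
  let ?P = "\<lambda>A. finite A \<and> F \<subseteq> A \<and> A \<subseteq> H"
  \<comment> \<open>\<open>merging T Z A\<close> is at most \<open>card Z\<close>, so
    \<open>nat\<close> truncates nothing in \<open>?m\<close> and a set of maximal merging exists as
    a minimiser of a natural number.\<close>
  define B where "B = arg_min ?m ?P"
  have B: "?P B" "\<And>A. ?P A \<Longrightarrow> ?m B \<le> ?m A"
    unfolding B_def using arg_min_natI[of ?P F ?m] arg_min_nat_le[of ?P _ ?m] assms(3,4) by auto
  have "merging T Z A = merging T Z B" if "finite A" "B \<subseteq> A" "A \<subseteq> H" for A
  proof (rule antisym)
    show "merging T Z B \<le> merging T Z A"
    proof (intro merging_mono)
      show "\<exists>f\<in>B. T x f \<and> T f b" if "x \<in> Z" "b \<in> A" "T x b" for x b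
        using dom[of x b] that \<open>A \<subseteq> H\<close> B(1) by blast
    qed (use that assms in auto)
    show "merging T Z A \<le> merging T Z B"
    proof -
      have "F \<subseteq> A" using that(2) B(1) by auto
      then have "?m B \<le> ?m A" using B(2)[of A] that by simp
      then show ?thesis
        using merging_le[OF assms(1), of A] merging_le[OF assms(1), of B] that B(1) by simp
    qed
  qed
  then show thesis using that B(1) by blast
qed

end

section \<open>Configurations and their atoms\<close>

lemma space_point_space: "space point_space = UNIV \<times> {0..}"
  by (simp add: point_space_def space_restrict_space)

lemma sets_point_space_iff:
  "A \<in> sets (point_space :: ('a::euclidean_space \<times> real) measure) \<longleftrightarrow> A \<in> sets borel \<and> A \<subseteq> UNIV \<times> {0..}"
proof -
  have "closed (UNIV \<times> {0..} :: ('a \<times> real) set)" by (intro closed_Times) auto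
  then have "UNIV \<times> {0..} \<in> sets (borel :: ('a \<times> real) measure)" by (rule borel_closed)
  then show ?thesis unfolding point_space_def
    by (subst sets_restrict_space_iff) auto
qed

lemma slab_in_sets [measurable]: "\<Lambda> \<in> sets borel \<Longrightarrow> \<Lambda> \<times> {0..} \<in> sets (point_space :: ('a::euclidean_space \<times> real) measure)"
  using measurable_slab[of \<Lambda>] by (simp add: space_point_space Times_Int_Times)

lemma rect_in_sets [measurable]:
  "\<Lambda> \<in> sets borel \<Longrightarrow> J \<in> sets borel \<Longrightarrow> J \<subseteq> {0..} \<Longrightarrow> \<Lambda> \<times> J \<in> sets (point_space :: ('a::euclidean_space \<times> real) measure)"
  unfolding sets_point_space_iff borel_prod[symmetric] by auto

lemma config_repr:
  fixes \<omega> :: "('a::euclidean_space \<times> real) measure"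
  assumes "\<omega> \<in> configurations"
  shows "\<exists>(I :: nat set) p. p \<in> I \<rightarrow> UNIV \<times> {0..} \<and> \<omega> = distr (count_space I) point_space p \<and>
      (\<forall>A\<in>sets point_space. emeasure \<omega> A = emeasure (count_space I) {i \<in> I. p i \<in> A}) \<and>
      (\<forall>\<Lambda>. bounded \<Lambda> \<longrightarrow> finite {i \<in> I. fst (p i) \<in> \<Lambda>})"
proof -
  have "\<exists>(I :: nat set) p. p \<in> I \<rightarrow> space point_space \<and> \<omega> = distr (count_space I) point_space p"
    using assms unfolding configurations_def by simp
  then obtain I :: "nat set" and p where Ip: "p \<in> I \<rightarrow> space point_space"
    "\<omega> = distr (count_space I) point_space p"
    by auto
  have em: "emeasure \<omega> A = emeasure (count_space I) {i \<in> I. p i \<in> A}" if "A \<in> sets point_space" for A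
    unfolding Ip(2) using that Ip(1)
    by (subst emeasure_distr) (auto intro!: arg_cong[of _ _ "emeasure _"])
  have "finite {i \<in> I. fst (p i) \<in> \<Lambda>}" if b: "bounded \<Lambda>" for \<Lambda>
  proof -
    \<comment> \<open>The bounded set need not be Borel, and the mass of a non-measurable slab is 0
      by convention; a ball around it is measurable and has finite mass.\<close>
    obtain r where r: "\<Lambda> \<subseteq> cball 0 r"
      using bounded_subset_ballD[OF b, of 0] ball_subset_cball by blast
    have "emeasure \<omega> (cball 0 r \<times> {0..}) < \<infinity>" using assms by (auto simp: configurations_def)
    then have "emeasure (count_space I) {i \<in> I. p i \<in> cball 0 r \<times> {0..}} < \<infinity>"
      using em[of "cball 0 r \<times> {0..}"] by (auto simp: slab_in_sets)
    then have "finite {i \<in> I. p i \<in> cball 0 r \<times> {0..}}"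
      by (subst (asm) emeasure_count_space) (auto split: if_splits)
    then show ?thesis using r Ip(1)
      by (elim rev_finite_subset) (auto simp: space_point_space Pi_iff mem_Times_iff)
  qed
  then show ?thesis using Ip em unfolding space_point_space by blast
qed

lemma config_distr:
  assumes "p \<in> I \<rightarrow> UNIV \<times> {0..}" "\<And>\<Lambda>. bounded \<Lambda> \<Longrightarrow> finite {i \<in> I. fst (p i) \<in> \<Lambda>}"
  shows "distr (count_space (I::nat set)) point_space p \<in> (configurations :: ('a::euclidean_space \<times> real) measure set)"
proof -
  have p: "p \<in> I \<rightarrow> space point_space" using assms(1) by (simp add: space_point_space)
  moreover have "emeasure (distr (count_space I) point_space p) (\<Lambda> \<times> {0..}) < \<infinity>" if "bounded \<Lambda>" for \<Lambda>
  proof (cases "\<Lambda> \<times> {0..} \<in> sets point_space")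
    case True
    have "finite (p -` (\<Lambda> \<times> {0..}) \<inter> space (count_space I))"
      by (rule finite_subset[OF _ assms(2)[OF that]]) auto
    then show ?thesis using True p by (subst emeasure_distr) (auto simp: emeasure_count_space less_top[symmetric])
  qed (simp add: emeasure_notin_sets)
  ultimately show ?thesis unfolding configurations_def by blast
qed

lemma sets_config [measurable_cong]: "\<omega> \<in> configurations \<Longrightarrow> sets \<omega> = sets point_space"
  by (rule sets_configuration)

lemma singleton_in_sets: "{p} \<in> sets (point_space :: ('a::euclidean_space \<times> real) measure) \<longleftrightarrow> 0 \<le> snd p"
  by (cases p) (auto simp: sets_point_space_iff)

lemma atoms_eq:
  assumes "p \<in> I \<rightarrow> UNIV \<times> {0..}" "\<And>A. A \<in> sets point_space \<Longrightarrow> emeasure \<omega> A = emeasure (count_space I) {i \<in> I. p i \<in> A}"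
    "sets \<omega> = sets point_space"
  shows "atoms \<omega> = p ` I"
proof -
  have "emeasure \<omega> {v} > 0 \<longleftrightarrow> v \<in> p ` I" for v
  proof (cases "0 \<le> snd v")
    case True
    then have "emeasure \<omega> {v} = emeasure (count_space I) {i \<in> I. p i = v}"
      using assms(2)[of "{v}"] by (simp add: singleton_in_sets)
    then show ?thesis by (auto simp: emeasure_count_space_eq_0 zero_less_iff_neq_zero)
  next
    case False
    then have "emeasure \<omega> {v} = 0" using assms(3) singleton_in_sets[of v] by (simp add: emeasure_notin_sets)
    then show ?thesis using False assms(1) by (auto simp: Pi_iff mem_Times_iff)
  qed
  then show ?thesis by (auto simp: atoms_def)
qed

lemma config_atoms:
  fixes \<omega> :: "('a::euclidean_space \<times> real) measure"
  assumes "\<omega> \<in> configurations"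
  shows atoms_radius: "\<And>p. p \<in> atoms \<omega> \<Longrightarrow> 0 \<le> snd p"
    and countable_atoms: "countable (atoms \<omega>)"
    and finite_atoms: "\<And>\<Lambda>. bounded \<Lambda> \<Longrightarrow> finite (atoms \<omega> \<inter> \<Lambda> \<times> UNIV)"
    and emeasure_eq_0_atoms: "\<And>A. A \<in> sets point_space \<Longrightarrow> emeasure \<omega> A = 0 \<longleftrightarrow> atoms \<omega> \<inter> A = {}"
proof -
  obtain I :: "nat set" and p :: "nat \<Rightarrow> 'a \<times> real" where Ip0: "p \<in> I \<rightarrow> UNIV \<times> {0..}"
      "\<omega> = distr (count_space I) point_space p"
      "\<forall>A\<in>sets point_space. emeasure \<omega> A = emeasure (count_space I) {i \<in> I. p i \<in> A}"
      "\<forall>\<Lambda>. bounded \<Lambda> \<longrightarrow> finite {i \<in> I. fst (p i) \<in> \<Lambda>}"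
    using config_repr[OF assms] by blast
  note Ip = Ip0(1) Ip0(3)[rule_format] Ip0(4)[rule_format]
  have a: "atoms \<omega> = p ` I" using atoms_eq[of p I \<omega>] Ip sets_config[OF assms] by blast
  show "0 \<le> snd q" if "q \<in> atoms \<omega>" for q using that Ip(1) a by (auto simp: Pi_iff mem_Times_iff)
  show "countable (atoms \<omega>)" unfolding a by simp
  show "finite (atoms \<omega> \<inter> \<Lambda> \<times> UNIV)" if "bounded \<Lambda>" for \<Lambda>
    by (rule finite_subset[OF _ finite_imageI[of _ p, OF Ip(3)[OF that]]]) (auto simp: a image_iff Bex_def; metis fst_conv)
  show "emeasure \<omega> A = 0 \<longleftrightarrow> atoms \<omega> \<inter> A = {}" if "A \<in> sets point_space" for A
    unfolding Ip(2)[OF that] a by (auto simp: emeasure_count_space_eq_0)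
qed

text \<open>Only an inequality, since an atom counts with its multiplicity on the right.\<close>

lemma card_atoms_le:
  fixes \<omega> :: "('a::euclidean_space \<times> real) measure"
  assumes "\<omega> \<in> configurations" "A \<in> sets point_space" "finite (atoms \<omega> \<inter> A)"
  shows "of_nat (card (atoms \<omega> \<inter> A)) \<le> emeasure \<omega> A"
proof -
  let ?B = "atoms \<omega> \<inter> A"
  have s: "{p} \<in> sets \<omega>" if "p \<in> ?B" for p
    using that atoms_radius[OF assms(1)] sets_config[OF assms(1)] singleton_in_sets by blast
  obtain I :: "nat set" and p :: "nat \<Rightarrow> 'a \<times> real" where Ip0: "p \<in> I \<rightarrow> UNIV \<times> {0..}"
      "\<omega> = distr (count_space I) point_space p"
      "\<forall>A\<in>sets point_space. emeasure \<omega> A = emeasure (count_space I) {i \<in> I. p i \<in> A}"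
      "\<forall>\<Lambda>. bounded \<Lambda> \<longrightarrow> finite {i \<in> I. fst (p i) \<in> \<Lambda>}"
    using config_repr[OF assms(1)] by blast
  note Ip = Ip0(1) Ip0(3)[rule_format] Ip0(4)[rule_format]
  have a: "atoms \<omega> = p ` I" using atoms_eq[of p I \<omega>] Ip sets_config[OF assms(1)] by blast
  have "?B = p ` {i \<in> I. p i \<in> A}" by (auto simp: a)
  then have "card ?B \<le> card {i \<in> I. p i \<in> A}" if "finite {i \<in> I. p i \<in> A}"
    using card_image_le[OF that, of p] by simp
  then show ?thesis unfolding Ip(2)[OF assms(2)]
    by (subst emeasure_count_space) auto
qed

text \<open>Restriction to a region of positions and radii together, as the estimates single out
  balls by radius as well as by centre; on slabs it is \<open>config_restrict\<close>.\<close>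

definition restr :: "('a::euclidean_space \<times> real) set \<Rightarrow> ('a \<times> real) measure \<Rightarrow> ('a \<times> real) measure" where
  "restr G \<omega> = density \<omega> (indicator G)"

lemma emeasure_restr:
  fixes \<omega> :: "('a::euclidean_space \<times> real) measure"
  assumes "G \<in> sets point_space" "\<omega> \<in> configurations" "A \<in> sets point_space"
  shows "emeasure (restr G \<omega>) A = emeasure \<omega> (A \<inter> G)"
proof -
  have "emeasure (restr G \<omega>) A = (\<integral>\<^sup>+ x. indicator G x * indicator A x \<partial>\<omega>)"
    unfolding restr_def using assms sets_config[OF assms(2)]
    by (subst emeasure_density) (auto intro!: borel_measurable_indicator)
  also have "\<dots> = (\<integral>\<^sup>+ x. indicator (A \<inter> G) x \<partial>\<omega>)"
    by (intro nn_integral_cong) (auto simp: indicator_def)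
  finally show ?thesis using assms sets_config[OF assms(2)] by simp
qed

lemma config_restrict_restr:
  assumes "\<Lambda> \<in> sets borel" "\<omega> \<in> configurations"
  shows "config_restrict \<Lambda> \<omega> = restr (\<Lambda> \<times> {0..}) \<omega>"
proof (rule measure_eqI)
  fix A assume A: "A \<in> sets (config_restrict \<Lambda> \<omega>)"
  then have A': "A \<in> sets point_space" using sets_config[OF assms(2)] by (simp add: config_restrict_def)
  then have "A \<inter> \<Lambda> \<times> UNIV = A \<inter> \<Lambda> \<times> {0..}" using sets.sets_into_space[OF A'] by (auto simp: space_point_space)
  then show "emeasure (config_restrict \<Lambda> \<omega>) A = emeasure (restr (\<Lambda> \<times> {0..}) \<omega>) A"
    using emeasure_config_restrict[OF assms A'] emeasure_restr[OF slab_in_sets[OF assms(1)] assms(2) A'] by simp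
qed (simp add: config_restrict_def restr_def)

lemma restr_config:
  fixes G :: "('a::euclidean_space \<times> real) set"
  assumes G: "G \<in> sets point_space" and w: "\<omega> \<in> configurations"
  shows "restr G \<omega> \<in> configurations"
proof -
  obtain I :: "nat set" and p :: "nat \<Rightarrow> 'a \<times> real" where Ip0: "p \<in> I \<rightarrow> UNIV \<times> {0..}"
      "\<omega> = distr (count_space I) point_space p"
      "\<forall>A\<in>sets point_space. emeasure \<omega> A = emeasure (count_space I) {i \<in> I. p i \<in> A}"
      "\<forall>\<Lambda>. bounded \<Lambda> \<longrightarrow> finite {i \<in> I. fst (p i) \<in> \<Lambda>}"
    using config_repr[OF w] by blast
  note Ip = Ip0(1) Ip0(3)[rule_format] Ip0(4)[rule_format]
  let ?J = "{i \<in> I. p i \<in> G}"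
  have p: "p \<in> ?J \<rightarrow> space point_space" using Ip(1) by (auto simp: space_point_space)
  have "restr G \<omega> = distr (count_space ?J) point_space p"
  proof (rule measure_eqI)
    show "sets (restr G \<omega>) = sets (distr (count_space ?J) point_space p)"
      by (simp add: restr_def sets_config[OF w])
    fix A assume "A \<in> sets (restr G \<omega>)"
    then have A: "A \<in> sets point_space" by (simp add: restr_def sets_config[OF w])
    have e: "{i \<in> I. p i \<in> A \<inter> G} = p -` A \<inter> ?J" by auto
    have "emeasure (restr G \<omega>) A = emeasure (count_space I) (p -` A \<inter> ?J)"
      using emeasure_restr[OF G w A] Ip(2)[of "A \<inter> G"] A G unfolding e by simp
    also have "\<dots> = emeasure (count_space ?J) (p -` A \<inter> ?J)"
      by (subst emeasure_count_space, blast, subst emeasure_count_space, blast, rule refl)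
    also have "\<dots> = emeasure (distr (count_space ?J) point_space p) A"
      using p A by (subst emeasure_distr) auto
    finally show "emeasure (restr G \<omega>) A = emeasure (distr (count_space ?J) point_space p) A" .
  qed
  moreover have "distr (count_space ?J) point_space p \<in> configurations"
  proof (rule config_distr)
    show "finite {i \<in> ?J. fst (p i) \<in> \<Lambda>}" if "bounded \<Lambda>" for \<Lambda>
      by (rule finite_subset[OF _ Ip(3)[OF that]]) auto
  qed (use Ip(1) in auto)
  ultimately show ?thesis by simp
qed

lemma atoms_restr:
  assumes "G \<in> sets point_space" "\<omega> \<in> configurations"
  shows "atoms (restr G \<omega>) = atoms \<omega> \<inter> G"
proof -
  have "emeasure (restr G \<omega>) {v} > 0 \<longleftrightarrow> emeasure \<omega> {v} > 0 \<and> v \<in> G" for v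
  proof (cases "0 \<le> snd v")
    case True
    then show ?thesis using emeasure_restr[OF assms, of "{v}"] by (cases "v \<in> G") (auto simp: singleton_in_sets)
  next
    case False
    then have "{v} \<notin> sets \<omega>" "{v} \<notin> sets (restr G \<omega>)"
      by (auto simp: singleton_in_sets sets_config[OF assms(2)] restr_def)
    then show ?thesis by (simp add: emeasure_notin_sets)
  qed
  then show ?thesis by (auto simp: atoms_def)
qed

lemma config_restrict_config:
  assumes "\<Lambda> \<in> sets borel" "\<omega> \<in> configurations"
  shows "config_restrict \<Lambda> \<omega> \<in> configurations"
  using restr_config[OF slab_in_sets] config_restrict_restr assms by metis

lemma atoms_config_restrict:
  assumes "\<Lambda> \<in> sets borel" "\<omega> \<in> configurations"
  shows "atoms (config_restrict \<Lambda> \<omega>) = atoms \<omega> \<inter> \<Lambda> \<times> UNIV"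
  using atoms_restr[OF slab_in_sets[OF assms(1)] assms(2)] config_restrict_restr[OF assms] atoms_radius[OF assms(2)]
  by auto

lemma sets_config_add [simp]: "sets (config_add \<omega> \<omega>') = sets point_space"
  by (simp add: config_add_def)

lemma config_add_config:
  fixes \<omega> :: "('a::euclidean_space \<times> real) measure"
  assumes w: "\<omega> \<in> configurations" and w': "\<omega>' \<in> configurations"
  shows "config_add \<omega> \<omega>' \<in> configurations"
proof -
  obtain I :: "nat set" and p :: "nat \<Rightarrow> 'a \<times> real" where Ip0: "p \<in> I \<rightarrow> UNIV \<times> {0..}"
      "\<omega> = distr (count_space I) point_space p"
      "\<forall>A\<in>sets point_space. emeasure \<omega> A = emeasure (count_space I) {i \<in> I. p i \<in> A}"
      "\<forall>\<Lambda>. bounded \<Lambda> \<longrightarrow> finite {i \<in> I. fst (p i) \<in> \<Lambda>}"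
    using config_repr[OF w] by blast
  note Ip = Ip0(1) Ip0(3)[rule_format] Ip0(4)[rule_format]
  obtain J :: "nat set" and r :: "nat \<Rightarrow> 'a \<times> real" where Jr0: "r \<in> J \<rightarrow> UNIV \<times> {0..}"
      "\<omega>' = distr (count_space J) point_space r"
      "\<forall>A\<in>sets point_space. emeasure \<omega>' A = emeasure (count_space J) {i \<in> J. r i \<in> A}"
      "\<forall>\<Lambda>. bounded \<Lambda> \<longrightarrow> finite {i \<in> J. fst (r i) \<in> \<Lambda>}"
    using config_repr[OF w'] by blast
  note Jr = Jr0(1) Jr0(3)[rule_format] Jr0(4)[rule_format]
  \<comment> \<open>Even indices enumerate the points of \<open>\<omega>\<close>, odd ones those of
    \<open>\<omega>'\<close>.\<close>
  define K where "K = (\<lambda>i. 2 * i) ` I \<union> (\<lambda>i. 2 * i + 1) ` J"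
  define s where "s k = (if even k then p (k div 2) else r (k div 2))" for k
  have K: "s \<in> K \<rightarrow> UNIV \<times> {0..}" using Ip(1) Jr(1) by (auto simp: K_def s_def Pi_iff)
  have split: "{k \<in> K. s k \<in> A} = (\<lambda>i. 2 * i) ` {i \<in> I. p i \<in> A} \<union> (\<lambda>i. 2 * i + 1) ` {i \<in> J. r i \<in> A}" for A
    by (auto simp: K_def s_def)
  have ev: "2 * i \<noteq> 2 * j + (1::nat)" for i j by presburger
  have em: "emeasure (count_space K) {k \<in> K. s k \<in> A} =
      emeasure (count_space I) {i \<in> I. p i \<in> A} + emeasure (count_space J) {i \<in> J. r i \<in> A}" for A
  proof -
    have 1: "emeasure (count_space K) ((\<lambda>i. 2 * i) ` {i \<in> I. p i \<in> A}) = emeasure (count_space I) {i \<in> I. p i \<in> A}"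
      by (subst emeasure_count_space, force simp: K_def, subst emeasure_count_space, force)
         (simp add: card_image finite_image_iff inj_on_def)
    have 2: "emeasure (count_space K) ((\<lambda>i. 2 * i + 1) ` {i \<in> J. r i \<in> A}) = emeasure (count_space J) {i \<in> J. r i \<in> A}"
      by (subst emeasure_count_space, force simp: K_def, subst emeasure_count_space, force)
         (simp add: card_image finite_image_iff inj_on_def)
    show ?thesis unfolding split 1[symmetric] 2[symmetric]
      by (rule plus_emeasure[symmetric]) (use ev in \<open>auto simp: K_def\<close>)
  qed
  have "config_add \<omega> \<omega>' = distr (count_space K) point_space s"
  proof (rule measure_eqI)
    fix A assume "A \<in> sets (config_add \<omega> \<omega>')"
    then have A: "A \<in> sets point_space" by simp
    have "emeasure (config_add \<omega> \<omega>') A = emeasure (count_space K) {k \<in> K. s k \<in> A}"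
      using emeasure_config_add[OF sets_config[OF w] sets_config[OF w'] A] Ip(2)[OF A] Jr(2)[OF A] em by simp
    also have "\<dots> = emeasure (distr (count_space K) point_space s) A"
      using K A by (subst emeasure_distr) (auto simp: space_point_space Pi_iff intro!: arg_cong[of _ _ "emeasure _"])
    finally show "emeasure (config_add \<omega> \<omega>') A = emeasure (distr (count_space K) point_space s) A" .
  qed simp
  moreover have "distr (count_space K) point_space s \<in> configurations"
  proof (rule config_distr[OF K])
    fix \<Lambda> :: "'a set" assume b: "bounded \<Lambda>"
    have "{k \<in> K. fst (s k) \<in> \<Lambda>} = (\<lambda>i. 2 * i) ` {i \<in> I. fst (p i) \<in> \<Lambda>} \<union> (\<lambda>i. 2 * i + 1) ` {i \<in> J. fst (r i) \<in> \<Lambda>}"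
      by (auto simp: K_def s_def)
    then show "finite {k \<in> K. fst (s k) \<in> \<Lambda>}" using Ip(3)[OF b] Jr(3)[OF b] by simp
  qed
  ultimately show ?thesis by simp
qed

lemma atoms_config_add:
  assumes w: "\<omega> \<in> configurations" and w': "\<omega>' \<in> configurations"
  shows "atoms (config_add \<omega> \<omega>') = atoms \<omega> \<union> atoms \<omega>'"
proof -
  have "emeasure (config_add \<omega> \<omega>') {v} > 0 \<longleftrightarrow> emeasure \<omega> {v} > 0 \<or> emeasure \<omega>' {v} > 0" for v
  proof (cases "0 \<le> snd v")
    case True
    then have "emeasure (config_add \<omega> \<omega>') {v} = emeasure \<omega> {v} + emeasure \<omega>' {v}"
      using emeasure_config_add[OF sets_config[OF w] sets_config[OF w'], of "{v}"] by (simp add: singleton_in_sets)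
    then show ?thesis by (auto simp: zero_less_iff_neq_zero)
  next
    case False
    then have "{v} \<notin> sets \<omega>" "{v} \<notin> sets \<omega>'" "{v} \<notin> sets (config_add \<omega> \<omega>')"
      by (auto simp: singleton_in_sets sets_config[OF w] sets_config[OF w'])
    then show ?thesis by (simp add: emeasure_notin_sets)
  qed
  then show ?thesis by (auto simp: atoms_def)
qed

section \<open>Measurability of counts, restrictions and sums\<close>

text \<open>The generators of \<open>config_space\<close> only involve bounded sets; an arbitrary
  set is the increasing union of its bounded parts, cut off in position and in radius.\<close>

lemma measurable_count:
  fixes A :: "('a::euclidean_space \<times> real) set"
  assumes A: "A \<in> sets point_space"
  shows "(\<lambda>\<omega>. emeasure \<omega> A) \<in> borel_measurable config_space"
proof -
  have bd: "(\<lambda>\<omega>. emeasure \<omega> A) \<in> borel_measurable config_space"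
    if "A \<in> sets point_space" "bounded A" for A :: "('a \<times> real) set"
  proof (rule measurableI)
    fix B :: "ennreal set" assume "B \<in> sets borel"
    then show "(\<lambda>\<omega>. emeasure \<omega> A) -` B \<inter> space config_space \<in> sets config_space"
      unfolding config_space_def using that
      by (subst sets_measure_of) (auto simp: space_config_space[unfolded config_space_def] intro!: sigma_sets.Basic)
  qed simp
  define D where "D n = A \<inter> (cball 0 (real n) \<times> {0..real n})" for n
  have D: "D n \<in> sets point_space" for n
    unfolding D_def using A by (intro sets.Int rect_in_sets) auto
  have "bounded (D n)" for n
    unfolding D_def by (rule bounded_subset[of "cball 0 (real n) \<times> {0..real n}"]) (auto intro!: bounded_Times)
  note m = bd[OF D this]
  have "incseq D" by (auto simp: D_def incseq_def)
  have U: "(\<Union>n. D n) = A"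
  proof
    show "A \<subseteq> (\<Union>n. D n)"
    proof
      fix p assume p: "p \<in> A"
      obtain n :: nat where n: "max (norm (fst p)) (snd p) \<le> real n" using real_arch_simple by blast
      have "0 \<le> snd p" using p sets.sets_into_space[OF A] by (auto simp: space_point_space)
      then show "p \<in> (\<Union>n. D n)" using p n by (auto simp: D_def mem_Times_iff intro!: exI[of _ n])
    qed
  qed (auto simp: D_def)
  have "emeasure \<omega> A = (SUP n. emeasure \<omega> (D n))" if "\<omega> \<in> space config_space" for \<omega>
  proof -
    have "range D \<subseteq> sets \<omega>" using that D by (auto simp: space_config_space sets_config)
    from SUP_emeasure_incseq[OF this \<open>incseq D\<close>] show ?thesis by (simp add: U)
  qed
  moreover have "(\<lambda>\<omega>. SUP n. emeasure \<omega> (D n)) \<in> borel_measurable config_space"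
    by (intro borel_measurable_SUP) (auto simp: m)
  ultimately show ?thesis by (simp cong: measurable_cong)
qed

lemma sets_configurations: "configurations \<in> sets config_space"
  using sets.top[of config_space] by (simp add: space_config_space)

lemma sets_vacant:
  assumes "G \<in> sets point_space"
  shows "{\<omega> \<in> configurations. atoms \<omega> \<inter> G = {}} \<in> sets config_space"
proof -
  have "{\<omega> \<in> configurations. atoms \<omega> \<inter> G = {}} = {\<omega> \<in> space config_space. emeasure \<omega> G = 0}"
    using emeasure_eq_0_atoms[OF _ assms] by (auto simp: space_config_space)
  also have "\<dots> \<in> sets config_space" using measurable_count[OF assms] by measurable
  finally show ?thesis .
qed

lemma sets_occupied:
  assumes "G \<in> sets point_space"
  shows "{\<omega> \<in> configurations. atoms \<omega> \<inter> G \<noteq> {}} \<in> sets config_space"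
proof -
  have "{\<omega> \<in> configurations. atoms \<omega> \<inter> G \<noteq> {}} = configurations - {\<omega> \<in> configurations. atoms \<omega> \<inter> G = {}}"
    by auto
  then show ?thesis using sets.Diff[OF sets_configurations sets_vacant[OF assms]] by simp
qed

lemma measurable_into_config_space:
  fixes f :: "'x \<Rightarrow> ('a::euclidean_space \<times> real) measure"
  assumes "\<And>x. x \<in> space M \<Longrightarrow> f x \<in> configurations"
    "\<And>A. A \<in> sets point_space \<Longrightarrow> (\<lambda>x. emeasure (f x) A) \<in> borel_measurable M"
  shows "f \<in> measurable M config_space"
  unfolding config_space_def
proof (rule measurable_measure_of)
  fix Y :: "('a \<times> real) measure set" assume "Y \<in> {(\<lambda>\<omega>. emeasure \<omega> \<Gamma>) -` B \<inter> configurations | \<Gamma> B.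
       \<Gamma> \<in> sets point_space \<and> bounded \<Gamma> \<and> B \<in> sets borel}"
  then obtain \<Gamma> B where Y: "Y = (\<lambda>\<omega>. emeasure \<omega> \<Gamma>) -` B \<inter> configurations" "\<Gamma> \<in> sets point_space" "B \<in> sets borel"
    by auto
  have "f -` Y \<inter> space M = (\<lambda>x. emeasure (f x) \<Gamma>) -` B \<inter> space M" using assms(1) Y by auto
  then show "f -` Y \<inter> space M \<in> sets M" using measurable_sets[OF assms(2)[OF Y(2)] Y(3)] by simp
qed (use assms in auto)

lemma measurable_restr:
  fixes G :: "('a::euclidean_space \<times> real) set"
  assumes "G \<in> sets point_space"
  shows "restr G \<in> measurable config_space config_space"
proof (rule measurable_into_config_space)
  fix A assume A: "A \<in> sets (point_space :: ('a \<times> real) measure)"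
  have "(\<lambda>\<omega>. emeasure \<omega> (A \<inter> G)) \<in> borel_measurable config_space"
    using A assms by (intro measurable_count) auto
  then show "(\<lambda>x. emeasure (restr G x) A) \<in> borel_measurable config_space"
    by (rule measurable_cong[THEN iffD1, rotated]) (simp add: emeasure_restr[OF assms _ A] space_config_space)
qed (simp add: restr_config[OF assms] space_config_space)

lemma measurable_config_restrict:
  fixes \<Lambda> :: "'a::euclidean_space set"
  assumes "\<Lambda> \<in> sets borel"
  shows "config_restrict \<Lambda> \<in> measurable config_space config_space"
  using measurable_restr[OF slab_in_sets[OF assms]]
  by (rule measurable_cong[THEN iffD1, rotated]) (simp add: config_restrict_restr[OF assms] space_config_space)

lemma measurable_config_add:
  fixes f g :: "'x \<Rightarrow> ('a::euclidean_space \<times> real) measure"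
  assumes f: "f \<in> measurable M config_space" and g: "g \<in> measurable M config_space"
  shows "(\<lambda>x. config_add (f x) (g x)) \<in> measurable M config_space"
proof (rule measurable_into_config_space)
  have fg: "f x \<in> configurations" "g x \<in> configurations" if "x \<in> space M" for x
    using measurable_space[OF f that] measurable_space[OF g that] by (auto simp: space_config_space)
  then show "config_add (f x) (g x) \<in> configurations" if "x \<in> space M" for x
    using config_add_config that by auto
  fix A assume A: "A \<in> sets (point_space :: ('a \<times> real) measure)"
  have "(\<lambda>x. emeasure (f x) A + emeasure (g x) A) \<in> borel_measurable M"
    using measurable_compose[OF f measurable_count[OF A]] measurable_compose[OF g measurable_count[OF A]] by simp
  then show "(\<lambda>x. emeasure (config_add (f x) (g x)) A) \<in> borel_measurable M"
    by (rule measurable_cong[THEN iffD1, rotated])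
       (simp add: emeasure_config_add[OF sets_config sets_config A] fg)
qed


section \<open>Integrals and quantifiers over the points of a random configuration\<close>

text \<open>A random configuration is a kernel of possibly infinite measures, so the complement step
  of the induction cannot subtract masses directly. Intersecting with the slabs \<open>D n\<close>,
  whose masses are finite, repairs this, and the supremum over \<open>n\<close> removes the slabs
  again.\<close>

lemma measurable_kernel_emeasure:
  fixes w :: "'x \<Rightarrow> ('a::euclidean_space \<times> real) measure"
  assumes w: "w \<in> measurable M config_space" and E: "E \<in> sets (M \<Otimes>\<^sub>M point_space)"
  shows "(\<lambda>x. emeasure (w x) (Pair x -` E)) \<in> borel_measurable M"
proof -
  let ?N = "point_space :: ('a \<times> real) measure"
  have wx: "w x \<in> configurations" if "x \<in> space M" for x
    using measurable_space[OF w that] by (simp add: space_config_space)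
  have m: "(\<lambda>x. emeasure (w x) A) \<in> borel_measurable M" if "A \<in> sets ?N" for A
    using measurable_compose[OF w measurable_count[OF that]] .
  define D where "D n = cball (0::'a) (real n) \<times> {0::real..}" for n
  have D: "D n \<in> sets ?N" for n by (auto simp: D_def)
  have sec: "Pair x -` F \<in> sets ?N" if "F \<in> sets (M \<Otimes>\<^sub>M ?N)" for F x
    using sets_Pair1[OF that] by simp
  have Dfin: "emeasure (w x) (B \<inter> D n) \<noteq> \<infinity>" if "x \<in> space M" for x n B
  proof -
    have "emeasure (w x) (D n) < \<infinity>" using wx[OF that] by (auto simp: configurations_def D_def)
    moreover have "emeasure (w x) (B \<inter> D n) \<le> emeasure (w x) (D n)"
      using D wx[OF that] by (intro emeasure_mono) (auto simp: sets_config)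
    ultimately show ?thesis by auto
  qed
  have fin: "(\<lambda>x. emeasure (w x) (Pair x -` E \<inter> D n)) \<in> borel_measurable M" for n
    using Int_stable_pair_measure_generator[of M ?N] pair_measure_closed[of M ?N] E
    unfolding sets_pair_measure
  proof (induct rule: sigma_sets_induct_disjoint)
    case (basic F)
    then obtain A B where F: "F = A \<times> B" "A \<in> sets M" "B \<in> sets ?N" by auto
    have "(\<lambda>x. indicator A x * emeasure (w x) (B \<inter> D n)) \<in> borel_measurable M"
      using F D by (intro borel_measurable_times_ennreal m borel_measurable_indicator) auto
    then show ?case
      by (rule measurable_cong[THEN iffD1, rotated]) (auto simp: F indicator_def)
  next
    case empty then show ?case by simp
  next
    case (compl F)
    then have F: "F \<in> sets (M \<Otimes>\<^sub>M ?N)" by (simp add: sets_pair_measure)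
    have "emeasure (w x) (Pair x -` (space M \<times> space ?N - F) \<inter> D n) =
        emeasure (w x) (D n) - emeasure (w x) (Pair x -` F \<inter> D n)" if x: "x \<in> space M" for x
    proof -
      have "Pair x -` (space M \<times> space ?N - F) \<inter> D n = D n - (Pair x -` F \<inter> D n)"
        using x by (auto simp: D_def space_point_space)
      moreover have "emeasure (w x) (D n - (Pair x -` F \<inter> D n)) =
          emeasure (w x) (D n) - emeasure (w x) (Pair x -` F \<inter> D n)"
        using sec[OF F, of x] D[of n] wx[OF x] Dfin[OF x]
        by (intro emeasure_Diff) (auto simp: sets_config)
      ultimately show ?thesis by simp
    qed
    moreover have "(\<lambda>x. emeasure (w x) (D n) - emeasure (w x) (Pair x -` F \<inter> D n)) \<in> borel_measurable M"
      using compl m[OF D] by (intro borel_measurable_minus_ennreal)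
    ultimately show ?case by (simp cong: measurable_cong)
  next
    case (union F)
    then have F: "F i \<in> sets (M \<Otimes>\<^sub>M ?N)" for i by (auto simp: sets_pair_measure)
    have "emeasure (w x) (Pair x -` (\<Union>i. F i) \<inter> D n) = (\<Sum>i. emeasure (w x) (Pair x -` F i \<inter> D n))"
      if x: "x \<in> space M" for x
    proof -
      have "(\<Sum>i. emeasure (w x) (Pair x -` F i \<inter> D n)) = emeasure (w x) (\<Union>i. Pair x -` F i \<inter> D n)"
        using union(1) sec[OF F, of x] D[of n] wx[OF x]
        by (intro suminf_emeasure) (auto simp: disjoint_family_on_def sets_config)
      also have "(\<Union>i. Pair x -` F i \<inter> D n) = Pair x -` (\<Union>i. F i) \<inter> D n" by auto
      finally show ?thesis by simp
    qed
    moreover have "(\<lambda>x. \<Sum>i. emeasure (w x) (Pair x -` F i \<inter> D n)) \<in> borel_measurable M"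
      using union(3) by (intro borel_measurable_suminf_order) auto
    ultimately show ?case by (simp cong: measurable_cong)
  qed
  have "emeasure (w x) (Pair x -` E) = (SUP n. emeasure (w x) (Pair x -` E \<inter> D n))" if x: "x \<in> space M" for x
  proof -
    have "range (\<lambda>n. Pair x -` E \<inter> D n) \<subseteq> sets (w x)"
      using sec[OF E, of x] D wx[OF x] by (auto simp: sets_config)
    moreover have "incseq (\<lambda>n. Pair x -` E \<inter> D n)" by (auto simp: D_def incseq_def)
    moreover have "(\<Union>n. Pair x -` E \<inter> D n) = Pair x -` E"
    proof
      show "Pair x -` E \<subseteq> (\<Union>n. Pair x -` E \<inter> D n)"
      proof
        fix p assume p: "p \<in> Pair x -` E"
        obtain n :: nat where n: "norm (fst p) \<le> real n" using real_arch_simple by blast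
        have "0 \<le> snd p" using p sets.sets_into_space[OF sec[OF E, of x]] by (auto simp: space_point_space)
        then show "p \<in> (\<Union>n. Pair x -` E \<inter> D n)" using p n by (auto simp: D_def mem_Times_iff)
      qed
    qed auto
    ultimately show ?thesis using SUP_emeasure_incseq by metis
  qed
  moreover have "(\<lambda>x. SUP n. emeasure (w x) (Pair x -` E \<inter> D n)) \<in> borel_measurable M"
    by (intro borel_measurable_SUP) (auto simp: fin)
  ultimately show ?thesis by (simp cong: measurable_cong)
qed

lemma measurable_kernel_integral:
  fixes w :: "'x \<Rightarrow> ('a::euclidean_space \<times> real) measure"
  assumes w: "w \<in> measurable M config_space" and f: "f \<in> borel_measurable (M \<Otimes>\<^sub>M point_space)"
  shows "(\<lambda>x. \<integral>\<^sup>+ p. f (x, p) \<partial>w x) \<in> borel_measurable M"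
  using f
proof induct
  have wx: "sets (w x) = sets point_space" if "x \<in> space M" for x
    using measurable_space[OF w that] by (simp add: space_config_space sets_config)
  have sp: "space (w x) = space point_space" if "x \<in> space M" for x
    using sets_eq_imp_space_eq[OF wx[OF that]] .
  {
    case (cong f g)
    have "(\<integral>\<^sup>+ p. f (x, p) \<partial>w x) = (\<integral>\<^sup>+ p. g (x, p) \<partial>w x)" if "x \<in> space M" for x
      using cong(3) that by (intro nn_integral_cong) (auto simp: sp space_pair_measure)
    then show ?case using cong by (simp cong: measurable_cong)
  next
    case (set E)
    have "(\<integral>\<^sup>+ p. indicator E (x, p) \<partial>w x) = emeasure (w x) (Pair x -` E)" if "x \<in> space M" for x
    proof -
      have "(\<integral>\<^sup>+ p. indicator E (x, p) \<partial>w x) = (\<integral>\<^sup>+ p. indicator (Pair x -` E) p \<partial>w x)"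
        by (intro nn_integral_cong) (auto simp: indicator_def)
      then show ?thesis using sets_Pair1[OF set, of x] wx[OF that] by simp
    qed
    then show ?case using measurable_kernel_emeasure[OF w set] by (simp cong: measurable_cong)
  next
    case (mult u c)
    have "(\<integral>\<^sup>+ p. c * u (x, p) \<partial>w x) = c * (\<integral>\<^sup>+ p. u (x, p) \<partial>w x)" if "x \<in> space M" for x
      using measurable_Pair2[OF mult(2) that] by (intro nn_integral_cmult) (simp add: measurable_cong_sets[OF wx[OF that]])
    then show ?case using mult by (simp cong: measurable_cong)
  next
    case (add u v)
    have "(\<integral>\<^sup>+ p. v (x, p) + u (x, p) \<partial>w x) = (\<integral>\<^sup>+ p. v (x, p) \<partial>w x) + (\<integral>\<^sup>+ p. u (x, p) \<partial>w x)" if "x \<in> space M" for x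
      using measurable_Pair2[OF add(1) that] measurable_Pair2[OF add(4) that]
      by (intro nn_integral_add) (simp_all add: measurable_cong_sets[OF wx[OF that]])
    then show ?case using add by (simp cong: measurable_cong)
  next
    case (seq U)
    have "(\<integral>\<^sup>+ p. (SUP i. U i) (x, p) \<partial>w x) = (SUP i. \<integral>\<^sup>+ p. U i (x, p) \<partial>w x)" if "x \<in> space M" for x
      unfolding SUP_apply using measurable_Pair2[OF seq(1) that] seq(4)
      by (intro nn_integral_monotone_convergence_SUP)
         (auto simp: measurable_cong_sets[OF wx[OF that]] incseq_def le_fun_def)
    moreover have "(\<lambda>x. SUP i. \<integral>\<^sup>+ p. U i (x, p) \<partial>w x) \<in> borel_measurable M"
      using seq by (intro borel_measurable_SUP) auto
    ultimately show ?case by (simp cong: measurable_cong)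
  }
qed

text \<open>Some atom has the property exactly when the set of points with the property has positive
  mass. This turns a quantifier over a random set into a measurable function of \<open>x\<close>,
  and it can be iterated for nested quantifiers.\<close>

lemma pred_atoms_Bex:
  fixes w :: "'x \<Rightarrow> ('a::euclidean_space \<times> real) measure"
  assumes w: "w \<in> measurable M config_space" and P: "Measurable.pred (M \<Otimes>\<^sub>M point_space) (\<lambda>(x, p). P x p)"
  shows "Measurable.pred M (\<lambda>x. \<exists>p\<in>atoms (w x). P x p)"
proof -
  let ?E = "{z \<in> space (M \<Otimes>\<^sub>M (point_space :: ('a \<times> real) measure)). case z of (x, p) \<Rightarrow> P x p}"
  have E: "?E \<in> sets (M \<Otimes>\<^sub>M point_space)" using P by simp
  have "(\<exists>p\<in>atoms (w x). P x p) \<longleftrightarrow> emeasure (w x) (Pair x -` ?E) \<noteq> 0" if x: "x \<in> space M" for x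
  proof -
    have wx: "w x \<in> configurations" using measurable_space[OF w x] by (simp add: space_config_space)
    have "Pair x -` ?E \<in> sets point_space" using sets_Pair1[OF E, of x] by simp
    then show ?thesis using emeasure_eq_0_atoms[OF wx] atoms_radius[OF wx] x
      by (fastforce simp: space_pair_measure space_point_space mem_Times_iff)
  qed
  moreover have "Measurable.pred M (\<lambda>x. emeasure (w x) (Pair x -` ?E) \<noteq> 0)"
    using measurable_kernel_emeasure[OF w E] by measurable
  ultimately show ?thesis by (simp cong: measurable_cong)
qed

section \<open>Percolation and the number of components\<close>

text \<open>The intersection of two closed balls written as an inequality, so that it is visibly
  measurable in both points; for nonnegative radii the two notions agree by
  \<open>touch_iff_point_ball\<close>.\<close>

definition touch :: "'a::euclidean_space \<times> real \<Rightarrow> 'a \<times> real \<Rightarrow> bool" where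
  "touch p p' \<longleftrightarrow> dist (fst p) (fst p') \<le> snd p + snd p'"

lemma touch_sym: "touch p p' \<Longrightarrow> touch p' p"
  by (simp add: touch_def dist_commute add.commute)

interpretation touch: symmetric_relation touch
  by unfold_locales (rule touch_sym)

lemma touch_iff_point_ball:
  fixes p p' :: "'a::euclidean_space \<times> real"
  assumes "0 \<le> snd p" "0 \<le> snd p'"
  shows "touch p p' \<longleftrightarrow> point_ball p \<inter> point_ball p' \<noteq> {}"
proof
  assume t: "touch p p'"
  obtain x r y s where p: "p = (x, r)" "p' = (y, s)" by (metis surj_pair)
  have rs: "0 \<le> r" "0 \<le> s" "dist x y \<le> r + s" using assms t by (auto simp: p touch_def)
  show "point_ball p \<inter> point_ball p' \<noteq> {}"
  proof (cases "r + s = 0")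
    case True
    then have "x \<in> point_ball p" "x \<in> point_ball p'" using rs p by (auto simp: dist_commute)
    then show ?thesis by blast
  next
    case False
    then have pos: "0 < r + s" using rs by simp
    \<comment> \<open>Divides the segment from \<open>x\<close> to \<open>y\<close> in the ratio
      \<open>r : s\<close>; the case \<open>r + s = 0\<close> is treated apart because of the
      division.\<close>
    let ?u = "x + (r / (r + s)) *\<^sub>R (y - x)"
    have "dist x ?u = (r / (r + s)) * dist x y"
      using rs by (simp add: dist_norm norm_minus_commute)
    also have "\<dots> \<le> (r / (r + s)) * (r + s)" using rs by (intro mult_left_mono) auto
    finally have 1: "dist x ?u \<le> r" using pos by simp
    have "?u - y = - (s / (r + s)) *\<^sub>R (y - x)"
    proof -
      have "?u - y = (r / (r + s) - 1) *\<^sub>R (y - x)" by (simp add: algebra_simps)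
      also have "r / (r + s) - 1 = - (s / (r + s))" using pos by (simp add: field_simps)
      finally show ?thesis .
    qed
    then have "norm (?u - y) = (s / (r + s)) * dist x y"
      using rs by (simp only: norm_scaleR) (simp add: dist_norm norm_minus_commute)
    then have "dist y ?u = (s / (r + s)) * dist x y"
      by (metis dist_norm norm_minus_commute)
    also have "\<dots> \<le> (s / (r + s)) * (r + s)" using rs by (intro mult_left_mono) auto
    finally have "dist y ?u \<le> s" using pos by simp
    then show ?thesis using 1 p by auto
  qed
next
  assume "point_ball p \<inter> point_ball p' \<noteq> {}"
  then obtain u where "dist (fst p) u \<le> snd p" "dist (fst p') u \<le> snd p'" by auto
  then show "touch p p'" using dist_triangle2[of "fst p" "fst p'" u] by (simp add: touch_def)
qed

lemma linked_iff_list: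
  assumes "p \<in> A"
  shows "linked T A p p' \<longleftrightarrow>
    (\<exists>ps. ps \<noteq> [] \<and> set ps \<subseteq> A \<and> hd ps = p \<and> last ps = p' \<and> successively T ps)"
proof
  assume "linked T A p p'"
  then show "\<exists>ps. ps \<noteq> [] \<and> set ps \<subseteq> A \<and> hd ps = p \<and> last ps = p' \<and> successively T ps"
    unfolding linked_def
  proof (induction rule: rtranclp_induct)
    case base
    then show ?case using assms by (intro exI[of _ "[p]"]) auto
  next
    case (step u v)
    then obtain ps where "ps \<noteq> []" "set ps \<subseteq> A" "hd ps = p" "last ps = u" "successively T ps" by auto
    then show ?case using step(2)
      by (intro exI[of _ "ps @ [v]"]) (auto simp: successively_append_iff)
  qed
next
  assume "\<exists>ps. ps \<noteq> [] \<and> set ps \<subseteq> A \<and> hd ps = p \<and> last ps = p' \<and> successively T ps"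
  then obtain ps where "ps \<noteq> []" "set ps \<subseteq> A" "hd ps = p" "last ps = p'" "successively T ps" by auto
  then show "linked T A p p'"
  proof (induction ps arbitrary: p)
    case (Cons a ps)
    show ?case
    proof (cases "ps = []")
      case True
      then show ?thesis using Cons by (simp add: linked_def)
    next
      case False
      then have "linked T A (hd ps) p'" using Cons by (auto simp: successively_Cons)
      then show ?thesis using Cons False unfolding linked_def
        by (intro converse_rtranclp_into_rtranclp[of _ p "hd ps"]) (auto simp: successively_Cons)
    qed
  qed simp
qed

lemma ball_connected_iff:
  assumes "\<omega> \<in> configurations"
  shows "ball_connected \<omega> x y \<longleftrightarrow>
    (\<exists>p\<in>atoms \<omega>. \<exists>p'\<in>atoms \<omega>. x \<in> point_ball p \<and> y \<in> point_ball p' \<and> linked touch (atoms \<omega>) p p')"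
proof -
  have s: "successively touch ps \<longleftrightarrow> (\<forall>i. Suc i < length ps \<longrightarrow> point_ball (ps ! i) \<inter> point_ball (ps ! Suc i) \<noteq> {})"
    if "set ps \<subseteq> atoms \<omega>" for ps
  proof -
    have "0 \<le> snd (ps ! i)" if "i < length ps" for i
      using atoms_radius[OF assms] \<open>set ps \<subseteq> atoms \<omega>\<close> that nth_mem by blast
    then show ?thesis unfolding successively_conv_nth
      using touch_iff_point_ball by (metis Suc_lessD)
  qed
  show ?thesis
  proof
    assume "ball_connected \<omega> x y"
    then obtain ps where ps: "ps \<noteq> []" "set ps \<subseteq> atoms \<omega>" "x \<in> point_ball (hd ps)" "y \<in> point_ball (last ps)"
      "successively touch ps" unfolding ball_connected_def using s by blast
    then have m: "hd ps \<in> atoms \<omega>" "last ps \<in> atoms \<omega>" by auto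
    then have "linked touch (atoms \<omega>) (hd ps) (last ps)" using ps by (subst linked_iff_list) auto
    then show "\<exists>p\<in>atoms \<omega>. \<exists>p'\<in>atoms \<omega>. x \<in> point_ball p \<and> y \<in> point_ball p' \<and> linked touch (atoms \<omega>) p p'"
      using m ps by blast
  next
    assume "\<exists>p\<in>atoms \<omega>. \<exists>p'\<in>atoms \<omega>. x \<in> point_ball p \<and> y \<in> point_ball p' \<and> linked touch (atoms \<omega>) p p'"
    then obtain p p' where p: "p \<in> atoms \<omega>" "x \<in> point_ball p" "y \<in> point_ball p'" "linked touch (atoms \<omega>) p p'"
      by blast
    then obtain ps where "ps \<noteq> []" "set ps \<subseteq> atoms \<omega>" "hd ps = p" "last ps = p'" "successively touch ps"
      using linked_iff_list[of p "atoms \<omega>"] by blast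
    then show "ball_connected \<omega> x y" unfolding ball_connected_def using s[of ps] p by blast
  qed
qed

text \<open>Any two balls that contain the same point touch, so the component of a point is
  determined by any ball that covers it. From here on geometry is replaced by clusters of
  \<open>touch\<close>.\<close>

lemma ball_components_eq:
  assumes w: "\<omega> \<in> configurations"
  shows "ball_components \<omega> = (\<lambda>C. \<Union>p\<in>C. point_ball p) ` clusters touch (atoms \<omega>)"
proof -
  let ?A = "atoms \<omega>"
  note r = atoms_radius[OF w]
  have im: "{(x, y). ball_connected \<omega> x y} `` {x} = (\<Union>p\<in>cluster touch ?A p. point_ball p)"
    if p: "p \<in> ?A" "x \<in> point_ball p" for x p
  proof -
    have "linked touch ?A p p'" if "p1 \<in> ?A" "x \<in> point_ball p1" "linked touch ?A p1 p'" for p1 p'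
    proof -
      have "touch p p1" using touch_iff_point_ball[of p p1] r p that by blast
      then show ?thesis using that p touch.linked_trans[OF touch.linked_step] by blast
    qed
    then show ?thesis using p unfolding ball_connected_iff[OF w] cluster_def by blast
  qed
  show ?thesis
  proof (intro equalityI subsetI)
    fix D assume "D \<in> ball_components \<omega>"
    then obtain x where x: "x \<in> germ_grain \<omega>" "D = {(x, y). ball_connected \<omega> x y} `` {x}"
      unfolding ball_components_def by (rule quotientE)
    then obtain p where "p \<in> ?A" "x \<in> point_ball p" by (auto simp: germ_grain_def)
    then show "D \<in> (\<lambda>C. \<Union>p\<in>C. point_ball p) ` clusters touch ?A"
      using im[of p x] x by (auto simp: clusters_def)
  next
    fix D assume "D \<in> (\<lambda>C. \<Union>p\<in>C. point_ball p) ` clusters touch ?A"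
    then obtain p where p: "p \<in> ?A" "D = (\<Union>p\<in>cluster touch ?A p. point_ball p)"
      by (auto simp: clusters_def)
    have x: "fst p \<in> point_ball p" using r[OF p(1)] by simp
    then have "fst p \<in> germ_grain \<omega>" using p(1) unfolding germ_grain_def by blast
    then show "D \<in> ball_components \<omega>"
      unfolding ball_components_def p(2) im[OF p(1) x, symmetric] by (rule quotientI)
  qed
qed

text \<open>Two clusters with the same union of balls contain touching balls and hence coincide, so
  components and clusters are in bijection.\<close>

lemma ncc_eq:
  assumes "\<omega> \<in> configurations"
  shows "ncc \<omega> = card (clusters touch (atoms \<omega>))"
proof -
  let ?A = "atoms \<omega>"
  have r: "\<And>p. p \<in> ?A \<Longrightarrow> 0 \<le> snd p" using atoms_radius[OF assms] .
  have "inj_on (\<lambda>C. \<Union>p\<in>C. point_ball p) (clusters touch ?A)"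
  proof (rule inj_onI)
    fix C D assume CD: "C \<in> clusters touch ?A" "D \<in> clusters touch ?A"
      and eq: "(\<Union>p\<in>C. point_ball p) = (\<Union>p\<in>D. point_ball p)"
    obtain p where p: "p \<in> C" using touch.clusters_ne[OF CD(1)] by blast
    then have pA: "p \<in> ?A" using touch.clusters_sub[OF CD(1)] by blast
    then have "fst p \<in> point_ball p" using r by simp
    then obtain u where u: "u \<in> D" "fst p \<in> point_ball u" using eq p by blast
    have uA: "u \<in> ?A" using u touch.clusters_sub[OF CD(2)] by blast
    have "touch p u" using touch_iff_point_ball[of p u] r pA uA u \<open>fst p \<in> point_ball p\<close> by blast
    then have "cluster touch ?A p = cluster touch ?A u"
      using pA uA by (intro touch.cluster_eq touch.linked_step)
    then show "C = D" using touch.clusters_cluster[OF CD(1) p] touch.clusters_cluster[OF CD(2) u(1)] by simp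
  qed
  then show ?thesis unfolding ncc_def ball_components_eq[OF assms] by (rule card_image)
qed

lemma unit_direction: "\<exists>e :: 'a::euclidean_space. norm e = 1 \<and> x = norm x *\<^sub>R e"
proof (cases "x = 0")
  case True
  obtain b :: 'a where "b \<in> Basis" using nonempty_Basis by blast
  then show ?thesis using True by (intro exI[of _ b]) simp
qed (auto intro!: exI[of _ "x /\<^sub>R norm x"])

text \<open>A ball reaches out to the norm of its centre plus its radius. Unboundedness becomes a
  countable family of conditions on single points, the form that measurability requires.\<close>

lemma unbounded_Union_cball:
  fixes C :: "('a::euclidean_space \<times> real) set"
  assumes r: "\<And>p. p \<in> C \<Longrightarrow> 0 \<le> snd p"
  shows "\<not> bounded (\<Union>p\<in>C. point_ball p) \<longleftrightarrow> (\<forall>n::nat. \<exists>p\<in>C. real n < norm (fst p) + snd p)"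
proof
  assume u: "\<not> bounded (\<Union>p\<in>C. point_ball p)"
  show "\<forall>n::nat. \<exists>p\<in>C. real n < norm (fst p) + snd p"
  proof (rule ccontr)
    assume "\<not> ?thesis"
    then obtain n :: nat where n: "\<And>p. p \<in> C \<Longrightarrow> norm (fst p) + snd p \<le> real n"
      unfolding not_all by (metis linorder_le_less_linear)
    have "norm x \<le> real n" if "p \<in> C" "x \<in> point_ball p" for x p
    proof -
      have "norm x \<le> norm (fst p) + dist (fst p) x"
        by (metis dist_0_norm dist_triangle)
      then show ?thesis using that(2) n[OF that(1)] by simp
    qed
    then have "bounded (\<Union>p\<in>C. point_ball p)" unfolding bounded_iff by blast
    then show False using u by simp
  qed
next
  assume n: "\<forall>n::nat. \<exists>p\<in>C. real n < norm (fst p) + snd p"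
  show "\<not> bounded (\<Union>p\<in>C. point_ball p)"
  proof
    assume "bounded (\<Union>p\<in>C. point_ball p)"
    then obtain b where b: "\<And>p x. p \<in> C \<Longrightarrow> x \<in> point_ball p \<Longrightarrow> norm x \<le> b" unfolding bounded_iff by blast
    obtain k :: nat where k: "b \<le> real k" using real_arch_simple by blast
    obtain p where p: "p \<in> C" "real k < norm (fst p) + snd p" using n by blast
    obtain e :: 'a where e: "norm e = 1" "fst p = norm (fst p) *\<^sub>R e"
      using unit_direction by blast
    let ?x = "fst p + snd p *\<^sub>R e"
    have "?x \<in> point_ball p" using e r[OF p(1)] by (simp add: dist_norm)
    then have "norm ?x \<le> b" using b p by blast
    moreover have "?x = (norm (fst p) + snd p) *\<^sub>R e" using e(2) by (metis scaleR_add_left)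
    ultimately show False using e(1) p(2) k r[OF p(1)] by simp
  qed
qed

lemma percolates_iff:
  assumes "\<omega> \<in> configurations"
  shows "percolates \<omega> \<longleftrightarrow> (\<exists>p\<in>atoms \<omega>. \<forall>n::nat. \<exists>p'\<in>atoms \<omega>.
    linked touch (atoms \<omega>) p p' \<and> real n < norm (fst p') + snd p')"
proof -
  let ?A = "atoms \<omega>"
  have r: "\<And>p. p \<in> ?A \<Longrightarrow> 0 \<le> snd p" using atoms_radius[OF assms] .
  have "percolates \<omega> \<longleftrightarrow> (\<exists>p\<in>?A. \<not> bounded (\<Union>p'\<in>cluster touch ?A p. point_ball p'))"
    unfolding percolates_def ball_components_eq[OF assms] clusters_def by blast
  also have "\<dots> \<longleftrightarrow> (\<exists>p\<in>?A. \<forall>n::nat. \<exists>p'\<in>cluster touch ?A p. real n < norm (fst p') + snd p')"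
    by (intro bex_cong refl unbounded_Union_cball) (auto simp: cluster_def r)
  finally show ?thesis unfolding cluster_def by blast
qed

section \<open>Chains of balls and the measurability of percolation\<close>

text \<open>A connection through exactly \<open>n\<close> intermediate points of \<open>A\<close>.
  Being linked is the union over the countably many \<open>n\<close>, and each level adds one
  quantifier over atoms, which \<open>pred_atoms_Bex\<close> handles.\<close>

fun chain :: "nat \<Rightarrow> ('a::euclidean_space \<times> real) set \<Rightarrow> 'a \<times> real \<Rightarrow> 'a \<times> real \<Rightarrow> bool" where
  "chain 0 A p p' \<longleftrightarrow> touch p p'"
| "chain (Suc n) A p p' \<longleftrightarrow> (\<exists>u\<in>A. touch p u \<and> chain n A u p')"

lemma linked_iff_chain:
  assumes "p \<in> A" "p' \<in> A" "0 \<le> snd p'"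
  shows "linked touch A p p' \<longleftrightarrow> (\<exists>n. chain n A p p')"
proof
  assume "linked touch A p p'"
  then show "\<exists>n. chain n A p p'" unfolding linked_def
  proof (induction rule: converse_rtranclp_induct)
    case base
    show ?case using assms by (intro exI[of _ 0]) (simp add: touch_def)
  next
    case (step y z)
    then show ?case by (metis chain.simps(2))
  qed
next
  assume "\<exists>n. chain n A p p'"
  then obtain n where "chain n A p p'" by blast
  then show "linked touch A p p'" using assms(1)
  proof (induction n arbitrary: p)
    case 0
    then show ?case using assms touch.linked_step[of p A p'] by simp
  next
    case (Suc n)
    then obtain u where "u \<in> A" "touch p u" "chain n A u p'" by auto
    then show ?case using Suc touch.linked_step touch.linked_trans by blast
  qed
qed

lemma measurable_fst_point_space [measurable]: "fst \<in> measurable (point_space :: ('a::euclidean_space \<times> real) measure) borel"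
  unfolding point_space_def by (intro measurable_restrict_space1) (simp flip: borel_prod)

lemma measurable_snd_point_space [measurable]: "snd \<in> measurable (point_space :: ('a::euclidean_space \<times> real) measure) borel"
  unfolding point_space_def by (intro measurable_restrict_space1) (simp flip: borel_prod)

lemma pred_touch [measurable]:
  assumes [measurable]: "f \<in> measurable M point_space" "g \<in> measurable M point_space"
  shows "Measurable.pred M (\<lambda>x. touch (f x) (g x))"
  unfolding touch_def by measurable

lemma pred_chain:
  "Measurable.pred (config_space \<Otimes>\<^sub>M (point_space \<Otimes>\<^sub>M (point_space :: ('a::euclidean_space \<times> real) measure)))
    (\<lambda>z. chain n (atoms (fst z)) (fst (snd z)) (snd (snd z)))"
proof (induction n)
  case 0
  show ?case unfolding chain.simps by measurable
next
  case (Suc n)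
  let ?P = "point_space :: ('a \<times> real) measure"
  let ?M = "config_space \<Otimes>\<^sub>M (?P \<Otimes>\<^sub>M ?P)"
  have "Measurable.pred (?M \<Otimes>\<^sub>M ?P) (\<lambda>z. chain n (atoms (fst (fst z))) (snd z) (snd (snd (fst z))))"
    using measurable_compose[OF _ Suc, of "\<lambda>z. (fst (fst z), snd z, snd (snd (fst z)))" "?M \<Otimes>\<^sub>M ?P"]
    by simp
  note [measurable] = this
  show ?case unfolding chain.simps
  proof (rule pred_atoms_Bex)
    show "Measurable.pred (?M \<Otimes>\<^sub>M ?P) (\<lambda>(z, u). touch (fst (snd z)) u \<and> chain n (atoms (fst z)) u (snd (snd z)))"
      unfolding split_beta' by measurable
  qed simp
qed

lemma pred_chains:
  assumes [measurable]: "w \<in> measurable M config_space" "f \<in> measurable M point_space" "g \<in> measurable M point_space"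
  shows "Measurable.pred M (\<lambda>x. \<exists>n. chain n (atoms (w x)) (f x) (g x))"
proof (rule pred_intros_countable)
  fix n
  show "Measurable.pred M (\<lambda>x. chain n (atoms (w x)) (f x) (g x))"
    using measurable_compose[OF _ pred_chain, of "\<lambda>x. (w x, f x, g x)" M n] by simp
qed

lemma pred_linked_pair:
  fixes w :: "'x \<Rightarrow> ('a::euclidean_space \<times> real) measure"
  assumes w [measurable]: "w \<in> measurable M config_space"
    and P [measurable]: "Measurable.pred (M \<Otimes>\<^sub>M point_space) (\<lambda>(x, p). P x p)"
    and R [measurable]: "Measurable.pred (M \<Otimes>\<^sub>M point_space) (\<lambda>(x, p). R x p)"
  shows "Measurable.pred M (\<lambda>x. \<exists>p\<in>atoms (w x). P x p \<and> (\<exists>p'\<in>atoms (w x). linked touch (atoms (w x)) p p' \<and> R x p'))"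
proof -
  let ?P = "point_space :: ('a \<times> real) measure"
  have Rc: "Measurable.pred ((M \<Otimes>\<^sub>M ?P) \<Otimes>\<^sub>M ?P) (\<lambda>z. R (fst (fst z)) (snd z))"
    using measurable_compose[OF _ R, of "\<lambda>z. (fst (fst z), snd z)" "(M \<Otimes>\<^sub>M ?P) \<Otimes>\<^sub>M ?P"] by simp
  have Pc: "Measurable.pred (M \<Otimes>\<^sub>M ?P) (\<lambda>z. P (fst z) (snd z))"
    using P by (simp add: split_beta')
  note [measurable] = Rc Pc
  have [measurable]: "Measurable.pred ((M \<Otimes>\<^sub>M ?P) \<Otimes>\<^sub>M ?P) (\<lambda>z. \<exists>n. chain n (atoms (w (fst (fst z)))) (snd (fst z)) (snd z))"
    by (intro pred_chains measurable_compose[OF _ w]) measurable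
  have "Measurable.pred (M \<Otimes>\<^sub>M ?P) (\<lambda>z. \<exists>p'\<in>atoms (w (fst z)). (\<exists>n. chain n (atoms (w (fst z))) (snd z) p') \<and> R (fst z) p')"
    by (intro pred_atoms_Bex measurable_compose[OF _ w] measurable_fst) (unfold split_beta', measurable)
  note [measurable] = this
  have "Measurable.pred M (\<lambda>x. \<exists>p\<in>atoms (w x). P x p \<and> (\<exists>p'\<in>atoms (w x). (\<exists>n. chain n (atoms (w x)) p p') \<and> R x p'))"
    by (intro pred_atoms_Bex w) (unfold split_beta', measurable)
  moreover have "(\<exists>p\<in>atoms (w x). P x p \<and> (\<exists>p'\<in>atoms (w x). (\<exists>n. chain n (atoms (w x)) p p') \<and> R x p')) \<longleftrightarrow>
    (\<exists>p\<in>atoms (w x). P x p \<and> (\<exists>p'\<in>atoms (w x). linked touch (atoms (w x)) p p' \<and> R x p'))"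
    if "x \<in> space M" for x
    using measurable_space[OF w that] linked_iff_chain atoms_radius by (fastforce simp: space_config_space)
  ultimately show ?thesis by (simp cong: measurable_cong)
qed

lemma percolates_measurable: "Measurable.pred config_space (percolates :: ('a::euclidean_space \<times> real) measure \<Rightarrow> bool)"
proof -
  let ?P = "point_space :: ('a \<times> real) measure" and ?C = "config_space :: ('a \<times> real) measure measure"
  have [measurable]: "Measurable.pred ((?C \<Otimes>\<^sub>M ?P) \<Otimes>\<^sub>M ?P) (\<lambda>z. \<exists>n. chain n (atoms (fst (fst z))) (snd (fst z)) (snd z))"
    by (intro pred_chains) measurable
  have [measurable]: "Measurable.pred (?C \<Otimes>\<^sub>M ?P) (\<lambda>z. \<exists>p'\<in>atoms (fst z). (\<exists>k. chain k (atoms (fst z)) (snd z) p') \<and> real n < norm (fst p') + snd p')" for n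
    by (intro pred_atoms_Bex measurable_fst measurable_ident_sets refl) (unfold split_beta', measurable)
  have "Measurable.pred ?C (\<lambda>\<omega>. \<exists>p\<in>atoms \<omega>. \<forall>n::nat. \<exists>p'\<in>atoms \<omega>. (\<exists>k. chain k (atoms \<omega>) p p') \<and> real n < norm (fst p') + snd p')"
    by (intro pred_atoms_Bex measurable_fst measurable_ident_sets refl) (unfold split_beta', measurable)
  moreover have "(\<exists>p\<in>atoms \<omega>. \<forall>n::nat. \<exists>p'\<in>atoms \<omega>. (\<exists>k. chain k (atoms \<omega>) p p') \<and> real n < norm (fst p') + snd p') \<longleftrightarrow> percolates \<omega>"
    if "\<omega> \<in> space ?C" for \<omega>
    using that percolates_iff linked_iff_chain atoms_radius unfolding space_config_space by metis
  ultimately show ?thesis by (simp cong: measurable_cong)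
qed


section \<open>The number of components as an integral\<close>

lemma atom_mass:
  fixes \<omega> :: "('a::euclidean_space \<times> real) measure"
  assumes "\<omega> \<in> configurations" "p \<in> atoms \<omega>"
  shows "0 < emeasure \<omega> {p}" "emeasure \<omega> {p} < \<infinity>"
proof -
  show "0 < emeasure \<omega> {p}" using assms by (simp add: atoms_def)
  have "emeasure \<omega> {p} \<le> emeasure \<omega> ({fst p} \<times> {0..})"
    using atoms_radius[OF assms] sets_config[OF assms(1)] slab_in_sets[of "{fst p}"]
    by (intro emeasure_mono) (auto simp: mem_Times_iff)
  also have "\<dots> < \<infinity>" using assms(1) by (auto simp: configurations_def)
  finally show "emeasure \<omega> {p} < \<infinity>" .
qed

lemma nn_integral_atoms:
  fixes \<omega> :: "('a::euclidean_space \<times> real) measure"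
  assumes w: "\<omega> \<in> configurations" and fin: "finite (atoms \<omega>)"
  shows "(\<integral>\<^sup>+ p. f p \<partial>\<omega>) = (\<Sum>p\<in>atoms \<omega>. f p * emeasure \<omega> {p})"
proof -
  have s: "{p} \<in> sets \<omega>" if "p \<in> atoms \<omega>" for p
    using that atoms_radius[OF w] sets_config[OF w] singleton_in_sets by blast
  have "atoms \<omega> = (\<Union>p\<in>atoms \<omega>. {p})" by auto
  also have "\<dots> \<in> sets \<omega>" using fin s by (intro sets.finite_UN) auto
  finally have A: "atoms \<omega> \<in> sets \<omega>" .
  then have "emeasure \<omega> (space \<omega> - atoms \<omega>) = 0"
    using emeasure_eq_0_atoms[OF w, of "space \<omega> - atoms \<omega>"] sets_config[OF w] by auto
  then have "space \<omega> - atoms \<omega> \<in> null_sets \<omega>" using A by (intro null_setsI) auto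
  then have ae: "AE p in \<omega>. p \<in> atoms \<omega>" by (rule AE_I'[of "space \<omega> - atoms \<omega>"]) auto
  have "(\<integral>\<^sup>+ p. f p \<partial>\<omega>) = (\<integral>\<^sup>+ p. (\<Sum>u\<in>atoms \<omega>. f u * indicator {u} p) \<partial>\<omega>)"
    using ae
  proof (intro nn_integral_cong_AE, eventually_elim)
    case (elim p)
    then show ?case using fin by (subst sum.remove[of _ p]) (auto intro!: sum.neutral)
  qed
  also have "\<dots> = (\<Sum>u\<in>atoms \<omega>. \<integral>\<^sup>+ p. f u * indicator {u} p \<partial>\<omega>)"
    using s by (intro nn_integral_sum) auto
  also have "\<dots> = (\<Sum>u\<in>atoms \<omega>. f u * emeasure \<omega> {u})"
    using s by (intro sum.cong nn_integral_cmult_indicator) auto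
  finally show ?thesis .
qed

text \<open>Points are weighted by the inverse mass of their cluster, so that every cluster counts once.\<close>
lemma card_clusters_integral:
  fixes \<omega> :: "('a::euclidean_space \<times> real) measure"
  assumes w: "\<omega> \<in> configurations" and fin: "finite (atoms \<omega>)"
  shows "of_nat (card (clusters touch (atoms \<omega>))) =
    (\<integral>\<^sup>+ p. 1 / (\<integral>\<^sup>+ p'. indicator {p'. \<exists>n. chain n (atoms \<omega>) p p'} p' \<partial>\<omega>) \<partial>\<omega>)"
proof -
  let ?A = "atoms \<omega>" and ?m = "\<lambda>p. emeasure \<omega> {p}"
  have mass: "(\<integral>\<^sup>+ p'. indicator {p'. \<exists>n. chain n ?A p p'} p' \<partial>\<omega>) = (\<Sum>p'\<in>cluster touch ?A p. ?m p')"
    if p: "p \<in> ?A" for p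
  proof -
    have "(\<integral>\<^sup>+ p'. indicator {p'. \<exists>n. chain n ?A p p'} p' \<partial>\<omega>) =
        (\<Sum>p'\<in>?A. indicator {p'. \<exists>n. chain n ?A p p'} p' * ?m p')"
      using nn_integral_atoms[OF w fin] .
    also have "\<dots> = (\<Sum>p'\<in>?A. if p' \<in> cluster touch ?A p then ?m p' else 0)"
      using linked_iff_chain[OF p] atoms_radius[OF w]
      by (intro sum.cong) (auto simp: cluster_def indicator_def)
    also have "\<dots> = (\<Sum>p'\<in>cluster touch ?A p. ?m p')"
      using fin by (subst sum.inter_restrict[symmetric]) (auto simp: cluster_def intro!: sum.cong)
    finally show ?thesis .
  qed
  have "(\<integral>\<^sup>+ p. 1 / (\<integral>\<^sup>+ p'. indicator {p'. \<exists>n. chain n ?A p p'} p' \<partial>\<omega>) \<partial>\<omega>) =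
      (\<Sum>p\<in>?A. 1 / (\<Sum>p'\<in>cluster touch ?A p. ?m p') * ?m p)"
    unfolding nn_integral_atoms[OF w fin, of "\<lambda>p. 1 / (\<integral>\<^sup>+ p'. indicator {p'. \<exists>n. chain n ?A p p'} p' \<partial>\<omega>)"]
    by (intro sum.cong) (simp_all add: mass)
  also have "\<dots> = (\<Sum>C\<in>clusters touch ?A. \<Sum>p\<in>C. 1 / (\<Sum>p'\<in>cluster touch ?A p. ?m p') * ?m p)"
    using touch.Union_clusters[of ?A] touch.clusters_disj[of _ ?A] touch.clusters_sub[of _ ?A] finite_subset[OF _ fin]
    by (subst sum.Union_disjoint[symmetric, unfolded comp_def]) auto
  also have "\<dots> = (\<Sum>C\<in>clusters touch ?A. 1)"
  proof (rule sum.cong)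
    fix C assume C: "C \<in> clusters touch ?A"
    have CA: "C \<subseteq> ?A" "finite C" using touch.clusters_sub[OF C] finite_subset fin by auto
    let ?s = "\<Sum>p\<in>C. ?m p"
    have "(\<Sum>p\<in>C. 1 / (\<Sum>p'\<in>cluster touch ?A p. ?m p') * ?m p) = (\<Sum>p\<in>C. 1 / ?s * ?m p)"
      using touch.clusters_cluster[OF C] by (intro sum.cong) auto
    also have "\<dots> = ?s / ?s"
      unfolding sum_distrib_left[symmetric] by (simp add: ennreal_divide_times)
    also have "\<dots> = 1"
    proof (rule ennreal_divide_self)
      obtain p where p: "p \<in> C" using touch.clusters_ne[OF C] by blast
      then have "0 < ?m p" using atom_mass(1)[OF w] CA by blast
      then show "?s \<noteq> 0" using p sum_eq_0_iff[OF CA(2), of ?m] by force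
      show "?s < top" using atom_mass(2)[OF w] CA by (auto simp: less_top[symmetric] ennreal_sum_eq_top)
    qed
    finally show "(\<Sum>p\<in>C. 1 / (\<Sum>p'\<in>cluster touch ?A p. ?m p') * ?m p) = 1" .
  qed simp
  finally show ?thesis by simp
qed

text \<open>By \<open>card_clusters_integral\<close> the number of components is an iterated
  integral against the configuration itself, so measurability of kernel integrals suffices and the
  points need not be enumerated.\<close>

lemma ncc_restrict_measurable:
  fixes \<Lambda> :: "'a::euclidean_space set"
  assumes L: "\<Lambda> \<in> sets borel" "bounded \<Lambda>"
  shows "(\<lambda>\<omega>. ncc (config_restrict \<Lambda> \<omega>)) \<in> measurable config_space (count_space UNIV)"
proof -
  let ?P = "point_space :: ('a \<times> real) measure" and ?C = "config_space :: ('a \<times> real) measure measure"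
  let ?w = "config_restrict \<Lambda>"
  note w [measurable] = measurable_config_restrict[OF L(1)]
  have [measurable]: "Measurable.pred ((?C \<Otimes>\<^sub>M ?P) \<Otimes>\<^sub>M ?P) (\<lambda>z. \<exists>n. chain n (atoms (?w (fst (fst z)))) (snd (fst z)) (snd z))"
    by (intro pred_chains measurable_compose[OF _ w]) measurable
  define f :: "(('a \<times> real) measure \<times> ('a \<times> real)) \<times> ('a \<times> real) \<Rightarrow> ennreal"
    where "f z = (if \<exists>n. chain n (atoms (?w (fst (fst z)))) (snd (fst z)) (snd z) then 1 else 0)" for z
  have "f \<in> borel_measurable ((?C \<Otimes>\<^sub>M ?P) \<Otimes>\<^sub>M ?P)"
    unfolding f_def by measurable
  then have [measurable]: "(\<lambda>z. \<integral>\<^sup>+ p'. f (z, p') \<partial>?w (fst z)) \<in> borel_measurable (?C \<Otimes>\<^sub>M ?P)"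
    by (rule measurable_kernel_integral[OF measurable_compose[OF measurable_fst w]])
  define h where "h z = 1 / (\<integral>\<^sup>+ p'. f (z, p') \<partial>?w (fst z))" for z
  have "h \<in> borel_measurable (?C \<Otimes>\<^sub>M ?P)"
    unfolding h_def by measurable
  then have "(\<lambda>\<omega>. \<integral>\<^sup>+ p. h (\<omega>, p) \<partial>?w \<omega>) \<in> borel_measurable ?C"
    by (rule measurable_kernel_integral[OF w])
  moreover have "(\<integral>\<^sup>+ p. h (\<omega>, p) \<partial>?w \<omega>) =
      (\<integral>\<^sup>+ p. 1 / (\<integral>\<^sup>+ p'. indicator {p'. \<exists>n. chain n (atoms (?w \<omega>)) p p'} p' \<partial>?w \<omega>) \<partial>?w \<omega>)" for \<omega>
    by (simp add: h_def f_def indicator_def of_bool_def)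
  moreover have "(\<integral>\<^sup>+ p. 1 / (\<integral>\<^sup>+ p'. indicator {p'. \<exists>n. chain n (atoms (?w \<omega>)) p p'} p' \<partial>?w \<omega>) \<partial>?w \<omega>) = of_nat (ncc (?w \<omega>))"
    if "\<omega> \<in> space ?C" for \<omega>
  proof -
    have c: "\<omega> \<in> configurations" using that by (simp add: space_config_space)
    show ?thesis
      using card_clusters_integral[OF config_restrict_config[OF L(1) c]] ncc_eq[OF config_restrict_config[OF L(1) c]]
        finite_atoms[OF c L(2)] atoms_config_restrict[OF L(1) c] by simp
  qed
  ultimately have m: "(\<lambda>\<omega>. of_nat (ncc (?w \<omega>)) :: ennreal) \<in> borel_measurable ?C"
    by (simp cong: measurable_cong)
  have "{\<omega> \<in> space ?C. ncc (?w \<omega>) = k} \<in> sets ?C" for k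
  proof -
    have "{\<omega> \<in> space ?C. (of_nat (ncc (?w \<omega>)) :: ennreal) = of_nat k} \<in> sets ?C"
      using m by measurable
    then show ?thesis by simp
  qed
  then show ?thesis by (subst measurable_count_space_eq2_countable) (auto simp: vimage_def Int_def conj_commute)
qed

text \<open>Each ball of radius at least \<open>s\<close> that meets \<open>cball y r\<close>
  contains a ball of radius \<open>s\<close> that lies in \<open>cball y (r + 2 * s)\<close>. Balls
  that do not touch give disjoint small balls, and volumes are compared.\<close>

lemma card_packing:
  fixes F :: "('a::euclidean_space \<times> real) set"
  assumes s: "0 < s" "0 \<le> r" and fin: "finite F"
    and big: "\<And>p. p \<in> F \<Longrightarrow> s \<le> snd p" and near: "\<And>p. p \<in> F \<Longrightarrow> dist (fst p) y \<le> r + snd p"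
    and disj: "\<And>p p'. p \<in> F \<Longrightarrow> p' \<in> F \<Longrightarrow> p \<noteq> p' \<Longrightarrow> \<not> touch p p'"
  shows "real (card F) \<le> ((r + 2 * s) / s) ^ DIM('a)"
proof -
  \<comment> \<open>The centre, moved towards \<open>y\<close> until it is within
    \<open>r + s\<close> of it. The shift is at most \<open>snd p - s\<close>, so the ball of radius
    \<open>s\<close> about the new centre stays in the original ball.\<close>
  define c :: "'a \<times> real \<Rightarrow> 'a" where "c p = (if dist (fst p) y \<le> r + s then fst p
    else y + ((r + s) / dist (fst p) y) *\<^sub>R (fst p - y))" for p
  have c: "dist (c p) y \<le> r + s \<and> dist (c p) (fst p) \<le> snd p - s" if "p \<in> F" for p
  proof (cases "dist (fst p) y \<le> r + s")
    case True
    then show ?thesis using big[OF that] by (simp add: c_def)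
  next
    case False
    let ?d = "dist (fst p) y"
    have d: "r + s < ?d" "0 < ?d" using False s by auto
    have cy: "c p - y = ((r + s) / ?d) *\<^sub>R (fst p - y)" using False by (simp add: c_def)
    then have "dist (c p) y = (r + s) / ?d * ?d"
      using s by (simp add: dist_norm)
    then have 1: "dist (c p) y = r + s" using d by simp
    have "c p - fst p = - ((?d - (r + s)) / ?d) *\<^sub>R (fst p - y)"
    proof -
      have "c p - fst p = (c p - y) - (fst p - y)" by simp
      also have "\<dots> = ((r + s) / ?d - 1) *\<^sub>R (fst p - y)" unfolding cy by (simp add: scaleR_left_diff_distrib)
      also have "(r + s) / ?d - 1 = - ((?d - (r + s)) / ?d)" using d by (simp add: field_simps)
      finally show ?thesis .
    qed
    then have "dist (c p) (fst p) = \<bar>(?d - (r + s)) / ?d\<bar> * ?d" by (simp add: dist_norm)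
    also have "\<dots> = ?d - (r + s)" using d by simp
    finally show ?thesis using 1 near[OF that] by simp
  qed
  have sub: "cball (c p) s \<subseteq> cball y (r + 2 * s)" "cball (c p) s \<subseteq> point_ball p" if "p \<in> F" for p
    using c[OF that] by (auto simp: cball_subset_cball_iff dist_commute)
  have "disjoint_family_on (\<lambda>p. cball (c p) s) F"
    unfolding disjoint_family_on_def
  proof (intro ballI impI)
    fix p p' assume p: "p \<in> F" "p' \<in> F" "p \<noteq> p'"
    have "0 \<le> snd p" "0 \<le> snd p'" using big[OF p(1)] big[OF p(2)] s by auto
    then have "point_ball p \<inter> point_ball p' = {}" using touch_iff_point_ball disj[OF p] by blast
    then show "cball (c p) s \<inter> cball (c p') s = {}" using sub(2)[OF p(1)] sub(2)[OF p(2)] by blast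
  qed
  then have "(\<Sum>p\<in>F. emeasure lborel (cball (c p) s)) = emeasure lborel (\<Union>p\<in>F. cball (c p) s)"
    using fin by (intro sum_emeasure) auto
  also have "\<dots> \<le> emeasure lborel (cball y (r + 2 * s))"
    using sub(1) by (intro emeasure_mono) auto
  finally have "of_nat (card F) * ennreal (unit_ball_vol (DIM('a)) * s ^ DIM('a)) \<le>
      ennreal (unit_ball_vol (DIM('a)) * (r + 2 * s) ^ DIM('a))"
    using s by (simp add: emeasure_cball)
  then have "real (card F) * (unit_ball_vol (DIM('a)) * s ^ DIM('a)) \<le> unit_ball_vol (DIM('a)) * (r + 2 * s) ^ DIM('a)"
    using s by (simp add: ennreal_of_nat_eq_real_of_nat ennreal_mult'[symmetric])
  then have "unit_ball_vol (DIM('a)) * (real (card F) * s ^ DIM('a)) \<le> unit_ball_vol (DIM('a)) * (r + 2 * s) ^ DIM('a)"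
    by (simp add: mult_ac)
  then have "real (card F) * s ^ DIM('a) \<le> (r + 2 * s) ^ DIM('a)"
    using unit_ball_vol_pos[of "DIM('a)"] by (simp del: mult_le_cancel_left_pos add: mult_le_cancel_left_pos)
  then show ?thesis using s by (simp add: power_divide field_simps)
qed

section \<open>The local number of components\<close>

lemma finite_subset_incseq:
  assumes "finite X" "incseq D" "X \<subseteq> (\<Union>n. D n)"
  shows "\<forall>\<^sub>F n in sequentially. X \<subseteq> D n"
  using assms(1,3)
proof (induction X)
  case (insert x X)
  then obtain n where "x \<in> D n" by auto
  then have "\<forall>\<^sub>F n in sequentially. x \<in> D n"
    using assms(2) by (auto simp: eventually_sequentially incseq_def)
  moreover have "\<forall>\<^sub>F n in sequentially. X \<subseteq> D n" using insert by auto
  ultimately show ?case by eventually_elim auto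
qed simp

text \<open>Infinitely many balls may touch \<open>x\<close>, as their radii are unbounded. Those of
  radius below 1 have their centres in a bounded set, so they are finitely many. Among the others a
  largest family of pairwise disjoint balls is finite by \<open>card_packing\<close>, and any
  further ball touches a member, since otherwise it could be added.\<close>

lemma finite_dominating:
  fixes \<omega> :: "('a::euclidean_space \<times> real) measure"
  assumes w: "\<omega> \<in> configurations" and x: "0 \<le> snd x" and H: "H \<subseteq> atoms \<omega>"
  shows "\<exists>F. finite F \<and> F \<subseteq> H \<and> (\<forall>b\<in>H. touch x b \<longrightarrow> (\<exists>f\<in>F. touch x f \<and> touch f b))"
proof -
  let ?S = "{b \<in> H. touch x b \<and> snd b < 1}" and ?B = "{b \<in> H. touch x b \<and> 1 \<le> snd b}"
  have "?S \<subseteq> atoms \<omega> \<inter> cball (fst x) (snd x + 1) \<times> UNIV"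
    using H by (auto simp: touch_def mem_Times_iff)
  then have S: "finite ?S" using finite_atoms[OF w bounded_cball] finite_subset by blast
  let ?P = "\<lambda>G. finite G \<and> G \<subseteq> ?B \<and> (\<forall>p\<in>G. \<forall>p'\<in>G. p \<noteq> p' \<longrightarrow> \<not> touch p p')"
  let ?K = "((snd x + 2 * 1) / 1) ^ DIM('a)"
  have bd: "card G \<le> nat \<lceil>?K\<rceil>" if "?P G" for G
  proof -
    have "real (card G) \<le> ?K"
      by (rule card_packing[where y = "fst x"]) (use that x in \<open>auto simp: touch_def dist_commute\<close>)
    then show ?thesis by linarith
  qed
  have "?P {}" by simp
  moreover have "\<forall>G. ?P G \<longrightarrow> card G < Suc (nat \<lceil>?K\<rceil>)" using bd le_imp_less_Suc by blast
  ultimately have "\<exists>G. ?P G \<and> (\<forall>G'. ?P G' \<longrightarrow> card G' \<le> card G)"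
    by (rule Lattices_Big.ex_has_greatest_nat)
  then obtain G where G: "?P G" "\<And>G'. ?P G' \<Longrightarrow> card G' \<le> card G" by blast
  have self: "touch b b" if "b \<in> H" for b
    using atoms_radius[OF w subsetD[OF H that]] by (simp add: touch_def)
  have "\<exists>f\<in>?S \<union> G. touch x f \<and> touch f b" if b: "b \<in> H" "touch x b" for b
  proof (cases "snd b < 1")
    case True
    then show ?thesis using b self by blast
  next
    case False
    show ?thesis
    proof (rule ccontr)
      assume n: "\<not> ?thesis"
      have bG: "\<not> touch f b" if "f \<in> G" for f using n that G(1) by blast
      then have "b \<notin> G" using self b by blast
      moreover have "\<not> touch b f" if "f \<in> G" for f using bG[OF that] touch_sym[of b f] by blast
      then have "?P (insert b G)" using G(1) b False bG by auto
      ultimately show False using G(2)[of "insert b G"] G(1) by simp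
    qed
  qed
  then show ?thesis using S G(1) by (intro exI[of _ "?S \<union> G"]) auto
qed

text \<open>Shows that the description in \<open>ncc_local\<close> has a unique value: along every
  exhausting sequence the increments become constant, by \<open>merging_stable\<close> applied to
  the union of the dominating families of the points over \<open>\<Lambda>\<close>.\<close>

lemma ncc_local_props:
  fixes \<omega> :: "('a::euclidean_space \<times> real) measure"
  assumes w: "\<omega> \<in> configurations" and L: "\<Lambda> \<in> sets borel" "bounded \<Lambda>"
  shows ncc_local_stable: "\<exists>B. finite B \<and> B \<subseteq> atoms \<omega> - \<Lambda> \<times> UNIV \<and> (\<forall>A. finite A \<longrightarrow> B \<subseteq> A \<longrightarrow>
      A \<subseteq> atoms \<omega> - \<Lambda> \<times> UNIV \<longrightarrow> merging touch (atoms \<omega> \<inter> \<Lambda> \<times> UNIV) A = ncc_local \<Lambda> \<omega>)"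
    and ncc_local_limit: "\<forall>\<^sub>F n in sequentially.
      int (ncc (config_restrict (ball 0 (real n)) \<omega>)) - int (ncc (config_restrict (ball 0 (real n) - \<Lambda>) \<omega>)) = ncc_local \<Lambda> \<omega>"
proof -
  let ?Z = "atoms \<omega> \<inter> \<Lambda> \<times> UNIV" and ?H = "atoms \<omega> - \<Lambda> \<times> UNIV"
  have Z: "finite ?Z" using finite_atoms[OF w L(2)] .
  have "\<forall>x\<in>?Z. \<exists>F. finite F \<and> F \<subseteq> ?H \<and> (\<forall>b\<in>?H. touch x b \<longrightarrow> (\<exists>f\<in>F. touch x f \<and> touch f b))"
    by (intro ballI finite_dominating[OF w]) (auto intro: atoms_radius[OF w])
  from bchoice[OF this] obtain F where
    "\<forall>x\<in>?Z. finite (F x) \<and> F x \<subseteq> ?H \<and> (\<forall>b\<in>?H. touch x b \<longrightarrow> (\<exists>f\<in>F x. touch x f \<and> touch f b))" ..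
  note F = bspec[OF this]
  obtain k B where B: "finite B" "B \<subseteq> ?H" "\<And>A. finite A \<Longrightarrow> B \<subseteq> A \<Longrightarrow> A \<subseteq> ?H \<Longrightarrow> merging touch ?Z A = k"
  proof (rule touch.merging_stable[OF Z, of ?H "\<Union>x\<in>?Z. F x"])
    show "finite (\<Union>x\<in>?Z. F x)" using Z F by blast
    show "(\<Union>x\<in>?Z. F x) \<subseteq> ?H" using F by blast
    show "\<exists>f\<in>\<Union>x\<in>?Z. F x. touch x f \<and> touch f b" if "x \<in> ?Z" "b \<in> ?H" "touch x b" for x b
      using F that by blast
  qed auto
  let ?d = "\<lambda>D. int (ncc (config_restrict D \<omega>)) - int (ncc (config_restrict (D - \<Lambda>) \<omega>))"
  have ev: "\<forall>\<^sub>F n in sequentially. ?d (\<Delta> n) = k"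
    if D: "incseq \<Delta>" "\<And>n. bounded (\<Delta> n) \<and> \<Delta> n \<in> sets borel" "(\<Union>n. \<Delta> n) = UNIV" for \<Delta> :: "nat \<Rightarrow> 'a set"
  proof -
    have "\<forall>\<^sub>F n in sequentially. ?Z \<union> B \<subseteq> \<Delta> n \<times> UNIV"
      using Z B(1) D(1,3) by (intro finite_subset_incseq) (auto simp: incseq_def, blast+)
    then show ?thesis
    proof eventually_elim
      case (elim n)
      let ?A = "?H \<inter> \<Delta> n \<times> UNIV"
      have fin: "finite ?A"
        by (rule finite_subset[OF _ finite_atoms[OF w, of "\<Delta> n"]]) (use D in auto)
      have 1: "atoms (config_restrict (\<Delta> n) \<omega>) = ?Z \<union> ?A"
        using elim D by (subst atoms_config_restrict[OF _ w]) auto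
      have 2: "atoms (config_restrict (\<Delta> n - \<Lambda>) \<omega>) = ?A"
        using D L by (subst atoms_config_restrict[OF _ w]) auto
      have "?d (\<Delta> n) = merging touch ?Z ?A"
        unfolding merging_def 1[symmetric] 2[symmetric]
          ncc_eq[OF config_restrict_config[OF conjunct2[OF D(2)] w]]
          ncc_eq[OF config_restrict_config[OF sets.Diff[OF conjunct2[OF D(2)] L(1)] w]]
        by (simp only: 1 2)
      also have "\<dots> = k" using fin elim B(2) by (intro B(3)) auto
      finally show ?case .
    qed
  qed
  have ball: "incseq (\<lambda>n. ball 0 (real n) :: 'a set)" "(\<Union>n. ball 0 (real n)) = (UNIV :: 'a set)"
    by (auto simp: incseq_def intro: reals_Archimedean2)
  have evb: "\<forall>\<^sub>F n in sequentially. ?d (ball 0 (real n)) = k"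
    by (intro ev ball) auto
  have "ncc_local \<Lambda> \<omega> = k"
    unfolding ncc_local_def
  proof (rule the_equality)
    show "\<forall>\<Delta>. incseq \<Delta> \<and> (\<forall>n. bounded (\<Delta> n) \<and> \<Delta> n \<in> sets borel) \<and> (\<Union>n. \<Delta> n) = UNIV \<longrightarrow>
        (\<lambda>n. ?d (\<Delta> n)) \<longlonglongrightarrow> k"
      using tendsto_eventually[OF ev] by blast
    fix j assume "\<forall>\<Delta> :: nat \<Rightarrow> 'a set. incseq \<Delta> \<and> (\<forall>n. bounded (\<Delta> n) \<and> \<Delta> n \<in> sets borel) \<and> (\<Union>n. \<Delta> n) = UNIV \<longrightarrow>
        (\<lambda>n. ?d (\<Delta> n)) \<longlonglongrightarrow> j"
    then have "(\<lambda>n. ?d (ball 0 (real n))) \<longlonglongrightarrow> j" using ball by simp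
    then show "j = k" using tendsto_eventually[OF evb] LIMSEQ_unique by blast
  qed
  then show "\<exists>B. finite B \<and> B \<subseteq> ?H \<and> (\<forall>A. finite A \<longrightarrow> B \<subseteq> A \<longrightarrow> A \<subseteq> ?H \<longrightarrow> merging touch ?Z A = ncc_local \<Lambda> \<omega>)"
    "\<forall>\<^sub>F n in sequentially. ?d (ball 0 (real n)) = ncc_local \<Lambda> \<omega>"
    using B evb by auto
qed

text \<open>The definition speaks of all exhausting sequences at once; along the balls
  \<open>ball 0 (real n)\<close> the value is attained eventually, which is a countable
  condition.\<close>

lemma ncc_local_measurable:
  fixes \<Lambda> :: "'a::euclidean_space set"
  assumes L: "\<Lambda> \<in> sets borel" "bounded \<Lambda>"
  shows "ncc_local \<Lambda> \<in> measurable config_space (count_space UNIV)"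
proof -
  let ?C = "config_space :: ('a \<times> real) measure measure"
  let ?d = "\<lambda>n \<omega>. int (ncc (config_restrict (ball 0 (real n)) \<omega>)) - int (ncc (config_restrict (ball 0 (real n) - \<Lambda>) \<omega>))"
  have "bounded (ball 0 (real n) - \<Lambda>)" for n by (rule bounded_subset[OF bounded_ball]) auto
  then have [measurable]: "(\<lambda>\<omega>. ncc (config_restrict (ball 0 (real n)) \<omega>)) \<in> measurable ?C (count_space UNIV)"
    "(\<lambda>\<omega>. ncc (config_restrict (ball 0 (real n) - \<Lambda>) \<omega>)) \<in> measurable ?C (count_space UNIV)" for n
    using L by (auto intro!: ncc_restrict_measurable)
  have "{\<omega> \<in> space ?C. ncc_local \<Lambda> \<omega> = k} = {\<omega> \<in> space ?C. \<exists>N. \<forall>n\<in>{N..}. ?d n \<omega> = k}" for k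
  proof -
    have "ncc_local \<Lambda> \<omega> = k \<longleftrightarrow> (\<exists>N. \<forall>n\<in>{N..}. ?d n \<omega> = k)" if "\<omega> \<in> configurations" for \<omega>
    proof -
      note lim = ncc_local_limit[OF that L, unfolded eventually_sequentially]
      show ?thesis
      proof
        assume "\<exists>N. \<forall>n\<in>{N..}. ?d n \<omega> = k"
        then obtain N where N: "\<And>n. n \<ge> N \<Longrightarrow> ?d n \<omega> = k" by auto
        obtain N' where N': "\<And>n. n \<ge> N' \<Longrightarrow> ?d n \<omega> = ncc_local \<Lambda> \<omega>" using lim by blast
        show "ncc_local \<Lambda> \<omega> = k" using N[of "max N N'"] N'[of "max N N'"] by simp
      qed (use lim in auto)
    qed
    then show ?thesis by (auto simp: space_config_space)
  qed
  moreover have "{\<omega> \<in> space ?C. \<exists>N. \<forall>n\<in>{N..}. ?d n \<omega> = k} \<in> sets ?C" for k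
    by measurable
  ultimately show ?thesis
    by (subst measurable_count_space_eq2_countable) (auto simp: vimage_def Int_def conj_commute)
qed

text \<open>Both local numbers are attained on one common finite set of outer points, so the
  counting bounds for clusters of finite sets carry over.\<close>

lemma ncc_local_add:
  fixes \<omega> \<omega>' :: "('a::euclidean_space \<times> real) measure"
  assumes w: "\<omega> \<in> configurations" "\<omega>' \<in> configurations" and L: "\<Lambda> \<in> sets borel" "bounded \<Lambda>"
    and out: "atoms \<omega>' - \<Lambda> \<times> UNIV = atoms \<omega> - \<Lambda> \<times> UNIV"
    and ins: "atoms \<omega>' \<inter> \<Lambda> \<times> UNIV = (atoms \<omega> \<inter> \<Lambda> \<times> UNIV) \<union> X"
  shows ncc_local_add_le: "ncc_local \<Lambda> \<omega>' \<le> ncc_local \<Lambda> \<omega> + int (card X)"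
    and ncc_local_add_ge: "(\<And>A. finite A \<Longrightarrow> A \<subseteq> atoms \<omega> \<Longrightarrow>
        card {C \<in> clusters touch A. \<exists>p\<in>C. \<exists>b\<in>X. touch p b} \<le> K) \<Longrightarrow>
      ncc_local \<Lambda> \<omega> \<le> ncc_local \<Lambda> \<omega>' + int K"
proof -
  let ?Z = "atoms \<omega> \<inter> \<Lambda> \<times> UNIV" and ?H = "atoms \<omega> - \<Lambda> \<times> UNIV"
  have Z: "finite ?Z" using finite_atoms[OF w(1) L(2)] .
  have X: "finite X" using finite_atoms[OF w(2) L(2)] ins by simp
  obtain B where B: "finite B" "B \<subseteq> ?H"
    "\<And>A. finite A \<Longrightarrow> B \<subseteq> A \<Longrightarrow> A \<subseteq> ?H \<Longrightarrow> merging touch ?Z A = ncc_local \<Lambda> \<omega>"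
    using ncc_local_stable[OF w(1) L] by blast
  obtain B' where B': "finite B'" "B' \<subseteq> ?H"
    "\<And>A. finite A \<Longrightarrow> B' \<subseteq> A \<Longrightarrow> A \<subseteq> ?H \<Longrightarrow> merging touch (?Z \<union> X) A = ncc_local \<Lambda> \<omega>'"
    using ncc_local_stable[OF w(2) L] unfolding out ins by blast
  define A where "A = B \<union> B'"
  have A: "finite A" "A \<subseteq> ?H" using B B' by (auto simp: A_def)
  have m: "merging touch ?Z A = ncc_local \<Lambda> \<omega>" "merging touch (?Z \<union> X) A = ncc_local \<Lambda> \<omega>'"
    using A by (auto intro!: B(3) B'(3) simp: A_def)
  have U: "?Z \<union> X \<union> A = (?Z \<union> A) \<union> X" by auto
  show "ncc_local \<Lambda> \<omega>' \<le> ncc_local \<Lambda> \<omega> + int (card X)"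
    using touch.card_clusters_union_le[of "?Z \<union> A" X] Z A(1) X unfolding m[symmetric] merging_def U by simp
  assume K: "\<And>A. finite A \<Longrightarrow> A \<subseteq> atoms \<omega> \<Longrightarrow> card {C \<in> clusters touch A. \<exists>p\<in>C. \<exists>b\<in>X. touch p b} \<le> K"
  have "card {C \<in> clusters touch (?Z \<union> A). \<exists>p\<in>C. \<exists>b\<in>X. touch p b} \<le> K"
    using Z A by (intro K) auto
  then show "ncc_local \<Lambda> \<omega> \<le> ncc_local \<Lambda> \<omega>' + int K"
    using touch.card_clusters_union_ge[of "?Z \<union> A" X] Z A(1) X unfolding m[symmetric] merging_def U by simp
qed

lemma ncc_local_cong:
  fixes \<omega> \<omega>' :: "('a::euclidean_space \<times> real) measure"
  assumes "\<omega> \<in> configurations" "\<omega>' \<in> configurations" "\<Lambda> \<in> sets borel" "bounded \<Lambda>" "atoms \<omega> = atoms \<omega>'"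
  shows "ncc_local \<Lambda> \<omega> = ncc_local \<Lambda> \<omega>'"
  using ncc_local_add_le[of \<omega> \<omega>' \<Lambda> "{}"] ncc_local_add_le[of \<omega>' \<omega> \<Lambda> "{}"] assms by simp

section \<open>Poisson processes\<close>

lemma (in prob_space) nn_integral_indep_var:
  assumes indep: "indep_var S X T Y"
    and f [measurable]: "f \<in> borel_measurable S" and g [measurable]: "g \<in> borel_measurable T"
  shows "(\<integral>\<^sup>+ x. f (X x) * g (Y x) \<partial>M) = (\<integral>\<^sup>+ x. f (X x) \<partial>M) * (\<integral>\<^sup>+ x. g (Y x) \<partial>M)"
proof -
  have X [measurable]: "random_variable S X" and Y [measurable]: "random_variable T Y"
    using indep indep_var_rv1 indep_var_rv2 by auto
  have eq: "distr M S X \<Otimes>\<^sub>M distr M T Y = distr M (S \<Otimes>\<^sub>M T) (\<lambda>x. (X x, Y x))"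
    using indep unfolding indep_var_distribution_eq by simp
  interpret Y: prob_space "distr M T Y" by (rule prob_space_distr) simp
  have "(\<integral>\<^sup>+ x. f (X x) * g (Y x) \<partial>M) = (\<integral>\<^sup>+ z. f (fst z) * g (snd z) \<partial>(distr M S X \<Otimes>\<^sub>M distr M T Y))"
    unfolding eq by (subst nn_integral_distr) auto
  also have "\<dots> = (\<integral>\<^sup>+ x. \<integral>\<^sup>+ y. f x * g y \<partial>distr M T Y \<partial>distr M S X)"
    by (subst Y.nn_integral_fst[symmetric]) auto
  also have "\<dots> = (\<integral>\<^sup>+ x. f x * (\<integral>\<^sup>+ y. g y \<partial>distr M T Y) \<partial>distr M S X)"
    by (intro nn_integral_cong nn_integral_cmult) simp
  also have "\<dots> = (\<integral>\<^sup>+ x. f x \<partial>distr M S X) * (\<integral>\<^sup>+ y. g y \<partial>distr M T Y)"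
    by (rule nn_integral_multc) simp
  finally show ?thesis by (simp add: nn_integral_distr)
qed

locale poisson_process =
  fixes \<mu> :: "('a::euclidean_space \<times> real) measure" and \<pi> :: "('a \<times> real) measure measure"
  assumes law: "poisson_process_law \<mu> \<pi>" and sets_mu: "sets \<mu> = sets point_space"
begin

sublocale prob_space \<pi> using law by (simp add: poisson_process_law_def)

lemma sets_pi [measurable_cong]: "sets \<pi> = sets config_space"
  using law by (simp add: poisson_process_law_def)

lemma space_pi: "space \<pi> = configurations"
  using sets_eq_imp_space_eq[OF sets_pi] by (simp add: space_config_space)

lemma count_rv: "A \<in> sets point_space \<Longrightarrow> random_variable borel (\<lambda>\<omega>. emeasure \<omega> A)"
  using measurable_count[of A] by (simp add: measurable_cong_sets[OF sets_pi])

lemma restr_rv: "A \<in> sets point_space \<Longrightarrow> random_variable config_space (restr A)"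
  using measurable_restr[of A] by (simp add: measurable_cong_sets[OF sets_pi])

abbreviation compl :: "('a \<times> real) set \<Rightarrow> ('a \<times> real) set" where
  "compl G \<equiv> UNIV \<times> {0..} - G"

lemma compl_sets: "G \<in> sets point_space \<Longrightarrow> compl G \<in> sets (point_space :: ('a \<times> real) measure)"
  using sets.compl_sets[of G "point_space :: ('a \<times> real) measure"] by (simp add: space_point_space)

text \<open>
  The finitely many sets \<open>A - G\<close> are cut into the disjoint cells of the Boolean algebra they
  generate, to which the independence of counts on disjoint sets applies.
\<close>
lemma prob_count_cylinder:
  assumes G: "G \<in> sets point_space" and J: "finite J" "J \<subseteq> sets point_space"
    and b: "b \<in> sets borel" and B: "\<And>A. B A \<in> sets borel"
  shows "prob ({\<omega> \<in> space \<pi>. emeasure \<omega> G \<in> b} \<inter> {\<omega> \<in> space \<pi>. \<forall>A\<in>J. emeasure \<omega> (A - G) \<in> B A}) =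
    prob {\<omega> \<in> space \<pi>. emeasure \<omega> G \<in> b} * prob {\<omega> \<in> space \<pi>. \<forall>A\<in>J. emeasure \<omega> (A - G) \<in> B A}"
proof -
  obtain h :: "nat \<Rightarrow> ('a \<times> real) set set" where h: "bij_betw h {0..<card (Pow J)} (Pow J)"
    using ex_bij_betw_nat_finite[of "Pow J"] J(1) by auto
  let ?N = "card (Pow J)"
  define cell where "cell T = {p \<in> compl G. \<forall>A\<in>J. p \<in> A \<longleftrightarrow> A \<in> T}" for T
  \<comment> \<open>\<open>G\<close> comes first, then the cells; empty sets fill up the sequence,
    as the Poisson law is stated for infinite sequences of disjoint sets.\<close>
  define D where "D i = (case i of 0 \<Rightarrow> G | Suc i \<Rightarrow> if i < ?N then cell (h i) else {})" for i
  have cell: "cell T \<in> sets point_space" for T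
  proof -
    have "cell T = {p \<in> space point_space. p \<notin> G \<and> (\<forall>A\<in>J. p \<in> A \<longleftrightarrow> A \<in> T)}"
      by (auto simp: cell_def space_point_space)
    also have "\<dots> \<in> sets point_space"
    proof (intro sets.sets_Collect_conj sets.sets_Collect_finite_All J(1))
      show "{p \<in> space point_space. p \<notin> G} \<in> sets point_space"
        using compl_sets[OF G] by (auto simp: space_point_space set_diff_eq)
      show "{p \<in> space point_space. p \<in> A \<longleftrightarrow> A \<in> T} \<in> sets point_space" if "A \<in> J" for A
      proof -
        have "A \<in> sets point_space" using that J(2) by auto
        then have "Measurable.pred point_space (\<lambda>p. p \<in> A)" by simp
        then show ?thesis by measurable
      qed
    qed
    finally show ?thesis .
  qed
  have D: "D i \<in> sets point_space" for i
    by (auto simp: D_def G cell split: nat.split)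
  have "cell (h i) \<inter> cell (h j) = {}" if "i < ?N" "j < ?N" "i \<noteq> j" for i j
  proof -
    have "h i \<noteq> h j"
      using bij_betw_imp_inj_on[OF h] that by (simp add: inj_on_eq_iff)
    moreover have "h i \<subseteq> J" "h j \<subseteq> J" using bij_betwE[OF h] that by auto
    ultimately obtain A where "A \<in> J" "(A \<in> h i) \<noteq> (A \<in> h j)" by blast
    then show ?thesis unfolding cell_def by blast
  qed
  then have disj: "disjoint_family D"
    by (auto simp: disjoint_family_on_def D_def cell_def split: nat.splits)
  have ind: "indep_vars (\<lambda>_. borel) (\<lambda>i \<omega>. emeasure \<omega> (D i)) UNIV"
    using law D disj unfolding poisson_process_law_def by blast
  define K where "K = Suc ` {0..<?N}"
  note iv = indep_var_restrict[OF ind, of "{0}" K]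
  let ?I = "\<lambda>A. {i \<in> {0..<?N}. A \<in> h i}"
  have sum: "emeasure \<omega> (A - G) = (\<Sum>i\<in>?I A. emeasure \<omega> (D (Suc i)))" if "A \<in> J" "\<omega> \<in> space \<pi>" for A \<omega>
  proof -
    have "A \<in> sets point_space" using that(1) J(2) by auto
    note AS = sets.sets_into_space[OF this, unfolded space_point_space]
    have "A - G = (\<Union>i\<in>?I A. D (Suc i))"
    proof (intro equalityI subsetI)
      fix p assume p: "p \<in> A - G"
      have "{A \<in> J. p \<in> A} \<in> Pow J" by auto
      then obtain i where i: "i < ?N" "h i = {A \<in> J. p \<in> A}"
        using h unfolding bij_betw_def by (metis (no_types, lifting) atLeastLessThan_iff imageE)
      then show "p \<in> (\<Union>i\<in>?I A. D (Suc i))" using p AS that by (auto simp: D_def cell_def intro!: bexI[of _ i])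
    next
      fix p assume "p \<in> (\<Union>i\<in>?I A. D (Suc i))"
      then show "p \<in> A - G" using that by (auto simp: D_def cell_def)
    qed
    moreover have "(\<Sum>i\<in>?I A. emeasure \<omega> (D (Suc i))) = emeasure \<omega> (\<Union>i\<in>?I A. D (Suc i))"
    proof (rule sum_emeasure)
      show "disjoint_family_on (\<lambda>i. D (Suc i)) (?I A)"
        using disj by (auto simp: disjoint_family_on_def)
    qed (use that D in \<open>auto simp: space_pi sets_config\<close>)
    ultimately show ?thesis by simp
  qed
  let ?b = "{f \<in> space (Pi\<^sub>M {0} (\<lambda>_. borel)). f (0::nat) \<in> b}"
  let ?B = "{f \<in> space (Pi\<^sub>M K (\<lambda>_. borel)). \<forall>A\<in>J. (\<Sum>i\<in>?I A. f (Suc i)) \<in> B A}"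
  have "?b \<in> sets (Pi\<^sub>M {0::nat} (\<lambda>_. borel :: ennreal measure))" using b by measurable
  moreover have "?B \<in> sets (Pi\<^sub>M K (\<lambda>_. borel :: ennreal measure))"
  proof (intro sets.sets_Collect_finite_All J(1))
    fix A
    have [measurable]: "B A \<in> sets borel" using B .
    have [measurable]: "(\<lambda>f. f (Suc i)) \<in> borel_measurable (Pi\<^sub>M K (\<lambda>_. borel :: ennreal measure))"
      if "i \<in> ?I A" for i using that by (intro measurable_component_singleton) (auto simp: K_def)
    have "(\<lambda>f. \<Sum>i\<in>?I A. f (Suc i)) \<in> borel_measurable (Pi\<^sub>M K (\<lambda>_. borel :: ennreal measure))"
      by (intro borel_measurable_sum) simp
    then show "{f \<in> space (Pi\<^sub>M K (\<lambda>_. borel)). (\<Sum>i\<in>?I A. f (Suc i)) \<in> B A} \<in> sets (Pi\<^sub>M K (\<lambda>_. borel :: ennreal measure))"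
      by measurable
  qed
  moreover have "indep_var (Pi\<^sub>M {0} (\<lambda>_. borel)) (\<lambda>\<omega>. \<lambda>i\<in>{0}. emeasure \<omega> (D i))
      (Pi\<^sub>M K (\<lambda>_. borel)) (\<lambda>\<omega>. \<lambda>i\<in>K. emeasure \<omega> (D i))"
    by (rule iv) (auto simp: K_def)
  ultimately have "prob ((\<lambda>\<omega>. (\<lambda>i\<in>{0}. emeasure \<omega> (D i), \<lambda>i\<in>K. emeasure \<omega> (D i))) -` (?b \<times> ?B) \<inter> space \<pi>) =
    prob ((\<lambda>\<omega>. \<lambda>i\<in>{0}. emeasure \<omega> (D i)) -` ?b \<inter> space \<pi>) * prob ((\<lambda>\<omega>. \<lambda>i\<in>K. emeasure \<omega> (D i)) -` ?B \<inter> space \<pi>)"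
    by (intro indep_varD)
  moreover have "(\<lambda>\<omega>. (\<lambda>i\<in>{0}. emeasure \<omega> (D i), \<lambda>i\<in>K. emeasure \<omega> (D i))) -` (?b \<times> ?B) \<inter> space \<pi> =
      ((\<lambda>\<omega>. \<lambda>i\<in>{0}. emeasure \<omega> (D i)) -` ?b \<inter> space \<pi>) \<inter> ((\<lambda>\<omega>. \<lambda>i\<in>K. emeasure \<omega> (D i)) -` ?B \<inter> space \<pi>)"
    by blast
  moreover have "(\<lambda>\<omega>. \<lambda>i\<in>{0}. emeasure \<omega> (D i)) -` ?b \<inter> space \<pi> = {\<omega> \<in> space \<pi>. emeasure \<omega> G \<in> b}"
    by (auto simp: D_def space_PiM)
  moreover have "(\<lambda>\<omega>. \<lambda>i\<in>K. emeasure \<omega> (D i)) -` ?B \<inter> space \<pi> = {\<omega> \<in> space \<pi>. \<forall>A\<in>J. emeasure \<omega> (A - G) \<in> B A}"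
  proof -
    have "(\<Sum>i\<in>?I A. (\<lambda>i\<in>K. emeasure \<omega> (D i)) (Suc i)) = emeasure \<omega> (A - G)" if "A \<in> J" "\<omega> \<in> space \<pi>" for A \<omega>
      unfolding sum[OF that] by (intro sum.cong) (auto simp: K_def)
    then show ?thesis by (auto simp: space_PiM)
  qed
  ultimately show ?thesis by simp
qed

text \<open>Cylinder events in the counts outside \<open>G\<close> are stable under intersection and
  generate all that \<open>restr (compl G)\<close> can observe, so their independence of the count
  of \<open>G\<close> extends to it.\<close>

lemma indep_count_restr:
  assumes G: "G \<in> sets point_space"
  shows "indep_var (vimage_algebra configurations (\<lambda>\<omega>. emeasure \<omega> G) borel) (\<lambda>\<omega>. \<omega>) config_space (restr (compl G))"
proof -
  let ?S = "vimage_algebra configurations (\<lambda>\<omega>. emeasure \<omega> G) borel"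
  let ?a = "{(\<lambda>\<omega>. emeasure \<omega> G) -` A \<inter> space \<pi> | A. A \<in> sets borel}"
  let ?b = "{restr (compl G) -` A \<inter> space \<pi> | A. A \<in> sets config_space}"
  let ?cyl = "{{\<omega> \<in> space \<pi>. \<forall>A\<in>J. emeasure \<omega> (A - G) \<in> B A} | J B.
      finite J \<and> J \<subseteq> sets point_space \<and> (\<forall>A. B A \<in> sets borel)}"
  have cnt: "random_variable borel (\<lambda>\<omega>. emeasure \<omega> (A - G))" if "A \<in> sets point_space" for A
    using that G by (intro count_rv) auto
  have cyl_ev: "?cyl \<subseteq> events"
  proof clarify
    fix J :: "('a \<times> real) set set" and B :: "('a \<times> real) set \<Rightarrow> ennreal set"
    assume J: "finite J" "J \<subseteq> sets point_space" "\<forall>A. B A \<in> sets borel"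
    show "{\<omega> \<in> space \<pi>. \<forall>A\<in>J. emeasure \<omega> (A - G) \<in> B A} \<in> events"
    proof (intro sets.sets_Collect_finite_All J(1))
      fix A assume "A \<in> J"
      then have "random_variable borel (\<lambda>\<omega>. emeasure \<omega> (A - G))" using J(2) by (intro cnt) auto
      then show "{\<omega> \<in> space \<pi>. emeasure \<omega> (A - G) \<in> B A} \<in> events" using J(3) by measurable
    qed
  qed
  have a_ev: "?a \<subseteq> events" using measurable_sets[OF count_rv[OF G]] by auto
  have "indep_set ?a ?cyl"
  proof (rule indep_setI[OF a_ev cyl_ev], clarify)
    fix b :: "ennreal set" and J :: "('a \<times> real) set set" and B :: "('a \<times> real) set \<Rightarrow> ennreal set"
    assume "b \<in> sets borel" "finite J" "J \<subseteq> sets point_space" "\<forall>A. B A \<in> sets borel"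
    then show "prob ((\<lambda>\<omega>. emeasure \<omega> G) -` b \<inter> space \<pi> \<inter> {\<omega> \<in> space \<pi>. \<forall>A\<in>J. emeasure \<omega> (A - G) \<in> B A}) =
        prob ((\<lambda>\<omega>. emeasure \<omega> G) -` b \<inter> space \<pi>) * prob {\<omega> \<in> space \<pi>. \<forall>A\<in>J. emeasure \<omega> (A - G) \<in> B A}"
      using prob_count_cylinder[OF G, of J b B] by (simp add: vimage_def Int_def conj_commute)
  qed
  moreover have "Int_stable ?a"
  proof (rule Int_stableI)
    fix X Y assume "X \<in> ?a" "Y \<in> ?a"
    then obtain A A' where "X = (\<lambda>\<omega>. emeasure \<omega> G) -` A \<inter> space \<pi>" "A \<in> sets borel"
      "Y = (\<lambda>\<omega>. emeasure \<omega> G) -` A' \<inter> space \<pi>" "A' \<in> sets borel" by auto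
    then show "X \<inter> Y \<in> ?a" by (auto intro!: exI[of _ "A \<inter> A'"])
  qed
  moreover have "Int_stable ?cyl"
  proof (rule Int_stableI)
    fix X Y assume "X \<in> ?cyl" "Y \<in> ?cyl"
    then obtain J B J' B' where
      X: "X = {\<omega> \<in> space \<pi>. \<forall>A\<in>J. emeasure \<omega> (A - G) \<in> B A}" "finite J" "J \<subseteq> sets point_space" "\<And>A. B A \<in> sets borel" and
      Y: "Y = {\<omega> \<in> space \<pi>. \<forall>A\<in>J'. emeasure \<omega> (A - G) \<in> B' A}" "finite J'" "J' \<subseteq> sets point_space" "\<And>A. B' A \<in> sets borel"
      by auto
    \<comment> \<open>A set that occurs in only one of the two families gets the trivial condition
      \<open>UNIV\<close> from the other.\<close>
    let ?B = "\<lambda>A. (if A \<in> J then B A else UNIV) \<inter> (if A \<in> J' then B' A else UNIV)"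
    have "X \<inter> Y = {\<omega> \<in> space \<pi>. \<forall>A\<in>J \<union> J'. emeasure \<omega> (A - G) \<in> ?B A}"
      unfolding X(1) Y(1) by (auto split: if_splits)
    moreover have "finite (J \<union> J')" "J \<union> J' \<subseteq> sets point_space" "\<forall>A. ?B A \<in> sets borel" using X Y by auto
    ultimately show "X \<inter> Y \<in> ?cyl" by (intro CollectI exI[of _ "J \<union> J'"] exI[of _ ?B] conjI)
  qed
  ultimately have ind: "indep_set (sigma_sets (space \<pi>) ?a) (sigma_sets (space \<pi>) ?cyl)"
    by (rule indep_set_sigma_sets)
  define M where "M = sigma (space \<pi>) ?cyl"
  have cyl_sub: "?cyl \<subseteq> Pow (space \<pi>)" by auto
  have spM: "space M = space \<pi>" unfolding M_def by (rule space_measure_of[OF cyl_sub])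
  have setsM: "sets M = sigma_sets (space \<pi>) ?cyl" unfolding M_def by (rule sets_measure_of[OF cyl_sub])
  have "restr (compl G) \<in> measurable M config_space"
  proof (rule measurable_into_config_space)
    show "restr (compl G) \<omega> \<in> configurations" if "\<omega> \<in> space M" for \<omega>
      using that restr_config[OF compl_sets[OF G]] by (simp add: spM space_pi)
    fix A assume A: "A \<in> sets (point_space :: ('a \<times> real) measure)"
    have AS: "A \<subseteq> UNIV \<times> {0..}" using sets.sets_into_space[OF A] by (simp add: space_point_space)
    show "(\<lambda>\<omega>. emeasure (restr (compl G) \<omega>) A) \<in> borel_measurable M"
    proof (rule measurableI)
      fix B :: "ennreal set" assume B: "B \<in> sets borel"
      have eq: "emeasure (restr (compl G) \<omega>) A = emeasure \<omega> (A - G)" if "\<omega> \<in> space \<pi>" for \<omega>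
      proof -
        have "A \<inter> compl G = A - G" using AS by auto
        then show ?thesis using emeasure_restr[OF compl_sets[OF G] _ A] that by (simp add: space_pi)
      qed
      have "(\<lambda>\<omega>. emeasure (restr (compl G) \<omega>) A) -` B \<inter> space M = {\<omega> \<in> space \<pi>. \<forall>A\<in>{A}. emeasure \<omega> (A - G) \<in> B}"
        using eq by (auto simp: spM)
      also have "\<dots> \<in> ?cyl" using A B by (intro CollectI exI[of _ "{A}"] exI[of _ "\<lambda>_. B"]) auto
      finally show "(\<lambda>\<omega>. emeasure (restr (compl G) \<omega>) A) -` B \<inter> space M \<in> sets M"
        unfolding setsM by (rule sigma_sets.Basic)
    qed simp
  qed
  from measurable_sets[OF this] have "?b \<subseteq> sigma_sets (space \<pi>) ?cyl"
    unfolding setsM spM by blast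
  then have "sigma_sets (space \<pi>) ?b \<subseteq> sigma_sets (space \<pi>) ?cyl"
    by (rule sigma_sets_mono)
  then have "indep_set (sigma_sets (space \<pi>) ?a) (sigma_sets (space \<pi>) ?b)"
    using ind indep_setD_ev1[OF ind] indep_setD_ev2[OF ind] unfolding indep_sets2_eq by blast
  moreover have S: "sets ?S = ?a"
    using count_rv[OF G] by (simp add: sets_vimage_algebra2 space_pi)
  then have "{(\<lambda>\<omega>. \<omega>) -` A \<inter> space \<pi> | A. A \<in> sets ?S} = ?a" by auto
  moreover have "(\<lambda>\<omega>. \<omega>) \<in> measurable \<pi> ?S"
    using count_rv[OF G] by (intro measurable_vimage_algebra2) (auto simp: space_pi)
  ultimately show ?thesis
    unfolding indep_var_eq using restr_rv[OF compl_sets[OF G]] by simp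
qed

lemma nn_integral_count_restr:
  assumes "G \<in> sets point_space" "v \<in> borel_measurable borel" "u \<in> borel_measurable config_space"
  shows "(\<integral>\<^sup>+ \<omega>. v (emeasure \<omega> G) * u (restr (compl G) \<omega>) \<partial>\<pi>) =
    (\<integral>\<^sup>+ \<omega>. v (emeasure \<omega> G) \<partial>\<pi>) * (\<integral>\<^sup>+ \<omega>. u (restr (compl G) \<omega>) \<partial>\<pi>)"
proof (rule nn_integral_indep_var[OF indep_count_restr[OF assms(1)] _ assms(3)])
  show "(\<lambda>\<omega>. v (emeasure \<omega> G)) \<in> borel_measurable (vimage_algebra configurations (\<lambda>\<omega>. emeasure \<omega> G) borel)"
    by (rule measurable_compose[OF measurable_vimage_algebra1 assms(2)]) simp
qed

lemma nn_integral_count: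
  assumes G: "G \<in> sets point_space" "emeasure \<mu> G < \<infinity>" and v: "v \<in> borel_measurable borel"
  shows "(\<integral>\<^sup>+ \<omega>. v (emeasure \<omega> G) \<partial>\<pi>) =
    (\<Sum>k. v (of_nat k) * ennreal (exp (- measure \<mu> G) * measure \<mu> G ^ k / fact k))"
proof -
  let ?m = "measure \<mu> G"
  let ?E = "\<lambda>k. {\<omega> \<in> space \<pi>. emeasure \<omega> G = of_nat k}"
  let ?p = "\<lambda>k. exp (- ?m) * ?m ^ k / fact k"
  have E: "?E k \<in> events" for k using count_rv[OF G(1)] by measurable
  have pk: "prob (?E k) = ?p k" for k
    using law G unfolding poisson_process_law_def by blast
  have "?p sums (exp (- ?m) * exp ?m)"
    using sums_mult[OF exp_converges[of ?m], of "exp (- ?m)"] by (simp add: field_simps)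
  then have p1: "?p sums 1" by (simp add: exp_minus)
  have "disjoint_family ?E" by (auto simp: disjoint_family_on_def)
  then have "(\<lambda>k. prob (?E k)) sums prob (\<Union>k. ?E k)"
    using E by (intro finite_measure_UNION) auto
  \<comment> \<open>The Poisson weights sum to 1, so the count of \<open>G\<close> is almost surely
    a finite integer, and the integral becomes a sum over its values.\<close>
  then have "prob (\<Union>k. ?E k) = 1" using p1 sums_unique2 unfolding pk by blast
  then have "AE \<omega> in \<pi>. \<omega> \<in> (\<Union>k. ?E k)" using E by (intro AE_prob_1) auto
  then have "AE \<omega> in \<pi>. v (emeasure \<omega> G) = (\<Sum>k. v (of_nat k) * indicator (?E k) \<omega>)"
  proof eventually_elim
    case (elim \<omega>)
    then obtain k where k: "\<omega> \<in> space \<pi>" "emeasure \<omega> G = of_nat k" by auto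
    have "(\<Sum>j. v (of_nat j) * indicator (?E j) \<omega>) = (\<Sum>j\<in>{k}. v (of_nat j) * indicator (?E j) \<omega>)"
      by (rule suminf_finite) (use k in auto)
    then show ?case using k by simp
  qed
  then have "(\<integral>\<^sup>+ \<omega>. v (emeasure \<omega> G) \<partial>\<pi>) = (\<integral>\<^sup>+ \<omega>. (\<Sum>k. v (of_nat k) * indicator (?E k) \<omega>) \<partial>\<pi>)"
    by (rule nn_integral_cong_AE)
  also have "\<dots> = (\<Sum>k. \<integral>\<^sup>+ \<omega>. v (of_nat k) * indicator (?E k) \<omega> \<partial>\<pi>)"
    using E by (intro nn_integral_suminf) auto
  also have "\<dots> = (\<Sum>k. v (of_nat k) * ennreal (?p k))"
    using E by (intro suminf_cong) (simp add: nn_integral_cmult_indicator emeasure_eq_measure pk)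
  finally show ?thesis .
qed

end

section \<open>Exponential moments of Poisson counts\<close>

text \<open>The power \<open>q ^ k\<close> for a count \<open>k\<close> that is given as an extended
  real. The floor makes it total, and the value at infinity keeps \<open>epow_ge\<close> true
  there.\<close>

definition epow :: "real \<Rightarrow> ennreal \<Rightarrow> ennreal" where
  "epow q x = (if x = \<top> then \<top> else ennreal (q ^ nat \<lfloor>enn2real x\<rfloor>))"

lemma epow_of_nat [simp]: "epow q (of_nat k) = ennreal (q ^ k)"
  by (simp add: epow_def ennreal_of_nat_eq_real_of_nat)

lemma epow_measurable [measurable]: "epow q \<in> borel_measurable borel"
  unfolding epow_def by measurable

lemma epow_ge:
  assumes "1 \<le> q" "of_nat k \<le> x"
  shows "ennreal (q ^ k) \<le> epow q x"
proof (cases x)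
  case (real r)
  then have "real k \<le> r" using assms(2) by (simp add: ennreal_of_nat_eq_real_of_nat)
  then have "k \<le> nat \<lfloor>r\<rfloor>" by linarith
  then show ?thesis using real assms by (auto simp: epow_def intro!: ennreal_leI power_increasing)
qed (simp add: epow_def)

context poisson_process
begin

lemma nn_integral_count_0:
  assumes G: "G \<in> sets point_space" "emeasure \<mu> G < \<infinity>"
  shows "(\<integral>\<^sup>+ \<omega>. (if emeasure \<omega> G = 0 then 1 else 0) \<partial>\<pi>) = ennreal (exp (- measure \<mu> G))"
proof -
  have "(\<integral>\<^sup>+ \<omega>. (if emeasure \<omega> G = 0 then 1 else 0) \<partial>\<pi>) =
      (\<Sum>k. (if of_nat k = (0::ennreal) then 1 else 0) * ennreal (exp (- measure \<mu> G) * measure \<mu> G ^ k / fact k))"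
    by (rule nn_integral_count[OF G]) simp
  also have "\<dots> = (\<Sum>k\<in>{0::nat}. (if of_nat k = (0::ennreal) then 1 else 0) * ennreal (exp (- measure \<mu> G) * measure \<mu> G ^ k / fact k))"
    by (rule suminf_finite) auto
  finally show ?thesis by simp
qed

text \<open>The generating function of the Poisson distribution with mean
  \<open>measure \<mu> G\<close>.\<close>

lemma nn_integral_epow:
  assumes G: "G \<in> sets point_space" "emeasure \<mu> G < \<infinity>" and q: "0 \<le> q"
  shows "(\<integral>\<^sup>+ \<omega>. epow q (emeasure \<omega> G) \<partial>\<pi>) = ennreal (exp ((q - 1) * measure \<mu> G))"
proof -
  let ?m = "measure \<mu> G"
  have "(\<lambda>k. exp (- ?m) * ((q * ?m) ^ k / fact k)) sums (exp (- ?m) * exp (q * ?m))"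
    using exp_converges[of "q * ?m"] by (intro sums_mult) (simp add: field_simps)
  moreover have "exp (- ?m) * exp (q * ?m) = exp ((q - 1) * ?m)"
    by (simp add: algebra_simps flip: exp_add)
  ultimately have s: "(\<lambda>k. q ^ k * (exp (- ?m) * ?m ^ k / fact k)) sums exp ((q - 1) * ?m)"
    by (simp add: power_mult_distrib mult_ac)
  have "(\<integral>\<^sup>+ \<omega>. epow q (emeasure \<omega> G) \<partial>\<pi>) =
      (\<Sum>k. epow q (of_nat k) * ennreal (exp (- ?m) * ?m ^ k / fact k))"
    by (rule nn_integral_count[OF G epow_measurable])
  also have "\<dots> = (\<Sum>k. ennreal (q ^ k * (exp (- ?m) * ?m ^ k / fact k)))"
    unfolding epow_of_nat using q by (intro suminf_cong ennreal_mult'[symmetric]) simp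
  also have "\<dots> = ennreal (\<Sum>k. q ^ k * (exp (- ?m) * ?m ^ k / fact k))"
    using s q by (intro suminf_ennreal2) (auto simp: sums_iff)
  finally show ?thesis using s by (simp add: sums_iff)
qed

lemma nn_integral_epow_pos:
  assumes G: "G \<in> sets point_space" "emeasure \<mu> G < \<infinity>" and q: "1 \<le> q"
  shows "(\<integral>\<^sup>+ \<omega>. (if emeasure \<omega> G = 0 then 0 else epow q (emeasure \<omega> G)) \<partial>\<pi>) =
    ennreal (exp ((q - 1) * measure \<mu> G) - exp (- measure \<mu> G))"
proof -
  let ?f = "\<lambda>\<omega>. (if emeasure \<omega> G = 0 then 0 else epow q (emeasure \<omega> G))"
  let ?g = "\<lambda>\<omega>. (if emeasure \<omega> G = 0 then 1 else 0 :: ennreal)"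
  note [measurable] = count_rv[OF G(1)]
  have "epow q 0 = 1" using epow_of_nat[of q 0] by simp
  then have "(\<integral>\<^sup>+ \<omega>. epow q (emeasure \<omega> G) \<partial>\<pi>) = (\<integral>\<^sup>+ \<omega>. ?f \<omega> + ?g \<omega> \<partial>\<pi>)"
    by (intro nn_integral_cong) auto
  also have "\<dots> = (\<integral>\<^sup>+ \<omega>. ?f \<omega> \<partial>\<pi>) + (\<integral>\<^sup>+ \<omega>. ?g \<omega> \<partial>\<pi>)"
    by (rule nn_integral_add) measurable
  finally have "ennreal (exp ((q - 1) * measure \<mu> G)) = (\<integral>\<^sup>+ \<omega>. ?f \<omega> \<partial>\<pi>) + ennreal (exp (- measure \<mu> G))"
    using nn_integral_epow[OF G, of q] nn_integral_count_0[OF G] q by simp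
  then have "ennreal (exp ((q - 1) * measure \<mu> G)) - ennreal (exp (- measure \<mu> G)) = (\<integral>\<^sup>+ \<omega>. ?f \<omega> \<partial>\<pi>)"
    by simp
  then show ?thesis by (simp add: ennreal_minus)
qed

end

section \<open>Conditional bounds for Gibbs measures\<close>

definition glue :: "'a::euclidean_space set \<Rightarrow> ('a \<times> real) measure \<Rightarrow> ('a \<times> real) measure \<Rightarrow> ('a \<times> real) measure" where
  "glue \<Lambda> \<omega>' \<omega> = config_add (config_restrict \<Lambda> \<omega>') (config_restrict (- \<Lambda>) \<omega>)"

lemma glue_config:
  assumes "\<Lambda> \<in> sets borel" "\<omega>' \<in> configurations" "\<omega> \<in> configurations"
  shows "glue \<Lambda> \<omega>' \<omega> \<in> configurations"
  using assms unfolding glue_def by (intro config_add_config config_restrict_config) auto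

lemma atoms_glue:
  assumes "\<Lambda> \<in> sets borel" "\<omega>' \<in> configurations" "\<omega> \<in> configurations"
  shows "atoms (glue \<Lambda> \<omega>' \<omega>) = (atoms \<omega>' \<inter> \<Lambda> \<times> UNIV) \<union> (atoms \<omega> - \<Lambda> \<times> UNIV)"
proof -
  have "- \<Lambda> \<in> sets borel" using assms(1) by auto
  note c = config_restrict_config[OF assms(1,2)] config_restrict_config[OF this assms(3)]
    and a = atoms_config_restrict[OF assms(1,2)] atoms_config_restrict[OF \<open>- \<Lambda> \<in> sets borel\<close> assms(3)]
  show ?thesis unfolding glue_def atoms_config_add[OF c] a by auto
qed

lemma glue_measurable:
  assumes "\<Lambda> \<in> sets borel" "\<omega> \<in> configurations"
  shows "(\<lambda>\<omega>'. glue \<Lambda> \<omega>' \<omega>) \<in> measurable config_space config_space"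
  unfolding glue_def
proof (rule measurable_config_add[OF measurable_config_restrict[OF assms(1)]])
  have "- \<Lambda> \<in> sets borel" using assms(1) by auto
  then show "(\<lambda>_. config_restrict (- \<Lambda>) \<omega>) \<in> measurable config_space config_space"
    using config_restrict_config[OF _ assms(2)] by (intro measurable_const) (simp add: space_config_space)
qed

lemma restr_idem:
  assumes "G \<in> sets point_space" "\<omega> \<in> configurations"
  shows "restr G (restr G \<omega>) = restr G \<omega>"
proof (rule measure_eqI)
  fix A assume "A \<in> sets (restr G (restr G \<omega>))"
  then have A: "A \<in> sets point_space" using sets_config[OF assms(2)] by (simp add: restr_def)
  then show "emeasure (restr G (restr G \<omega>)) A = emeasure (restr G \<omega>) A"
    using assms restr_config[OF assms] by (simp add: emeasure_restr Int_assoc sets.Int)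
qed (simp add: restr_def)

text \<open>Lets integrals over \<open>law_restrict \<Lambda> \<pi>\<close> be written as integrals
  over \<open>\<pi>\<close> itself.\<close>

lemma glue_restrict:
  assumes "\<Lambda> \<in> sets borel" "\<omega>' \<in> configurations"
  shows "glue \<Lambda> (config_restrict \<Lambda> \<omega>') \<omega> = glue \<Lambda> \<omega>' \<omega>"
  unfolding glue_def
  using restr_idem[OF slab_in_sets[OF assms(1)] assms(2)] config_restrict_restr[OF assms(1)]
    assms(2) config_restrict_config[OF assms] by metis

text \<open>The Gibbs density before normalisation, as a function of the inner configuration; its
  integral is the partition function, by \<open>partition_eq\<close>.\<close>

definition weight :: "real \<Rightarrow> 'a::euclidean_space set \<Rightarrow> ('a \<times> real) measure \<Rightarrow> ('a \<times> real) measure \<Rightarrow> ennreal" where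
  "weight q \<Lambda> \<omega> \<omega>' = ennreal (q powi ncc_local \<Lambda> (glue \<Lambda> \<omega>' \<omega>))"

lemma weight_measurable:
  fixes \<Lambda> :: "'a::euclidean_space set"
  assumes "\<Lambda> \<in> sets borel" "bounded \<Lambda>" "\<omega> \<in> configurations"
  shows "weight q \<Lambda> \<omega> \<in> borel_measurable config_space"
proof -
  have "(\<lambda>\<omega>'. ncc_local \<Lambda> (glue \<Lambda> \<omega>' \<omega>)) \<in> measurable config_space (count_space UNIV)"
    using measurable_compose[OF glue_measurable[OF assms(1,3)] ncc_local_measurable[OF assms(1,2)]] .
  from measurable_compose[OF this, of "\<lambda>k. ennreal (q powi k)" borel] show ?thesis
    unfolding weight_def by simp
qed

text \<open>The specification with its Poisson law fixed and a general intensity measure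
  \<open>\<mu>\<close>: the estimates see the intensity and the mark law only through
  \<open>\<mu>\<close> of a few regions.\<close>

locale gibbs = poisson_process \<mu> \<pi> for \<mu> :: "('a::euclidean_space \<times> real) measure" and \<pi> +
  fixes q :: real and P :: "('a \<times> real) measure measure"
  assumes q: "1 \<le> q" and P: "prob_space P" "sets P = sets config_space"
    and spec: "\<And>\<Lambda>. bounded \<Lambda> \<Longrightarrow> \<Lambda> \<in> sets borel \<Longrightarrow>
        (AE \<omega> in P. 0 < crcm_partition \<pi> q \<Lambda> (config_restrict (- \<Lambda>) \<omega>) \<and>
                    crcm_partition \<pi> q \<Lambda> (config_restrict (- \<Lambda>) \<omega>) < \<infinity>) \<and>
        (\<forall>f :: ('a \<times> real) measure \<Rightarrow> real.
          f \<in> borel_measurable config_space \<and> (\<exists>C. \<forall>\<omega> \<in> configurations. \<bar>f \<omega>\<bar> \<le> C) \<longrightarrow>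
          (\<integral>\<omega>. f \<omega> \<partial>P) =
          (\<integral>\<omega>. (\<integral>\<omega>'. f (config_add (config_restrict \<Lambda> \<omega>') (config_restrict (- \<Lambda>) \<omega>)) *
                 (q powi ncc_local \<Lambda>
                    (config_add (config_restrict \<Lambda> \<omega>') (config_restrict (- \<Lambda>) \<omega>)) /
                  enn2real (crcm_partition \<pi> q \<Lambda> (config_restrict (- \<Lambda>) \<omega>)))
               \<partial>law_restrict \<Lambda> \<pi>) \<partial>P))"
begin

lemma space_P: "space P = configurations"
  using sets_eq_imp_space_eq[OF P(2)] by (simp add: space_config_space)

lemma prob_configurations: "measure P configurations = 1"
  using prob_space.prob_space[OF P(1)] by (simp add: space_P)

lemma sets_percolates: "{\<omega> \<in> space P. percolates \<omega>} \<in> sets P"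
  using percolates_measurable unfolding pred_def by (simp add: P(2) space_P space_config_space)

lemma distr_law_restrict:
  assumes "\<Lambda> \<in> sets borel" "g \<in> borel_measurable config_space"
  shows "(\<integral>\<^sup>+ \<omega>'. g \<omega>' \<partial>law_restrict \<Lambda> \<pi>) = (\<integral>\<^sup>+ \<omega>'. g (config_restrict \<Lambda> \<omega>') \<partial>\<pi>)"
proof -
  have "config_restrict \<Lambda> \<in> measurable \<pi> config_space"
    using measurable_config_restrict[OF assms(1)] by (simp add: measurable_cong_sets[OF sets_pi])
  then show ?thesis unfolding law_restrict_def using assms(2) by (intro nn_integral_distr) auto
qed

lemma partition_eq:
  assumes "\<Lambda> \<in> sets borel" "bounded \<Lambda>" "\<omega> \<in> configurations"
  shows "crcm_partition \<pi> q \<Lambda> (config_restrict (- \<Lambda>) \<omega>) = (\<integral>\<^sup>+ \<omega>'. weight q \<Lambda> \<omega> \<omega>' \<partial>\<pi>)"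
proof -
  have "crcm_partition \<pi> q \<Lambda> (config_restrict (- \<Lambda>) \<omega>) = (\<integral>\<^sup>+ \<omega>'. weight q \<Lambda> \<omega> \<omega>' \<partial>law_restrict \<Lambda> \<pi>)"
    by (simp add: crcm_partition_def weight_def glue_def)
  also have "\<dots> = (\<integral>\<^sup>+ \<omega>'. weight q \<Lambda> \<omega> (config_restrict \<Lambda> \<omega>') \<partial>\<pi>)"
    by (rule distr_law_restrict[OF assms(1) weight_measurable[OF assms]])
  also have "\<dots> = (\<integral>\<^sup>+ \<omega>'. weight q \<Lambda> \<omega> \<omega>' \<partial>\<pi>)"
    by (intro nn_integral_cong) (simp add: weight_def glue_restrict[OF assms(1)] space_pi)
  finally show ?thesis .
qed

text \<open>The specification is applied to the indicator of \<open>E \<inter> F\<close>. Resampling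
  inside \<open>\<Lambda>\<close> does not affect \<open>F\<close>, so the indicator of
  \<open>F\<close> leaves the inner integral, and what remains is \<open>bound\<close> divided by
  the partition function.\<close>

lemma conditional_bound:
  assumes L: "\<Lambda> \<in> sets borel" "bounded \<Lambda>" and E: "E \<in> sets config_space" and F: "F \<in> sets config_space"
    and c: "0 \<le> c"
    and outside: "\<And>\<omega> \<omega>'. \<omega> \<in> configurations \<Longrightarrow> \<omega>' \<in> configurations \<Longrightarrow> glue \<Lambda> \<omega>' \<omega> \<in> F \<longleftrightarrow> \<omega> \<in> F"
    and bound: "\<And>\<omega>. \<omega> \<in> configurations \<Longrightarrow>
      (\<integral>\<^sup>+ \<omega>'. indicator E (glue \<Lambda> \<omega>' \<omega>) * weight q \<Lambda> \<omega> \<omega>' \<partial>\<pi>) \<le> ennreal c * (\<integral>\<^sup>+ \<omega>'. weight q \<Lambda> \<omega> \<omega>' \<partial>\<pi>)"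
  shows "measure P (E \<inter> F) \<le> c * measure P F"
proof -
  interpret P: prob_space P by (rule P(1))
  let ?f = "indicator (E \<inter> F) :: ('a \<times> real) measure \<Rightarrow> real"
  let ?Z = "\<lambda>\<omega>. crcm_partition \<pi> q \<Lambda> (config_restrict (- \<Lambda>) \<omega>)"
  define inner where "inner \<omega> = (\<integral>\<omega>'. ?f (glue \<Lambda> \<omega>' \<omega>) * (q powi ncc_local \<Lambda> (glue \<Lambda> \<omega>' \<omega>) / enn2real (?Z \<omega>)) \<partial>law_restrict \<Lambda> \<pi>)" for \<omega>
  have "(\<integral>\<omega>. ?f \<omega> \<partial>P) = (\<integral>\<omega>. inner \<omega> \<partial>P)"
    unfolding inner_def glue_def
    by (rule spec[OF L(2,1), THEN conjunct2, rule_format]) (use E F in \<open>auto intro!: exI[of _ 1] simp: indicator_def\<close>)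
  moreover have "(\<integral>\<omega>. ?f \<omega> \<partial>P) = measure P (E \<inter> F)"
    using E F P(2) by simp
  ultimately have eq: "measure P (E \<inter> F) = (\<integral>\<omega>. inner \<omega> \<partial>P)" by simp
  have "AE \<omega> in P. inner \<omega> \<le> c * indicator F \<omega>"
    using spec[OF L(2,1), THEN conjunct1] AE_space
  proof eventually_elim
    case (elim \<omega>)
    then have w: "\<omega> \<in> configurations" by (simp add: space_P)
    have Z: "?Z \<omega> = (\<integral>\<^sup>+ \<omega>'. weight q \<Lambda> \<omega> \<omega>' \<partial>\<pi>)" by (rule partition_eq[OF L w])
    obtain z where z: "?Z \<omega> = ennreal z" "0 < z"
      using elim(1) by (cases "?Z \<omega>") auto
    have q0: "0 \<le> q powi k" for k using q by (simp add: zero_le_power_int)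
    let ?g = "\<lambda>\<omega>'. ?f (glue \<Lambda> \<omega>' \<omega>) * (q powi ncc_local \<Lambda> (glue \<Lambda> \<omega>' \<omega>) / enn2real (?Z \<omega>))"
    note [measurable] = glue_measurable[OF L(1) w] E F
      measurable_compose[OF glue_measurable[OF L(1) w] ncc_local_measurable[OF L]]
    have g: "?g \<in> borel_measurable config_space"
    proof -
      have [measurable]: "(\<lambda>\<omega>'. q powi ncc_local \<Lambda> (glue \<Lambda> \<omega>' \<omega>)) \<in> borel_measurable config_space"
        by (rule measurable_compose[OF measurable_compose[OF glue_measurable[OF L(1) w] ncc_local_measurable[OF L]], of _ borel]) simp
      have [measurable]: "(\<lambda>\<omega>'. ?f (glue \<Lambda> \<omega>' \<omega>)) \<in> borel_measurable config_space"
        by (rule measurable_compose[OF glue_measurable[OF L(1) w]]) (use E F in auto)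
      show ?thesis by measurable
    qed
    have inner: "inner \<omega> = enn2real (\<integral>\<^sup>+ \<omega>'. ennreal (?g \<omega>') \<partial>law_restrict \<Lambda> \<pi>)"
      unfolding inner_def
      by (rule integral_eq_nn_integral) (use g q0 z in \<open>auto simp: law_restrict_def\<close>)
    have "(\<integral>\<^sup>+ \<omega>'. ennreal (?g \<omega>') \<partial>law_restrict \<Lambda> \<pi>) = (\<integral>\<^sup>+ \<omega>'. ennreal (?g (config_restrict \<Lambda> \<omega>')) \<partial>\<pi>)"
      using g by (intro distr_law_restrict L) measurable
    also have "\<dots> = (\<integral>\<^sup>+ \<omega>'. ennreal (?g \<omega>') \<partial>\<pi>)"
      by (intro nn_integral_cong) (simp add: glue_restrict[OF L(1)] space_pi)
    also have "\<dots> = (\<integral>\<^sup>+ \<omega>'. indicator F \<omega> * (indicator E (glue \<Lambda> \<omega>' \<omega>) * weight q \<Lambda> \<omega> \<omega>' / ennreal z) \<partial>\<pi>)"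
      using outside[OF w] z q0
      by (intro nn_integral_cong)
         (auto simp: indicator_def weight_def space_pi divide_ennreal)
    also have "\<dots> = indicator F \<omega> * ((\<integral>\<^sup>+ \<omega>'. indicator E (glue \<Lambda> \<omega>' \<omega>) * weight q \<Lambda> \<omega> \<omega>' \<partial>\<pi>) / ennreal z)"
    proof -
      have [measurable]: "weight q \<Lambda> \<omega> \<in> borel_measurable \<pi>"
        using weight_measurable[OF L w] by (simp add: measurable_cong_sets[OF sets_pi])
      have "(\<lambda>\<omega>'. indicator E (glue \<Lambda> \<omega>' \<omega>) :: ennreal) \<in> borel_measurable config_space"
        by (rule measurable_compose[OF glue_measurable[OF L(1) w]]) (use E in auto)
      then have [measurable]: "(\<lambda>\<omega>'. indicator E (glue \<Lambda> \<omega>' \<omega>) :: ennreal) \<in> borel_measurable \<pi>"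
        by (simp add: measurable_cong_sets[OF sets_pi])
      show ?thesis by (subst nn_integral_cmult, measurable) (simp add: nn_integral_divide)
    qed
    also have "\<dots> \<le> indicator F \<omega> * ((ennreal c * ennreal z) / ennreal z)"
      using bound[OF w] z Z by (intro mult_left_mono divide_right_mono_ennreal) auto
    also have "\<dots> = ennreal (c * indicator F \<omega>)"
      using z c by (auto simp: indicator_def ennreal_mult[symmetric] divide_ennreal)
    finally have "inner \<omega> \<le> enn2real (ennreal (c * indicator F \<omega>))"
      unfolding inner by (rule enn2real_mono) simp
    then show ?case using c by simp
  qed
  then have "(\<integral>\<omega>. inner \<omega> \<partial>P) \<le> (\<integral>\<omega>. c * indicator F \<omega> \<partial>P)"
  proof (cases "integrable P inner")
    case True
    moreover have "integrable P (indicator F :: _ \<Rightarrow> real)"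
      using F P(2) by (intro integrable_real_indicator) (auto simp: P.emeasure_eq_measure)
    then have "integrable P (\<lambda>\<omega>. c * indicator F \<omega>)" by simp
    ultimately show "AE \<omega> in P. inner \<omega> \<le> c * indicator F \<omega> \<Longrightarrow> ?thesis" by (intro integral_mono_AE)
  next
    \<comment> \<open>By convention the integral of \<open>inner\<close> is then 0, and the
      right-hand side is nonnegative.\<close>
    case False
    then have "(\<integral>\<omega>. inner \<omega> \<partial>P) = 0" by (rule not_integrable_integral_eq)
    moreover have "0 \<le> (\<integral>\<omega>. c * indicator F \<omega> \<partial>P)" using c by (intro integral_nonneg_AE) auto
    ultimately show ?thesis by simp
  qed
  also have "\<dots> = c * measure P F" using F P(2) by simp
  finally show ?thesis using eq by simp
qed

text \<open>Points added inside \<open>\<Lambda>\<close> create at most one component each.\<close>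
lemma weight_le:
  assumes L: "\<Lambda> \<in> sets borel" "bounded \<Lambda>" and w: "\<omega> \<in> configurations" "\<omega>' \<in> configurations" "\<omega>'' \<in> configurations"
    and G: "G \<in> sets point_space" and sub: "atoms \<omega>' \<inter> \<Lambda> \<times> UNIV \<subseteq> atoms \<omega>'' \<union> G" "atoms \<omega>'' \<subseteq> atoms \<omega>'"
  shows "weight q \<Lambda> \<omega> \<omega>' \<le> epow q (emeasure \<omega>' G) * weight q \<Lambda> \<omega> \<omega>''"
proof -
  let ?X = "(atoms \<omega>' \<inter> \<Lambda> \<times> UNIV) - atoms \<omega>''"
  note c = glue_config[OF L(1) w(2,1)] glue_config[OF L(1) w(3,1)]
  note a = atoms_glue[OF L(1) w(2,1)] atoms_glue[OF L(1) w(3,1)]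
  have "ncc_local \<Lambda> (glue \<Lambda> \<omega>' \<omega>) \<le> ncc_local \<Lambda> (glue \<Lambda> \<omega>'' \<omega>) + int (card ?X)"
    by (rule ncc_local_add_le[OF c(2,1) L]) (use sub in \<open>auto simp: a\<close>)
  then have "q powi ncc_local \<Lambda> (glue \<Lambda> \<omega>' \<omega>) \<le> q powi (ncc_local \<Lambda> (glue \<Lambda> \<omega>'' \<omega>) + int (card ?X))"
    using q by (intro power_int_increasing) auto
  also have "\<dots> = q ^ card ?X * q powi ncc_local \<Lambda> (glue \<Lambda> \<omega>'' \<omega>)"
    using q by (simp add: power_int_add)
  finally have 1: "weight q \<Lambda> \<omega> \<omega>' \<le> ennreal (q ^ card ?X) * weight q \<Lambda> \<omega> \<omega>''"
    unfolding weight_def using q by (subst ennreal_mult'[symmetric]) (auto intro!: ennreal_leI simp: zero_le_power_int)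
  have "ennreal (q ^ card ?X) \<le> epow q (emeasure \<omega>' G)"
  proof (rule epow_ge[OF q])
    let ?G = "G \<inter> \<Lambda> \<times> {0..}"
    have G': "?G \<in> sets point_space" using G L by auto
    have fin: "finite (atoms \<omega>' \<inter> ?G)" by (rule finite_subset[OF _ finite_atoms[OF w(2) L(2)]]) auto
    have "?X \<subseteq> atoms \<omega>' \<inter> ?G" using sub atoms_radius[OF w(2)] by auto
    then have "of_nat (card ?X) \<le> (of_nat (card (atoms \<omega>' \<inter> ?G)) :: ennreal)"
      using fin by (simp add: card_mono)
    also have "\<dots> \<le> emeasure \<omega>' ?G" by (rule card_atoms_le[OF w(2) G' fin])
    also have "\<dots> \<le> emeasure \<omega>' G" using G w(2) by (intro emeasure_mono) (auto simp: sets_config)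
    finally show "of_nat (card ?X) \<le> emeasure \<omega>' G" .
  qed
  from order_trans[OF 1 mult_right_mono[OF this]] show ?thesis by simp
qed

text \<open>Adding \<open>X\<close> can only lose clusters that \<open>X\<close> touches. The bound
  \<open>K\<close> is required for all finite subsets, because the local number is attained on a
  finite set that is not known explicitly.\<close>

lemma weight_ge:
  assumes L: "\<Lambda> \<in> sets borel" "bounded \<Lambda>" and w: "\<omega> \<in> configurations" "\<omega>' \<in> configurations" "\<omega>'' \<in> configurations"
    and X: "atoms \<omega>' \<inter> \<Lambda> \<times> UNIV = (atoms \<omega>'' \<inter> \<Lambda> \<times> UNIV) \<union> X"
    and K: "\<And>A. finite A \<Longrightarrow> A \<subseteq> atoms (glue \<Lambda> \<omega>'' \<omega>) \<Longrightarrow> card {C \<in> clusters touch A. \<exists>p\<in>C. \<exists>b\<in>X. touch p b} \<le> K"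
  shows "weight q \<Lambda> \<omega> \<omega>'' \<le> ennreal (q ^ K) * weight q \<Lambda> \<omega> \<omega>'"
proof -
  note c = glue_config[OF L(1) w(2,1)] glue_config[OF L(1) w(3,1)]
  note a = atoms_glue[OF L(1) w(2,1)] atoms_glue[OF L(1) w(3,1)]
  have "ncc_local \<Lambda> (glue \<Lambda> \<omega>'' \<omega>) \<le> ncc_local \<Lambda> (glue \<Lambda> \<omega>' \<omega>) + int K"
    by (rule ncc_local_add_ge[OF c(2,1) L _ _ K]) (use X in \<open>auto simp: a\<close>)
  then have "q powi ncc_local \<Lambda> (glue \<Lambda> \<omega>'' \<omega>) \<le> q powi (ncc_local \<Lambda> (glue \<Lambda> \<omega>' \<omega>) + int K)"
    using q by (intro power_int_increasing) auto
  also have "\<dots> = q ^ K * q powi ncc_local \<Lambda> (glue \<Lambda> \<omega>' \<omega>)"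
    using q by (simp add: power_int_add)
  finally show ?thesis
    unfolding weight_def using q by (subst ennreal_mult'[symmetric]) (auto intro!: ennreal_leI simp: zero_le_power_int)
qed

lemma weight_cong:
  assumes L: "\<Lambda> \<in> sets borel" "bounded \<Lambda>" and w: "\<omega> \<in> configurations" "\<omega>' \<in> configurations" "\<omega>'' \<in> configurations"
    and "atoms \<omega>' \<inter> \<Lambda> \<times> UNIV = atoms \<omega>'' \<inter> \<Lambda> \<times> UNIV"
  shows "weight q \<Lambda> \<omega> \<omega>' = weight q \<Lambda> \<omega> \<omega>''"
  unfolding weight_def
  using ncc_local_cong[OF glue_config[OF L(1) w(2,1)] glue_config[OF L(1) w(3,1)] L] assms
  by (simp add: atoms_glue)

text \<open>Let \<open>N\<close> be the number of points in \<open>G\<close> and \<open>m\<close>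
  its Poisson mean. The weight is at most \<open>q ^ N\<close> times the weight after emptying
  \<open>G\<close>, and the latter is independent of \<open>N\<close>. The mean of
  \<open>q ^ N\<close> on \<open>N > 0\<close> is \<open>exp ((q - 1) * m) - exp (- m) = (exp (q *
  m) - 1) * exp (- m)\<close>. The last factor is the probability of \<open>N = 0\<close>, so the
  rest is compared with the part of the partition function where \<open>G\<close> is vacant.\<close>

lemma occupied_bound:
  assumes L: "\<Lambda> \<in> sets borel" "bounded \<Lambda>" and G: "G \<in> sets point_space" "G \<subseteq> \<Lambda> \<times> UNIV" "emeasure \<mu> G < \<infinity>"
    and F: "F \<in> sets config_space"
    and outside: "\<And>\<omega> \<omega>'. \<omega> \<in> configurations \<Longrightarrow> \<omega>' \<in> configurations \<Longrightarrow> glue \<Lambda> \<omega>' \<omega> \<in> F \<longleftrightarrow> \<omega> \<in> F"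
  shows "measure P ({\<omega> \<in> configurations. atoms \<omega> \<inter> G \<noteq> {}} \<inter> F) \<le> (exp (q * measure \<mu> G) - 1) * measure P F"
proof (rule conditional_bound[OF L _ F])
  let ?E = "{\<omega> \<in> configurations. atoms \<omega> \<inter> G \<noteq> {}}" and ?m = "measure \<mu> G"
  show "?E \<in> sets config_space" by (rule sets_occupied[OF G(1)])
  show "0 \<le> exp (q * ?m) - 1" using q by simp
  show "glue \<Lambda> \<omega>' \<omega> \<in> F \<longleftrightarrow> \<omega> \<in> F" if "\<omega> \<in> configurations" "\<omega>' \<in> configurations" for \<omega> \<omega>'
    by (rule outside[OF that])
  fix \<omega> :: "('a \<times> real) measure" assume w: "\<omega> \<in> configurations"
  define w0 where "w0 = weight q \<Lambda> \<omega>"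
  define U where "U = (\<integral>\<^sup>+ \<omega>'. w0 (restr (compl G) \<omega>') \<partial>\<pi>)"
  have w0 [measurable]: "w0 \<in> borel_measurable config_space"
    unfolding w0_def by (rule weight_measurable[OF L w])
  have rc: "restr (compl G) \<omega>' \<in> configurations" "atoms (restr (compl G) \<omega>') = atoms \<omega>' - G"
    if "\<omega>' \<in> configurations" for \<omega>'
    using restr_config[OF compl_sets[OF G(1)] that] atoms_restr[OF compl_sets[OF G(1)] that] atoms_radius[OF that]
    by (auto simp: mem_Times_iff)
  have occ: "atoms \<omega>' \<inter> G = {} \<longleftrightarrow> emeasure \<omega>' G = 0" if "\<omega>' \<in> configurations" for \<omega>'
    using emeasure_eq_0_atoms[OF that G(1)] by simp
  have ge: "atoms (glue \<Lambda> \<omega>' \<omega>) \<inter> G = atoms \<omega>' \<inter> G" if "\<omega>' \<in> configurations" for \<omega>'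
    using atoms_glue[OF L(1) that w] G(2) by auto
  have "(\<integral>\<^sup>+ \<omega>'. indicator ?E (glue \<Lambda> \<omega>' \<omega>) * w0 \<omega>' \<partial>\<pi>) \<le>
      (\<integral>\<^sup>+ \<omega>'. (if emeasure \<omega>' G = 0 then 0 else epow q (emeasure \<omega>' G)) * w0 (restr (compl G) \<omega>') \<partial>\<pi>)"
  proof (rule nn_integral_mono)
    fix \<omega>' assume "\<omega>' \<in> space \<pi>"
    then have w': "\<omega>' \<in> configurations" by (simp add: space_pi)
    have "w0 \<omega>' \<le> epow q (emeasure \<omega>' G) * w0 (restr (compl G) \<omega>')"
      unfolding w0_def by (rule weight_le[OF L w w' rc(1)[OF w'] G(1)]) (auto simp: rc(2)[OF w'])
    then show "indicator ?E (glue \<Lambda> \<omega>' \<omega>) * w0 \<omega>' \<le>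
        (if emeasure \<omega>' G = 0 then 0 else epow q (emeasure \<omega>' G)) * w0 (restr (compl G) \<omega>')"
      using occ[OF w'] ge[OF w'] by (auto simp: indicator_def)
  qed
  also have "\<dots> = (\<integral>\<^sup>+ \<omega>'. (if emeasure \<omega>' G = 0 then 0 else epow q (emeasure \<omega>' G)) \<partial>\<pi>) * U"
    unfolding U_def by (rule nn_integral_count_restr[OF G(1), where v = "\<lambda>x. if x = 0 then 0 else epow q x"]) measurable
  also have "\<dots> = ennreal (exp ((q - 1) * ?m) - exp (- ?m)) * U"
    by (simp add: nn_integral_epow_pos[OF G(1,3) q])
  also have "exp ((q - 1) * ?m) - exp (- ?m) = (exp (q * ?m) - 1) * exp (- ?m)"
    by (simp add: algebra_simps flip: exp_add)
  also have "ennreal ((exp (q * ?m) - 1) * exp (- ?m)) * U = ennreal (exp (q * ?m) - 1) * (ennreal (exp (- ?m)) * U)"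
    using q by (simp add: ennreal_mult mult.assoc)
  also have "ennreal (exp (- ?m)) * U = (\<integral>\<^sup>+ \<omega>'. (if emeasure \<omega>' G = 0 then 1 else 0) * w0 (restr (compl G) \<omega>') \<partial>\<pi>)"
    unfolding U_def nn_integral_count_0[OF G(1,3), symmetric]
    by (rule nn_integral_count_restr[OF G(1), where v = "\<lambda>x. if x = 0 then 1 else 0", symmetric]) measurable
  also have "\<dots> \<le> (\<integral>\<^sup>+ \<omega>'. w0 \<omega>' \<partial>\<pi>)"
  proof (rule nn_integral_mono)
    fix \<omega>' assume "\<omega>' \<in> space \<pi>"
    then have w': "\<omega>' \<in> configurations" by (simp add: space_pi)
    have "w0 (restr (compl G) \<omega>') = w0 \<omega>'" if "atoms \<omega>' \<inter> G = {}"
      unfolding w0_def by (rule weight_cong[OF L w rc(1)[OF w'] w']) (use rc(2)[OF w'] that in auto)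
    then show "(if emeasure \<omega>' G = 0 then 1 else 0) * w0 (restr (compl G) \<omega>') \<le> w0 \<omega>'"
      using occ[OF w'] by auto
  qed
  finally show "(\<integral>\<^sup>+ \<omega>'. indicator ?E (glue \<Lambda> \<omega>' \<omega>) * weight q \<Lambda> \<omega> \<omega>' \<partial>\<pi>) \<le>
      ennreal (exp (q * ?m) - 1) * (\<integral>\<^sup>+ \<omega>'. weight q \<Lambda> \<omega> \<omega>' \<partial>\<pi>)"
    unfolding w0_def by (simp add: mult_left_mono)
qed

text \<open>
  The points in \<open>H\<close> are removed at the price of a factor depending only on \<open>\<mu> H\<close>; once they are
  gone, filling \<open>G\<close> merges at most \<open>K\<close> components.
\<close>
lemma vacant_bound:
  assumes L: "\<Lambda> \<in> sets borel" "bounded \<Lambda>" and G: "G \<in> sets point_space" "G \<subseteq> \<Lambda> \<times> UNIV" "emeasure \<mu> G < \<infinity>"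
    and H: "H \<in> sets point_space" "H \<subseteq> \<Lambda> \<times> UNIV" "emeasure \<mu> H < \<infinity>" and disj: "G \<inter> H = {}"
    and K: "\<And>A X. finite A \<Longrightarrow> A \<subseteq> UNIV \<times> {0..} - H \<Longrightarrow> X \<subseteq> G \<Longrightarrow>
      card {C \<in> clusters touch A. \<exists>p\<in>C. \<exists>b\<in>X. touch p b} \<le> K"
  shows "measure P {\<omega> \<in> configurations. atoms \<omega> \<inter> G = {}} \<le> exp (q * measure \<mu> H - measure \<mu> G) * q ^ K"
proof -
  interpret P: prob_space P by (rule P(1))
  let ?E = "{\<omega> \<in> configurations. atoms \<omega> \<inter> G = {}}" and ?m = "measure \<mu> G" and ?h = "measure \<mu> H"
  let ?S = "configurations :: ('a \<times> real) measure set"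
  have "measure P (?E \<inter> ?S) \<le> (exp (q * ?h - ?m) * q ^ K) * measure P ?S"
  proof (rule conditional_bound[OF L sets_vacant[OF G(1)] sets_configurations])
    show "0 \<le> exp (q * ?h - ?m) * q ^ K" using q by simp
    show "glue \<Lambda> \<omega>' \<omega> \<in> ?S \<longleftrightarrow> \<omega> \<in> ?S" if "\<omega> \<in> configurations" "\<omega>' \<in> configurations" for \<omega> \<omega>'
      using that glue_config[OF L(1)] by simp
    fix \<omega> :: "('a \<times> real) measure" assume w: "\<omega> \<in> configurations"
    define w0 where "w0 = weight q \<Lambda> \<omega>"
    have w0 [measurable]: "w0 \<in> borel_measurable config_space"
      unfolding w0_def by (rule weight_measurable[OF L w])
    define w1 where "w1 \<omega>' = w0 (restr (compl G) \<omega>')" for \<omega>'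
    define U where "U = (\<integral>\<^sup>+ \<omega>'. w1 (restr (compl H) \<omega>') \<partial>\<pi>)"
    have w1 [measurable]: "w1 \<in> borel_measurable config_space"
      unfolding w1_def by (rule measurable_compose[OF measurable_restr[OF compl_sets[OF G(1)]] w0])
    note cs = compl_sets[OF G(1)] compl_sets[OF H(1)]
    have rcG: "restr (compl G) \<omega>' \<in> configurations" "atoms (restr (compl G) \<omega>') = atoms \<omega>' - G"
      if "\<omega>' \<in> configurations" for \<omega>'
      using restr_config[OF cs(1) that] atoms_restr[OF cs(1) that] atoms_radius[OF that]
      by (auto simp: mem_Times_iff)
    have rcH: "restr (compl H) \<omega>' \<in> configurations" "atoms (restr (compl H) \<omega>') = atoms \<omega>' - H"
      if "\<omega>' \<in> configurations" for \<omega>'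
      using restr_config[OF cs(2) that] atoms_restr[OF cs(2) that] atoms_radius[OF that]
      by (auto simp: mem_Times_iff)
    have occ: "atoms \<omega>' \<inter> G = {} \<longleftrightarrow> emeasure \<omega>' G = 0" "atoms \<omega>' \<inter> H = {} \<longleftrightarrow> emeasure \<omega>' H = 0"
      if "\<omega>' \<in> configurations" for \<omega>'
      using emeasure_eq_0_atoms[OF that G(1)] emeasure_eq_0_atoms[OF that H(1)] by auto
    have ge: "atoms (glue \<Lambda> \<omega>' \<omega>) \<inter> G = atoms \<omega>' \<inter> G" if "\<omega>' \<in> configurations" for \<omega>'
      using atoms_glue[OF L(1) that w] G(2) by auto
    \<comment> \<open>Bounds the weight by deleting the points in \<open>H\<close>, at a factor of
      at most \<open>q\<close> for each of them.\<close>
    define u where "u \<zeta> = epow q (emeasure \<zeta> H) * w0 (restr (compl H) \<zeta>)" for \<zeta>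
    have u [measurable]: "u \<in> borel_measurable config_space"
      unfolding u_def
      using measurable_compose[OF measurable_count[OF H(1)] epow_measurable] measurable_compose[OF measurable_restr[OF cs(2)] w0]
      by (intro borel_measurable_times_ennreal)
    have "(\<integral>\<^sup>+ \<omega>'. indicator ?E (glue \<Lambda> \<omega>' \<omega>) * w0 \<omega>' \<partial>\<pi>) \<le>
        (\<integral>\<^sup>+ \<omega>'. (if emeasure \<omega>' G = 0 then 1 else 0) * u (restr (compl G) \<omega>') \<partial>\<pi>)"
    proof (rule nn_integral_mono)
      fix \<omega>' assume "\<omega>' \<in> space \<pi>"
      then have w': "\<omega>' \<in> configurations" by (simp add: space_pi)
      let ?g = "restr (compl G) \<omega>'"
      have "w0 \<omega>' \<le> u ?g" if "atoms \<omega>' \<inter> G = {}"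
      proof -
        have "w0 \<omega>' = w0 ?g" unfolding w0_def
          by (rule weight_cong[OF L w w' rcG(1)[OF w']]) (use rcG(2)[OF w'] that in auto)
        also have "\<dots> \<le> u ?g" unfolding w0_def u_def
          by (rule weight_le[OF L w rcG(1)[OF w'] rcH(1)[OF rcG(1)[OF w']] H(1)]) (auto simp: rcH(2)[OF rcG(1)[OF w']])
        finally show ?thesis .
      qed
      then show "indicator ?E (glue \<Lambda> \<omega>' \<omega>) * w0 \<omega>' \<le> (if emeasure \<omega>' G = 0 then 1 else 0) * u ?g"
        using occ[OF w'] ge[OF w'] by (auto simp: indicator_def)
    qed
    also have "\<dots> = ennreal (exp (- ?m)) * (\<integral>\<^sup>+ \<omega>'. u (restr (compl G) \<omega>') \<partial>\<pi>)"
      unfolding nn_integral_count_0[OF G(1,3), symmetric]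
      by (rule nn_integral_count_restr[OF G(1), where v = "\<lambda>x. if x = 0 then 1 else 0"]) measurable
    also have "(\<integral>\<^sup>+ \<omega>'. u (restr (compl G) \<omega>') \<partial>\<pi>) = (\<integral>\<^sup>+ \<omega>'. epow q (emeasure \<omega>' H) * w1 (restr (compl H) \<omega>') \<partial>\<pi>)"
    proof (rule nn_integral_cong)
      fix \<omega>' assume "\<omega>' \<in> space \<pi>"
      then have w': "\<omega>' \<in> configurations" by (simp add: space_pi)
      have "H \<inter> compl G = H" using disj sets.sets_into_space[OF H(1)] by (auto simp: space_point_space)
      then have "emeasure (restr (compl G) \<omega>') H = emeasure \<omega>' H"
        using emeasure_restr[OF cs(1) w' H(1)] by simp
      moreover have "w0 (restr (compl H) (restr (compl G) \<omega>')) = w1 (restr (compl H) \<omega>')"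
        unfolding w0_def w1_def
        by (rule weight_cong[OF L w rcH(1)[OF rcG(1)[OF w']] rcG(1)[OF rcH(1)[OF w']]])
           (use rcG(2)[OF w'] rcG(2)[OF rcH(1)[OF w']] rcH(2)[OF w'] rcH(2)[OF rcG(1)[OF w']] in auto)
      ultimately show "u (restr (compl G) \<omega>') = epow q (emeasure \<omega>' H) * w1 (restr (compl H) \<omega>')"
        by (simp add: u_def)
    qed
    also have "\<dots> = ennreal (exp ((q - 1) * ?h)) * U"
    proof -
      have "0 \<le> q" using q by simp
      from nn_integral_epow[OF H(1,3) this, symmetric] show ?thesis
        unfolding U_def by (simp add: nn_integral_count_restr[OF H(1) epow_measurable w1])
    qed
    \<comment> \<open>The factor \<open>exp (- ?h)\<close> is split off as the probability that
      \<open>H\<close> is vacant. On that event filling \<open>G\<close> again costs at most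
      \<open>q ^ K\<close>, which leads back to the partition function.\<close>
    also have "ennreal (exp (- ?m)) * (ennreal (exp ((q - 1) * ?h)) * U) =
        ennreal (exp (q * ?h - ?m)) * (ennreal (exp (- ?h)) * U)"
    proof -
      have "exp (- ?m) * exp ((q - 1) * ?h) = exp (q * ?h - ?m) * exp (- ?h)"
        by (simp add: algebra_simps flip: exp_add)
      then show ?thesis by (simp add: ennreal_mult'[symmetric] mult.assoc[symmetric])
    qed
    also have "ennreal (exp (- ?h)) * U = (\<integral>\<^sup>+ \<omega>'. (if emeasure \<omega>' H = 0 then 1 else 0) * w1 (restr (compl H) \<omega>') \<partial>\<pi>)"
      unfolding U_def nn_integral_count_0[OF H(1,3), symmetric]
      by (rule nn_integral_count_restr[OF H(1), where v = "\<lambda>x. if x = 0 then 1 else 0", symmetric]) measurable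
    also have "\<dots> \<le> (\<integral>\<^sup>+ \<omega>'. ennreal (q ^ K) * w0 \<omega>' \<partial>\<pi>)"
    proof (rule nn_integral_mono)
      fix \<omega>' assume "\<omega>' \<in> space \<pi>"
      then have w': "\<omega>' \<in> configurations" by (simp add: space_pi)
      let ?r = "restr (compl G) (restr (compl H) \<omega>')"
      note r = rcG(1)[OF rcH(1)[OF w']]
      have ar: "atoms ?r = atoms \<omega>' - H - G" using rcG(2)[OF rcH(1)[OF w']] rcH(2)[OF w'] by simp
      have "w1 (restr (compl H) \<omega>') \<le> ennreal (q ^ K) * w0 \<omega>'" if "atoms \<omega>' \<inter> H = {}"
        unfolding w1_def w0_def
      proof (rule weight_ge[OF L w w' r])
        show "atoms \<omega>' \<inter> \<Lambda> \<times> UNIV = (atoms ?r \<inter> \<Lambda> \<times> UNIV) \<union> (atoms \<omega>' \<inter> G)"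
          unfolding ar using that G(2) by auto
        fix A assume "finite A" and A: "A \<subseteq> atoms (glue \<Lambda> ?r \<omega>)"
        \<comment> \<open>The outer points avoid \<open>H\<close> because \<open>H\<close> lies over
          \<open>\<Lambda>\<close>, the inner ones because they have been removed.\<close>
        have "atoms (glue \<Lambda> ?r \<omega>) \<subseteq> compl H"
        proof -
          have "atoms ?r \<subseteq> compl H" "atoms \<omega> - \<Lambda> \<times> UNIV \<subseteq> compl H"
            using atoms_radius[OF w] atoms_radius[OF w'] H(2) unfolding ar by (auto simp: mem_Times_iff)
          then show ?thesis unfolding atoms_glue[OF L(1) r w] by blast
        qed
        then show "card {C \<in> clusters touch A. \<exists>p\<in>C. \<exists>b\<in>atoms \<omega>' \<inter> G. touch p b} \<le> K"
          using A by (intro K \<open>finite A\<close>) auto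
      qed
      then show "(if emeasure \<omega>' H = 0 then 1 else 0) * w1 (restr (compl H) \<omega>') \<le> ennreal (q ^ K) * w0 \<omega>'"
        using occ(2)[OF w'] by auto
    qed
    also have "\<dots> = ennreal (q ^ K) * (\<integral>\<^sup>+ \<omega>'. w0 \<omega>' \<partial>\<pi>)"
      using w0 by (intro nn_integral_cmult) (simp add: measurable_cong_sets[OF sets_pi])
    finally show "(\<integral>\<^sup>+ \<omega>'. indicator ?E (glue \<Lambda> \<omega>' \<omega>) * weight q \<Lambda> \<omega> \<omega>' \<partial>\<pi>) \<le>
        ennreal (exp (q * ?h - ?m) * q ^ K) * (\<integral>\<^sup>+ \<omega>'. weight q \<Lambda> \<omega> \<omega>' \<partial>\<pi>)"
      unfolding w0_def using q by (simp add: mult_left_mono ennreal_mult mult.assoc)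
  qed
  moreover have "?E \<inter> ?S = ?E" by auto
  ultimately show ?thesis by (simp add: prob_configurations)
qed

end

section \<open>Absence of percolation\<close>

text \<open>A chain from the ball of radius \<open>\<alpha>\<close> about \<open>x\<close> out to
  distance \<open>8 * \<alpha>\<close>, through balls centred within \<open>10 * \<alpha>\<close>.
  Restricting the centres makes the event local. The margin of \<open>2 * \<alpha>\<close> ensures
  that a chain that has not yet reached \<open>8 * \<alpha>\<close> can only be continued from
  outside the region by a ball of radius above \<open>2 * \<alpha>\<close>.\<close>

definition crossing :: "'a::euclidean_space \<Rightarrow> real \<Rightarrow> ('a \<times> real) set \<Rightarrow> bool" where
  "crossing x \<alpha> A \<longleftrightarrow> (let A' = A \<inter> cball x (10 * \<alpha>) \<times> UNIV in
    \<exists>p\<in>A'. dist x (fst p) \<le> \<alpha> + snd p \<and> (\<exists>p'\<in>A'. linked touch A' p p' \<and> 8 * \<alpha> \<le> dist x (fst p') + snd p'))"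

lemma crossing_cong:
  "A \<inter> cball x (10 * \<alpha>) \<times> UNIV = B \<inter> cball x (10 * \<alpha>) \<times> UNIV \<Longrightarrow> crossing x \<alpha> A = crossing x \<alpha> B"
  by (simp add: crossing_def)

text \<open>A discrete intermediate value theorem: the first ball on the chain that reaches distance
  \<open>r\<close> is \<open>p\<close> itself or touches a ball that does not reach it. In either
  case it meets the sphere of radius \<open>r\<close>, which is what the bound by
  \<open>snd u\<close> expresses.\<close>

lemma linked_meets_sphere:
  fixes x :: "'a::euclidean_space"
  assumes l: "linked touch A p p'" and near: "dist x (fst p) \<le> r + snd p" and far: "r \<le> dist x (fst p') + snd p'"
  shows "\<exists>u. linked touch A p u \<and> linked touch A u p' \<and> \<bar>dist x (fst u) - r\<bar> \<le> snd u"
proof -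
  let ?found = "\<lambda>v. \<exists>u. linked touch A p u \<and> linked touch A u v \<and> \<bar>dist x (fst u) - r\<bar> \<le> snd u"
  have "?found p' \<or> dist x (fst p') + snd p' < r"
    using l
  proof (induction rule: touch.linked_induct)
    case base
    show ?case
    proof (cases "dist x (fst p) + snd p < r")
      case False
      then have "\<bar>dist x (fst p) - r\<bar> \<le> snd p" using near by simp
      then show ?thesis using touch.linked_refl by blast
    qed simp
  next
    case (step u v)
    have uv: "linked touch A u v" using step by (intro touch.linked_step)
    show ?case
    proof (cases "?found u")
      case True
      then show ?thesis using uv touch.linked_trans by blast
    next
      case False
      then have "dist x (fst u) + snd u < r" using step by blast
      moreover have "dist x (fst v) \<le> dist x (fst u) + (snd u + snd v)"
        using step(4) dist_triangle[of x "fst v" "fst u"] by (simp add: touch_def)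
      ultimately have v: "dist x (fst v) \<le> r + snd v" by simp
      show ?thesis
      proof (cases "dist x (fst v) + snd v < r")
        case False
        then have "\<bar>dist x (fst v) - r\<bar> \<le> snd v" using v by simp
        then show ?thesis using touch.linked_trans[OF step(1) uv] touch.linked_refl by blast
      qed simp
    qed
  qed
  then show ?thesis using far by auto
qed

text \<open>Unless a crossing has been completed before, the first ball on the chain that is centred
  beyond \<open>10 * \<alpha>\<close> still meets the ball of radius \<open>8 * \<alpha>\<close>
  about \<open>x\<close>, so it is the far ball of the second alternative.\<close>

lemma crossing_or_far:
  fixes x :: "'a::euclidean_space"
  assumes l: "linked touch A p p'" and p: "p \<in> A" and near: "dist x (fst p) \<le> \<alpha> + snd p"
    and far: "8 * \<alpha> \<le> dist x (fst p') + snd p'" and a: "0 < \<alpha>"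
  shows "crossing x \<alpha> A \<or> (\<exists>v\<in>A. 10 * \<alpha> < dist x (fst v) \<and> dist x (fst v) \<le> 8 * \<alpha> + snd v)"
proof -
  let ?A = "A \<inter> cball x (10 * \<alpha>) \<times> UNIV"
  let ?good = "\<lambda>v. v \<in> ?A \<and> linked touch ?A p v"
  let ?conc = "crossing x \<alpha> A \<or> (\<exists>v\<in>A. 10 * \<alpha> < dist x (fst v) \<and> dist x (fst v) \<le> 8 * \<alpha> + snd v)"
  have hit: "?conc \<or> (?good v \<and> dist x (fst v) + snd v < 8 * \<alpha>)" if "?good v" "?good p" for v
    using that near unfolding crossing_def Let_def by (metis not_less)
  have "?conc \<or> (?good p' \<and> ?good p \<and> dist x (fst p') + snd p' < 8 * \<alpha>)"
    using l
  proof (induction rule: touch.linked_induct)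
    case base
    show ?case
    proof (cases "10 * \<alpha> < dist x (fst p)")
      case True
      then show ?thesis using p near a by (intro disjI1 disjI2 bexI[of _ p]) auto
    next
      case False
      then have "?good p" using p by (auto simp: mem_Times_iff)
      then show ?thesis using hit by blast
    qed
  next
    case (step u v)
    show ?case
    proof (cases ?conc)
      case False
      then have u: "?good u" "?good p" "dist x (fst u) + snd u < 8 * \<alpha>" using step by auto
      have "dist x (fst v) \<le> dist x (fst u) + (snd u + snd v)"
        using step(4) dist_triangle[of x "fst v" "fst u"] by (simp add: touch_def)
      then have v: "dist x (fst v) \<le> 8 * \<alpha> + snd v" using u by simp
      then have "dist x (fst v) \<le> 10 * \<alpha>" using False step(3) by force
      then have vA: "v \<in> ?A" using step(3) by (auto simp: mem_Times_iff)
      then have "?good v" using u touch.linked_trans[OF _ touch.linked_step[OF _ vA step(4)]] by blast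
      then show ?thesis using hit u(2) by blast
    qed blast
  qed
  then show ?thesis using far by auto
qed

lemma sphere_net:
  fixes r :: real
  shows "\<exists>K. finite K \<and> K \<subseteq> sphere (0::'a::euclidean_space) r \<and> sphere 0 r \<subseteq> (\<Union>k\<in>K. cball k 1)"
proof -
  have "compact (sphere (0::'a) r)" by simp
  then obtain K where K: "K \<subseteq> sphere 0 r" "finite K" "sphere (0::'a) r \<subseteq> (\<Union>k\<in>K. ball k 1)"
    by (rule compactE_image[of _ "sphere 0 r" "\<lambda>k. ball k 1"]) auto
  have "(\<Union>k\<in>K. ball k 1) \<subseteq> (\<Union>k\<in>K. cball k 1)" by (intro UN_mono ball_subset_cball) simp
  with K(3) have "sphere (0::'a) r \<subseteq> (\<Union>k\<in>K. cball k 1)" by (rule order_trans)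
  with K(1,2) show ?thesis by (intro exI[of _ K] conjI)
qed

text \<open>The point at distance \<open>r * \<alpha>\<close> from \<open>x\<close> in the direction
  of \<open>fst u\<close> belongs to the ball \<open>u\<close>, and the scaled net has a point
  within \<open>\<alpha>\<close> of it.\<close>

lemma near_net_point:
  fixes x :: "'a::euclidean_space"
  assumes K: "sphere 0 r \<subseteq> (\<Union>k\<in>K. cball k 1)" and a: "0 < \<alpha>" and r: "0 \<le> r" and u: "\<bar>dist x (fst u) - r * \<alpha>\<bar> \<le> snd u"
  shows "\<exists>k\<in>K. dist (x + \<alpha> *\<^sub>R k) (fst u) \<le> \<alpha> + snd u"
proof -
  obtain e :: 'a where e: "norm e = 1" "fst u - x = norm (fst u - x) *\<^sub>R e"
    using unit_direction by blast
  have "r *\<^sub>R e \<in> sphere 0 r" using e r by simp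
  with K have "r *\<^sub>R e \<in> (\<Union>k\<in>K. cball k 1)" by (rule subsetD)
  then obtain k where k: "k \<in> K" "dist k (r *\<^sub>R e) \<le> 1" by auto
  have "dist (x + \<alpha> *\<^sub>R k) (x + \<alpha> *\<^sub>R (r *\<^sub>R e)) = \<alpha> * dist k (r *\<^sub>R e)"
  proof -
    have "x + \<alpha> *\<^sub>R k - (x + \<alpha> *\<^sub>R (r *\<^sub>R e)) = \<alpha> *\<^sub>R (k - r *\<^sub>R e)" by (simp add: scaleR_diff_right)
    then show ?thesis using a by (simp add: dist_norm)
  qed
  also have "\<dots> \<le> \<alpha>" using k a by (simp add: mult_left_le)
  finally have 1: "dist (x + \<alpha> *\<^sub>R k) (x + \<alpha> *\<^sub>R (r *\<^sub>R e)) \<le> \<alpha>" .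
  have "x + \<alpha> *\<^sub>R (r *\<^sub>R e) - fst u = (r * \<alpha> - norm (fst u - x)) *\<^sub>R e"
  proof -
    have "x + \<alpha> *\<^sub>R (r *\<^sub>R e) - fst u = \<alpha> *\<^sub>R (r *\<^sub>R e) - (fst u - x)" by simp
    also have "\<dots> = (r * \<alpha>) *\<^sub>R e - norm (fst u - x) *\<^sub>R e" using e(2) by (simp add: mult.commute)
    finally show ?thesis by (simp add: scaleR_left_diff_distrib)
  qed
  then have "dist (x + \<alpha> *\<^sub>R (r *\<^sub>R e)) (fst u) = \<bar>r * \<alpha> - norm (fst u - x)\<bar>"
    using e by (simp add: dist_norm)
  also have "\<dots> \<le> snd u" using u by (simp add: dist_norm norm_minus_commute abs_minus_commute)
  finally show ?thesis using 1 k(1) dist_triangle[of "x + \<alpha> *\<^sub>R k" "fst u" "x + \<alpha> *\<^sub>R (r *\<^sub>R e)"]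
    by (intro bexI[of _ k]) auto
qed

text \<open>
  One of the two crossings starts near the sphere of radius \<open>10 \<alpha>\<close>, the other one near that of
  radius \<open>80 \<alpha>\<close>, so they take place in disjoint regions.
\<close>
lemma crossing_split:
  fixes x :: "'a::euclidean_space"
  assumes K1: "K1 \<subseteq> sphere 0 10" "sphere 0 10 \<subseteq> (\<Union>k\<in>K1. cball k 1)"
    and K2: "K2 \<subseteq> sphere 0 80" "sphere 0 80 \<subseteq> (\<Union>k\<in>K2. cball k 1)"
    and a: "0 < \<alpha>" and cr: "crossing x (10 * \<alpha>) A"
    and small: "\<And>p. p \<in> A \<Longrightarrow> fst p \<in> cball x (100 * \<alpha>) \<Longrightarrow> snd p \<le> \<alpha>"
  shows "\<exists>k1\<in>K1. \<exists>k2\<in>K2. crossing (x + \<alpha> *\<^sub>R k1) \<alpha> A \<and> crossing (x + \<alpha> *\<^sub>R k2) \<alpha> A"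
proof -
  define A' where "A' = A \<inter> cball x (100 * \<alpha>) \<times> UNIV"
  obtain p p' where p: "p \<in> A'" "dist x (fst p) \<le> 10 * \<alpha> + snd p"
    and p': "p' \<in> A'" "80 * \<alpha> \<le> dist x (fst p') + snd p'" and l: "linked touch A' p p'"
    using cr by (auto simp: crossing_def Let_def A'_def)
  have sm: "snd v \<le> \<alpha>" if "v \<in> A'" for v using that small by (auto simp: A'_def)
  \<comment> \<open>Radii at most \<open>\<alpha>\<close> rule out the second alternative of
    \<open>crossing_or_far\<close>; with \<open>y\<close> within \<open>90 * \<alpha>\<close> of
    \<open>x\<close>, the region of the small crossing lies in that of the large one.\<close>
  have cross: "crossing y \<alpha> A" if l: "linked touch A' v v'" and v: "v \<in> A'" and "dist y (fst v) \<le> \<alpha> + snd v"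
    and "8 * \<alpha> \<le> dist y (fst v') + snd v'" and y: "dist x y \<le> 90 * \<alpha>" for v v' y
  proof -
    have "\<not> (\<exists>v\<in>A'. 10 * \<alpha> < dist y (fst v) \<and> dist y (fst v) \<le> 8 * \<alpha> + snd v)"
      using sm a by force
    then have "crossing y \<alpha> A'" using crossing_or_far[OF l v] that a by blast
    moreover have "cball y (10 * \<alpha>) \<subseteq> cball x (100 * \<alpha>)"
      using y a by (simp add: cball_subset_cball_iff dist_commute)
    then have "A \<inter> cball y (10 * \<alpha>) \<times> UNIV = A' \<inter> cball y (10 * \<alpha>) \<times> UNIV"
      by (auto simp: A'_def)
    ultimately show ?thesis using crossing_cong by blast
  qed
  have d: "dist x (x + \<alpha> *\<^sub>R k) = \<alpha> * norm k" for k using a by (simp add: dist_norm)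
  obtain u1 where u1: "linked touch A' p u1" "linked touch A' u1 p'" "\<bar>dist x (fst u1) - 10 * \<alpha>\<bar> \<le> snd u1"
    using linked_meets_sphere[OF l p(2)] p'(2) a by auto
  obtain k1 where k1: "k1 \<in> K1" "dist (x + \<alpha> *\<^sub>R k1) (fst u1) \<le> \<alpha> + snd u1"
    using near_net_point[OF K1(2) a _ u1(3)] by auto
  have n1: "norm k1 = 10" using k1 K1(1) by auto
  have c1: "crossing (x + \<alpha> *\<^sub>R k1) \<alpha> A"
  proof (rule cross[OF u1(2) _ k1(2)])
    show "u1 \<in> A'" using touch.linked_in[OF u1(1)] p by simp
    show "8 * \<alpha> \<le> dist (x + \<alpha> *\<^sub>R k1) (fst p') + snd p'"
      using dist_triangle[of x "fst p'" "x + \<alpha> *\<^sub>R k1"] d[of k1] n1 p'(2) a by simp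
    show "dist x (x + \<alpha> *\<^sub>R k1) \<le> 90 * \<alpha>" using d[of k1] n1 a by simp
  qed
  obtain u2 where u2: "linked touch A' p u2" "\<bar>dist x (fst u2) - 80 * \<alpha>\<bar> \<le> snd u2"
    using linked_meets_sphere[OF l, of x "80 * \<alpha>"] p(2) p'(2) a by auto
  obtain k2 where k2: "k2 \<in> K2" "dist (x + \<alpha> *\<^sub>R k2) (fst u2) \<le> \<alpha> + snd u2"
    using near_net_point[OF K2(2) a _ u2(2)] by auto
  have n2: "norm k2 = 80" using k2 K2(1) by auto
  \<comment> \<open>The chain is read backwards, from the outer sphere to \<open>p\<close>, whose
    ball reaches distance at least \<open>70 * \<alpha>\<close> from the net point.\<close>
  have c2: "crossing (x + \<alpha> *\<^sub>R k2) \<alpha> A"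
  proof (rule cross[OF touch.linked_sym[OF u2(1)] _ k2(2)])
    show "u2 \<in> A'" using touch.linked_in[OF u2(1)] p by simp
    show "8 * \<alpha> \<le> dist (x + \<alpha> *\<^sub>R k2) (fst p) + snd p"
      using dist_triangle[of x "x + \<alpha> *\<^sub>R k2" "fst p"] d[of k2] n2 p(2) a by (simp add: dist_commute)
    show "dist x (x + \<alpha> *\<^sub>R k2) \<le> 90 * \<alpha>" using d[of k2] n2 a by simp
  qed
  show ?thesis using c1 c2 k1(1) k2(1) by blast
qed

text \<open>The events that only look at atoms off \<open>\<Lambda>\<close>, in the role of the
  outer sigma-algebra. Phrased through agreement of atoms, the notion is plainly stable under
  intersection and is checked directly for crossings.\<close>

definition outside :: "'a::euclidean_space set \<Rightarrow> ('a \<times> real) measure set \<Rightarrow> bool" where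
  "outside \<Lambda> F \<longleftrightarrow> (\<forall>\<omega>\<in>configurations. \<forall>\<omega>'\<in>configurations.
     atoms \<omega> - \<Lambda> \<times> UNIV = atoms \<omega>' - \<Lambda> \<times> UNIV \<longrightarrow> \<omega> \<in> F \<longleftrightarrow> \<omega>' \<in> F)"

lemma outside_glue:
  assumes "outside \<Lambda> F" "\<Lambda> \<in> sets borel" "\<omega> \<in> configurations" "\<omega>' \<in> configurations"
  shows "glue \<Lambda> \<omega>' \<omega> \<in> F \<longleftrightarrow> \<omega> \<in> F"
  using assms glue_config[OF assms(2,4,3)] atoms_glue[OF assms(2,4,3)] unfolding outside_def by blast

lemma outsideD:
  assumes "outside \<Lambda> F" "\<omega> \<in> configurations" "\<omega>' \<in> configurations"
    "atoms \<omega> - \<Lambda> \<times> UNIV = atoms \<omega>' - \<Lambda> \<times> UNIV"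
  shows "\<omega> \<in> F \<longleftrightarrow> \<omega>' \<in> F"
  by (rule assms(1)[unfolded outside_def, rule_format, OF assms(2-4)])

lemma outside_mono:
  assumes "outside \<Lambda> F" "\<Lambda>' \<subseteq> \<Lambda>"
  shows "outside \<Lambda>' F"
  unfolding outside_def
proof (intro ballI impI)
  fix \<omega> \<omega>' :: "('a \<times> real) measure"
  assume w: "\<omega> \<in> configurations" "\<omega>' \<in> configurations" and eq: "atoms \<omega> - \<Lambda>' \<times> UNIV = atoms \<omega>' - \<Lambda>' \<times> UNIV"
  have A: "A - \<Lambda> \<times> UNIV = (A - \<Lambda>' \<times> UNIV) - \<Lambda> \<times> UNIV" for A :: "('a \<times> real) set"
    using assms(2) by auto
  have "atoms \<omega> - \<Lambda> \<times> UNIV = atoms \<omega>' - \<Lambda> \<times> UNIV"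
    by (subst A, subst eq, subst A[of "atoms \<omega>'"], rule refl)
  then show "\<omega> \<in> F \<longleftrightarrow> \<omega>' \<in> F" by (rule outsideD[OF assms(1) w])
qed

lemma outside_Int: "outside \<Lambda> F \<Longrightarrow> outside \<Lambda> F' \<Longrightarrow> outside \<Lambda> (F \<inter> F')"
  unfolding outside_def
  by (intro ballI impI) (metis Int_iff)

definition crossing_event :: "'a::euclidean_space \<Rightarrow> real \<Rightarrow> ('a \<times> real) measure set" where
  "crossing_event x \<alpha> = {\<omega> \<in> configurations. crossing x \<alpha> (atoms \<omega>)}"

lemma crossing_event_measurable: "crossing_event x \<alpha> \<in> sets (config_space :: ('a::euclidean_space \<times> real) measure measure)"
proof -
  let ?w = "config_restrict (cball x (10 * \<alpha>))"
  have w: "?w \<in> measurable config_space config_space" by (rule measurable_config_restrict) auto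
  have "Measurable.pred config_space (\<lambda>\<omega>. \<exists>p\<in>atoms (?w \<omega>). dist x (fst p) \<le> \<alpha> + snd p \<and>
      (\<exists>p'\<in>atoms (?w \<omega>). linked touch (atoms (?w \<omega>)) p p' \<and> 8 * \<alpha> \<le> dist x (fst p') + snd p'))"
    by (rule pred_linked_pair[OF w]) (unfold split_beta', measurable)
  moreover have "crossing x \<alpha> (atoms \<omega>) \<longleftrightarrow> (\<exists>p\<in>atoms (?w \<omega>). dist x (fst p) \<le> \<alpha> + snd p \<and>
      (\<exists>p'\<in>atoms (?w \<omega>). linked touch (atoms (?w \<omega>)) p p' \<and> 8 * \<alpha> \<le> dist x (fst p') + snd p'))"
    if "\<omega> \<in> space config_space" for \<omega>
  proof -
    have "atoms (?w \<omega>) = atoms \<omega> \<inter> cball x (10 * \<alpha>) \<times> UNIV"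
      using that by (intro atoms_config_restrict) (auto simp: space_config_space)
    then show ?thesis by (simp add: crossing_def Let_def)
  qed
  ultimately have "Measurable.pred config_space (\<lambda>\<omega>. crossing x \<alpha> (atoms \<omega>))" by (simp cong: measurable_cong)
  then show ?thesis unfolding crossing_event_def pred_def by (simp add: space_config_space)
qed

lemma outside_crossing_event:
  assumes "cball x (10 * \<alpha>) \<inter> \<Lambda> = {}"
  shows "outside \<Lambda> (crossing_event x \<alpha>)"
  unfolding outside_def
proof (intro ballI impI)
  fix \<omega> \<omega>' :: "('a \<times> real) measure"
  assume c: "\<omega> \<in> configurations" "\<omega>' \<in> configurations" and eq: "atoms \<omega> - \<Lambda> \<times> UNIV = atoms \<omega>' - \<Lambda> \<times> UNIV"
  have "A \<inter> cball x (10 * \<alpha>) \<times> UNIV = (A - \<Lambda> \<times> UNIV) \<inter> cball x (10 * \<alpha>) \<times> UNIV" for A :: "('a \<times> real) set"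
    using assms by auto
  then have "crossing x \<alpha> (atoms \<omega>) = crossing x \<alpha> (atoms \<omega>')"
    using eq by (intro crossing_cong) metis
  then show "\<omega> \<in> crossing_event x \<alpha> \<longleftrightarrow> \<omega>' \<in> crossing_event x \<alpha>" using c by (simp add: crossing_event_def)
qed

text \<open>Once \<open>e\<close> is below \<open>r / 4\<close>, the errors accumulated by the
  halving recursion stay below \<open>r / 2\<close>, and the contribution of the starting value
  decays geometrically.\<close>

lemma recursion_tendsto_0:
  fixes x e :: "nat \<Rightarrow> real"
  assumes "\<And>n. 0 \<le> x n" "\<And>n. x (Suc n) \<le> x n / 2 + e n" "e \<longlonglongrightarrow> 0"
  shows "x \<longlonglongrightarrow> 0"
proof (rule LIMSEQ_I)
  fix r :: real assume r: "0 < r"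
  obtain N where "\<And>n. n \<ge> N \<Longrightarrow> norm (e n - 0) < r / 4"
    using LIMSEQ_D[OF assms(3), of "r / 4"] r by auto
  then have N: "e n \<le> r / 4" if "n \<ge> N" for n using that by (fastforce simp: abs_less_iff)
  have it: "x (N + k) \<le> x N / 2 ^ k + r / 2" for k
  proof (induction k)
    case (Suc k)
    have "x (N + Suc k) \<le> x (N + k) / 2 + r / 4" using assms(2)[of "N + k"] N[of "N + k"] by simp
    also have "\<dots> \<le> (x N / 2 ^ k + r / 2) / 2 + r / 4" using Suc by simp
    finally show ?case by (simp add: field_simps)
  qed (use r in simp)
  have "(\<lambda>k. x N / 2 ^ k) \<longlonglongrightarrow> 0"
    using LIMSEQ_power_zero[of "1 / 2 :: real"] tendsto_mult_right_zero[of "\<lambda>k. (1 / 2 :: real) ^ k" _ "x N"]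
    by (simp add: power_divide)
  then obtain M where M0: "\<And>k. k \<ge> M \<Longrightarrow> norm (x N / 2 ^ k - 0) < r / 2"
    using LIMSEQ_D[of "\<lambda>k. x N / 2 ^ k" 0 "r / 2"] r by auto
  have M: "x N / 2 ^ k < r / 2" if "k \<ge> M" for k
    using le_less_trans[OF abs_ge_self M0[OF that, unfolded real_norm_def diff_0_right]] .
  have "norm (x n - 0) < r" if "n \<ge> N + M" for n
  proof -
    have "M \<le> n - N" using that by simp
    have "N + (n - N) = n" using that by simp
    then have "x n \<le> x N / 2 ^ (n - N) + r / 2" using it[of "n - N"] by metis
    then have "x n < r" using M[OF \<open>M \<le> n - N\<close>] by linarith
    then show ?thesis using assms(1)[of n] by simp
  qed
  then show "\<exists>no. \<forall>n\<ge>no. norm (x n - 0) < r" by blast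
qed

section \<open>The recursion over scales for crossings\<close>

context gibbs
begin

lemma occupied_bound':
  assumes L: "\<Lambda> \<in> sets borel" "bounded \<Lambda>" and G: "G \<in> sets point_space" "G \<subseteq> \<Lambda> \<times> UNIV"
    and t: "emeasure \<mu> G \<le> ennreal t" "0 \<le> t"
    and F: "F \<in> sets config_space" "outside \<Lambda> F"
  shows "measure P ({\<omega> \<in> configurations. atoms \<omega> \<inter> G \<noteq> {}} \<inter> F) \<le> (exp (q * t) - 1) * measure P F"
proof -
  have fin: "emeasure \<mu> G < \<infinity>" using t(1) by (rule le_less_trans) simp
  have "measure P ({\<omega> \<in> configurations. atoms \<omega> \<inter> G \<noteq> {}} \<inter> F) \<le> (exp (q * measure \<mu> G) - 1) * measure P F"
    by (rule occupied_bound[OF L G fin F(1)]) (rule outside_glue[OF F(2) L(1)])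
  also have "measure \<mu> G \<le> t" unfolding measure_def using t by (metis enn2real_leI)
  then have "(exp (q * measure \<mu> G) - 1) * measure P F \<le> (exp (q * t) - 1) * measure P F"
    using q by (intro mult_right_mono) auto
  finally show ?thesis .
qed

text \<open>The worst conditional probability of a crossing, uniform in the centre. Quantifying over
  all outer events \<open>F\<close> is what lets such bounds multiply over disjoint regions.\<close>

definition crossing_bound :: "real \<Rightarrow> real \<Rightarrow> bool" where
  "crossing_bound \<alpha> c \<longleftrightarrow> (\<forall>x F. F \<in> sets config_space \<longrightarrow> outside (cball x (10 * \<alpha>)) F \<longrightarrow>
    measure P (crossing_event x \<alpha> \<inter> F) \<le> c * measure P F)"

text \<open>A crossing needs at least one point in its region, and at the initial scale this crude
  bound is already small.\<close>

lemma crossing_bound_initial: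
  assumes m: "\<And>x. emeasure \<mu> (cball x (10 * \<alpha>) \<times> {0..}) \<le> ennreal m" "0 \<le> m"
  shows "crossing_bound \<alpha> (exp (q * m) - 1)"
  unfolding crossing_bound_def
proof (intro allI impI)
  interpret P: prob_space P by (rule P(1))
  fix x :: 'a and F :: "('a \<times> real) measure set" assume F: "F \<in> sets config_space" "outside (cball x (10 * \<alpha>)) F"
  let ?G = "cball x (10 * \<alpha>) \<times> {0..}"
  have G: "?G \<in> sets point_space" by auto
  note E = sets_occupied[OF G]
  have "crossing_event x \<alpha> \<subseteq> {\<omega> \<in> configurations. atoms \<omega> \<inter> ?G \<noteq> {}}"
    using atoms_radius by (fastforce simp: crossing_event_def crossing_def Let_def)
  then have "measure P (crossing_event x \<alpha> \<inter> F) \<le> measure P ({\<omega> \<in> configurations. atoms \<omega> \<inter> ?G \<noteq> {}} \<inter> F)"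
    using E F by (intro P.finite_measure_mono) (auto simp: P(2))
  also have "\<dots> \<le> (exp (q * m) - 1) * measure P F"
    by (rule occupied_bound'[OF _ _ G _ m F]) auto
  finally show "measure P (crossing_event x \<alpha> \<inter> F) \<le> (exp (q * m) - 1) * measure P F" .
qed

text \<open>Either a ball of radius above \<open>\<alpha>\<close> is centred in the window, which
  costs the exponential term, or \<open>crossing_split\<close> yields one of
  \<open>card K1 * card K2\<close> pairs of crossings, each of probability at most
  \<open>c\<^sup>2\<close> given the outside.\<close>

lemma crossing_bound_step:
  assumes K1: "finite K1" "K1 \<subseteq> sphere (0::'a) 10" "sphere 0 10 \<subseteq> (\<Union>k\<in>K1. cball k 1)"
    and K2: "finite K2" "K2 \<subseteq> sphere (0::'a) 80" "sphere 0 80 \<subseteq> (\<Union>k\<in>K2. cball k 1)"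
    and a: "0 < \<alpha>" and t: "\<And>x. emeasure \<mu> (cball x (100 * \<alpha>) \<times> {\<alpha><..}) \<le> ennreal t" "0 \<le> t"
    and c: "0 \<le> c" "crossing_bound \<alpha> c"
  shows "crossing_bound (10 * \<alpha>) (real (card K1 * card K2) * c\<^sup>2 + (exp (q * t) - 1))"
  unfolding crossing_bound_def
proof (intro allI impI)
  interpret P: prob_space P by (rule P(1))
  fix x :: 'a and F :: "('a \<times> real) measure set" assume F: "F \<in> sets config_space" "outside (cball x (10 * (10 * \<alpha>))) F"
  then have F': "outside (cball x (100 * \<alpha>)) F" by simp
  let ?G = "cball x (100 * \<alpha>) \<times> {\<alpha><..}"
  let ?B = "{\<omega> \<in> configurations. atoms \<omega> \<inter> ?G \<noteq> {}}"
  let ?D = "\<lambda>(k1, k2). crossing_event (x + \<alpha> *\<^sub>R k1) \<alpha> \<inter> crossing_event (x + \<alpha> *\<^sub>R k2) \<alpha>"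
  have G: "?G \<in> sets point_space" using a by (intro rect_in_sets) auto
  note B = sets_occupied[OF G]
  have D: "?D k \<in> sets config_space" for k by (auto simp: split_beta' intro!: crossing_event_measurable)
  have sub: "crossing_event x (10 * \<alpha>) \<subseteq> ?B \<union> (\<Union>k\<in>K1 \<times> K2. ?D k)"
  proof
    fix \<omega> assume w: "\<omega> \<in> crossing_event x (10 * \<alpha>)"
    then have cr: "crossing x (10 * \<alpha>) (atoms \<omega>)" and conf: "\<omega> \<in> configurations" by (auto simp: crossing_event_def)
    show "\<omega> \<in> ?B \<union> (\<Union>k\<in>K1 \<times> K2. ?D k)"
    proof (cases "\<omega> \<in> ?B")
      case False
      then have "snd p \<le> \<alpha>" if "p \<in> atoms \<omega>" "fst p \<in> cball x (100 * \<alpha>)" for p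
        using that conf by (force simp: mem_Times_iff)
      from crossing_split[OF K1(2,3) K2(2,3) a cr this] show ?thesis
        using conf by (auto simp: crossing_event_def)
    qed simp
  qed
  have "measure P (crossing_event x (10 * \<alpha>) \<inter> F) \<le> measure P ((?B \<inter> F) \<union> (\<Union>k\<in>K1 \<times> K2. ?D k \<inter> F))"
    using sub B D F K1 K2 by (intro P.finite_measure_mono) (auto simp: P(2) intro!: sets.Un sets.finite_UN)
  also have "\<dots> \<le> measure P (?B \<inter> F) + measure P (\<Union>k\<in>K1 \<times> K2. ?D k \<inter> F)"
    using B D F K1 K2 by (intro measure_Un_le) (auto simp: P(2) intro!: sets.finite_UN)
  also have "measure P (?B \<inter> F) \<le> (exp (q * t) - 1) * measure P F"
    by (rule occupied_bound'[OF _ _ G _ t F(1) F']) auto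
  also have "measure P (\<Union>k\<in>K1 \<times> K2. ?D k \<inter> F) \<le> (\<Sum>k\<in>K1 \<times> K2. measure P (?D k \<inter> F))"
    using D F K1 K2 by (intro measure_UNION_le) (auto simp: P(2))
  also have "\<dots> \<le> (\<Sum>k\<in>K1 \<times> K2. c\<^sup>2 * measure P F)"
  proof (rule sum_mono)
    fix k assume "k \<in> K1 \<times> K2"
    then obtain k1 k2 where k: "k = (k1, k2)" "k1 \<in> K1" "k2 \<in> K2" by auto
    let ?x1 = "x + \<alpha> *\<^sub>R k1" and ?x2 = "x + \<alpha> *\<^sub>R k2"
    have n: "norm k1 = 10" "norm k2 = 80" using k K1 K2 by auto
    have dx: "dist x ?x1 = 10 * \<alpha>" "dist x ?x2 = 80 * \<alpha>" using n a by (auto simp: dist_norm)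
    have s: "cball ?x1 (10 * \<alpha>) \<subseteq> cball x (100 * \<alpha>)" "cball ?x2 (10 * \<alpha>) \<subseteq> cball x (100 * \<alpha>)"
      using dx a by (auto simp: cball_subset_cball_iff dist_commute)
    have "dist ?x1 ?x2 \<ge> 70 * \<alpha>" using dist_triangle[of x ?x2 ?x1] dx by simp
    then have dj: "cball ?x2 (10 * \<alpha>) \<inter> cball ?x1 (10 * \<alpha>) = {}"
      using a by (intro disjoint_cballI) (simp add: dist_commute)
    \<comment> \<open>The second crossing together with \<open>F\<close> is an event outside the
      region of the first, and \<open>F\<close> alone is one outside the region of the second, so
      \<open>crossing_bound\<close> applies twice.\<close>
    have "measure P (?D k \<inter> F) = measure P (crossing_event ?x1 \<alpha> \<inter> (crossing_event ?x2 \<alpha> \<inter> F))"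
      by (simp add: k Int_assoc)
    also have "\<dots> \<le> c * measure P (crossing_event ?x2 \<alpha> \<inter> F)"
      using c(2) F(1) outside_Int[OF outside_crossing_event[OF dj] outside_mono[OF F' s(1)]] crossing_event_measurable
      unfolding crossing_bound_def by blast
    also have "\<dots> \<le> c * (c * measure P F)"
      using c F(1) outside_mono[OF F' s(2)] unfolding crossing_bound_def by (intro mult_left_mono) blast+
    finally show "measure P (?D k \<inter> F) \<le> c\<^sup>2 * measure P F" by (simp add: power2_eq_square mult.assoc)
  qed
  finally show "measure P (crossing_event x (10 * \<alpha>) \<inter> F) \<le>
      (real (card K1 * card K2) * c\<^sup>2 + (exp (q * t) - 1)) * measure P F"
    by (simp add: card_cartesian_product algebra_simps)
qed

definition far_event :: "real \<Rightarrow> ('a \<times> real) measure set" where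
  "far_event \<alpha> = {\<omega> \<in> configurations. \<exists>v\<in>atoms \<omega>. 10 * \<alpha> < norm (fst v) \<and> norm (fst v) \<le> 8 * \<alpha> + snd v}"

text \<open>The region is unbounded, while \<open>occupied_bound'\<close> needs a bounded one. The
  bound is uniform over the truncations to balls of radius \<open>k\<close>, so it passes to their
  increasing union.\<close>

lemma far_event_bound:
  assumes t: "emeasure \<mu> {v \<in> UNIV \<times> {0..}. 10 * \<alpha> < norm (fst v) \<and> norm (fst v) \<le> 8 * \<alpha> + snd v} \<le> ennreal t" "0 \<le> t"
  shows "far_event \<alpha> \<in> sets config_space" "measure P (far_event \<alpha>) \<le> exp (q * t) - 1"
proof -
  interpret P: prob_space P by (rule P(1))
  let ?T = "{v \<in> UNIV \<times> {0..} :: ('a \<times> real) set. 10 * \<alpha> < norm (fst v) \<and> norm (fst v) \<le> 8 * \<alpha> + snd v}"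
  let ?D = "\<lambda>k. {\<omega> \<in> configurations. atoms \<omega> \<inter> (?T \<inter> ball 0 (real k) \<times> {0..}) \<noteq> {}}"
  have "?T = {v \<in> space point_space. 10 * \<alpha> < norm (fst v) \<and> norm (fst v) \<le> 8 * \<alpha> + snd v}"
    by (simp add: space_point_space)
  also have "\<dots> \<in> sets point_space" by measurable
  finally have T: "?T \<in> sets point_space" .
  have Tk: "?T \<inter> ball 0 (real k) \<times> {0..} \<in> sets point_space" for k using T by auto
  note D = sets_occupied[OF Tk]
  have U: "far_event \<alpha> = (\<Union>k. ?D k)"
  proof (intro equalityI subsetI)
    fix \<omega> assume "\<omega> \<in> far_event \<alpha>"
    then obtain v where v: "\<omega> \<in> configurations" "v \<in> atoms \<omega>" "10 * \<alpha> < norm (fst v)" "norm (fst v) \<le> 8 * \<alpha> + snd v"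
      by (auto simp: far_event_def)
    obtain k :: nat where "norm (fst v) < real k" using reals_Archimedean2 by blast
    then have "v \<in> atoms \<omega> \<inter> (?T \<inter> ball 0 (real k) \<times> {0..})"
      using v atoms_radius[OF v(1,2)] by (auto simp: mem_Times_iff)
    then show "\<omega> \<in> (\<Union>k. ?D k)" using v(1) by blast
  qed (auto simp: far_event_def)
  then show "far_event \<alpha> \<in> sets config_space" using D by auto
  have "(\<lambda>k. measure P (?D k)) \<longlonglongrightarrow> measure P (\<Union>k. ?D k)"
    using D by (intro P.finite_Lim_measure_incseq) (auto simp: P(2) incseq_def)
  moreover have "measure P (?D k) \<le> exp (q * t) - 1" for k
  proof -
    have "emeasure \<mu> (?T \<inter> ball 0 (real k) \<times> {0..}) \<le> emeasure \<mu> ?T"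
      using T by (intro emeasure_mono) (auto simp: sets_mu)
    then have e: "emeasure \<mu> (?T \<inter> ball 0 (real k) \<times> {0..}) \<le> ennreal t" using t(1) by simp
    have "measure P (?D k \<inter> configurations) \<le> (exp (q * t) - 1) * measure P configurations"
      by (rule occupied_bound'[where \<Lambda> = "ball 0 (real k)", OF _ _ Tk _ e t(2) sets_configurations]) (auto simp: outside_def)
    moreover have "?D k \<inter> configurations = ?D k" by auto
    ultimately show ?thesis by (simp add: prob_configurations)
  qed
  ultimately show "measure P (far_event \<alpha>) \<le> exp (q * t) - 1"
    unfolding U by (intro LIMSEQ_le_const2) auto
qed

text \<open>With \<open>?N\<close> pairs of net points, the bound
  \<open>?N * c n \<le> 1 / 2\<close> is preserved since
  \<open>(1 / 2)\<^sup>2 + 1 / 4 = 1 / 2\<close>, and it turns the quadratic recursion into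
  \<open>c (Suc n) \<le> c n / 2 + e n\<close>.\<close>

lemma subcritical:
  assumes K1: "finite K1" "K1 \<subseteq> sphere (0::'a) 10" "sphere 0 10 \<subseteq> (\<Union>k\<in>K1. cball k 1)"
    and K2: "finite K2" "K2 \<subseteq> sphere (0::'a) 80" "sphere 0 80 \<subseteq> (\<Union>k\<in>K2. cball k 1)"
    and t: "\<And>n x. emeasure \<mu> (cball x (100 * 10 ^ n) \<times> {10 ^ n<..}) \<le> ennreal (t n)" "\<And>n. 0 \<le> t n" "t \<longlonglongrightarrow> 0"
    and far: "\<And>n. emeasure \<mu> {v \<in> UNIV \<times> {0..}. 10 * 10 ^ n < norm (fst v) \<and> norm (fst v) \<le> 8 * 10 ^ n + snd v} \<le> ennreal (t n)"
    and m: "\<And>x. emeasure \<mu> (cball x 10 \<times> {0..}) \<le> ennreal m" "0 \<le> m"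
    and small: "real (card K1 * card K2) * (exp (q * m) - 1) \<le> 1 / 4" "\<And>n. real (card K1 * card K2) * (exp (q * t n) - 1) \<le> 1 / 4"
  shows "measure_not_percolates P"
proof -
  interpret P: prob_space P by (rule P(1))
  let ?N = "real (card K1 * card K2)"
  define e where "e n = exp (q * t n) - 1" for n
  define c where "c = rec_nat (exp (q * m) - 1) (\<lambda>n c. ?N * c\<^sup>2 + e n)"
  have c_simps: "c 0 = exp (q * m) - 1" "c (Suc n) = ?N * (c n)\<^sup>2 + e n" for n by (simp_all add: c_def)
  have e0: "0 \<le> e n" for n using q t(2)[of n] by (simp add: e_def)
  have c0: "0 \<le> c n" for n using q m(2) e0 by (induction n) (auto simp: c_simps)
  have Nc: "?N * c n \<le> 1 / 2" for n
  proof (induction n)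
    case 0 then show ?case using small(1) by (simp add: c_simps)
  next
    case (Suc n)
    have "?N * c (Suc n) = (?N * c n)\<^sup>2 + ?N * e n" by (simp add: c_simps power2_eq_square algebra_simps)
    also have "(?N * c n)\<^sup>2 \<le> (1 / 2)\<^sup>2" using Suc c0[of n] by (intro power_mono) auto
    also have "?N * e n \<le> 1 / 4" using small(2) by (simp add: e_def)
    finally show ?case by (simp add: power2_eq_square)
  qed
  have elim: "e \<longlonglongrightarrow> 0"
  proof -
    have "(\<lambda>n. exp (q * t n) - 1) \<longlonglongrightarrow> exp (q * 0) - 1" by (intro tendsto_intros t(3))
    moreover have "e = (\<lambda>n. exp (q * t n) - 1)" by (auto simp: e_def)
    ultimately show ?thesis by simp
  qed
  have step: "c (Suc n) \<le> c n / 2 + e n" for n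
  proof -
    have "?N * (c n)\<^sup>2 = (?N * c n) * c n" by (simp add: power2_eq_square)
    also have "\<dots> \<le> (1 / 2) * c n" using Nc[of n] c0[of n] by (intro mult_right_mono)
    finally show ?thesis by (simp add: c_simps)
  qed
  have clim: "c \<longlonglongrightarrow> 0" by (rule recursion_tendsto_0[OF c0 step elim])
  have cb: "crossing_bound (10 ^ n) (c n)" for n
  proof (induction n)
    case 0
    show ?case using crossing_bound_initial[of 1 m] m by (simp add: c_simps)
  next
    case (Suc n)
    have "crossing_bound (10 * 10 ^ n) (?N * (c n)\<^sup>2 + (exp (q * t n) - 1))"
      by (rule crossing_bound_step[OF K1 K2 _ t(1,2) c0 Suc]) simp
    then show ?case by (simp add: c_simps e_def)
  qed
  let ?E = "\<lambda>n. crossing_event 0 (10 ^ n) \<union> far_event (10 ^ n)"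
  have E: "?E n \<in> sets P" for n
    using crossing_event_measurable far_event_bound(1)[OF far t(2)] by (auto simp: P(2))
  have PE: "measure P (?E n) \<le> c n + e n" for n
  proof -
    have "outside (cball 0 (10 * 10 ^ n)) (configurations :: ('a \<times> real) measure set)" by (auto simp: outside_def)
    then have "measure P (crossing_event 0 (10 ^ n) \<inter> configurations) \<le> c n * measure P configurations"
      using cb[of n] sets_configurations unfolding crossing_bound_def by blast
    moreover have "crossing_event 0 (10 ^ n) \<inter> configurations = (crossing_event 0 (10 ^ n) :: ('a \<times> real) measure set)"
      by (auto simp: crossing_event_def)
    moreover note prob_configurations
    moreover have "measure P (?E n) \<le> measure P (crossing_event 0 (10 ^ n)) + measure P (far_event (10 ^ n))"
      using crossing_event_measurable far_event_bound(1)[OF far t(2)] by (intro measure_Un_le) (auto simp: P(2))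
    moreover have "measure P (far_event (10 ^ n)) \<le> e n" unfolding e_def by (rule far_event_bound(2)[OF far t(2)])
    ultimately show ?thesis by simp
  qed
  have lim: "(\<lambda>n. c n + e n) \<longlonglongrightarrow> 0" using tendsto_add[OF clim elim] by simp
  \<comment> \<open>Percolation forces these events at every large scale, so it is enough that their
    probabilities tend to 0; no summability is asked for.\<close>
  have null: "(\<Inter>n\<in>{N..}. ?E n) \<in> null_sets P" for N
  proof -
    have m: "(\<Inter>n\<in>{N..}. ?E n) \<in> sets P" using E by (intro sets.countable_INT') auto
    have "measure P (\<Inter>n\<in>{N..}. ?E n) \<le> c n + e n" if "n \<ge> N" for n
      using P.finite_measure_mono[of "\<Inter>n\<in>{N..}. ?E n" "?E n"] E that PE[of n] by (auto intro: order_trans)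
    then have "measure P (\<Inter>n\<in>{N..}. ?E n) \<le> 0"
      using lim by (intro LIMSEQ_le_const) (auto intro: exI[of _ N])
    then have "measure P (\<Inter>n\<in>{N..}. ?E n) = 0" by (intro order.antisym measure_nonneg)
    then show ?thesis using m by (intro null_setsI) (auto simp: P.emeasure_eq_measure)
  qed
  have "(\<Union>N. \<Inter>n\<in>{N..}. ?E n) \<in> null_sets P" using null by (intro null_sets_UN) auto
  moreover note sets_percolates
  moreover have "{\<omega> \<in> space P. percolates \<omega>} \<subseteq> (\<Union>N. \<Inter>n\<in>{N..}. ?E n)"
  proof
    fix \<omega> assume "\<omega> \<in> {\<omega> \<in> space P. percolates \<omega>}"
    then have w: "\<omega> \<in> configurations" "percolates \<omega>" by (auto simp: space_P)
    then obtain p where p: "p \<in> atoms \<omega>" "\<And>n::nat. \<exists>p'\<in>atoms \<omega>. linked touch (atoms \<omega>) p p' \<and> real n < norm (fst p') + snd p'"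
      using percolates_iff by blast
    \<comment> \<open>From scale \<open>10 ^ N\<close> on, the centre of \<open>p\<close> lies in
      the inner ball, so at every later scale its unbounded cluster starts inside and
      leaves.\<close>
    obtain N where N: "norm (fst p) < 10 ^ N" using real_arch_pow[of 10 "norm (fst p)"] by auto
    have "\<omega> \<in> ?E n" if "n \<ge> N" for n
    proof -
      have "(10::real) ^ N \<le> 10 ^ n" using that by (intro power_increasing) auto
      then have n: "norm (fst p) \<le> 10 ^ n" using N by linarith
      obtain k :: nat where k: "8 * 10 ^ n \<le> real k" using real_arch_simple by blast
      obtain p' where p': "linked touch (atoms \<omega>) p p'" "real k < norm (fst p') + snd p'" using p(2) by blast
      have "crossing 0 (10 ^ n) (atoms \<omega>) \<or> (\<exists>v\<in>atoms \<omega>. 10 * 10 ^ n < dist 0 (fst v) \<and> dist 0 (fst v) \<le> 8 * 10 ^ n + snd v)"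
        using n p' k atoms_radius[OF w(1) p(1)] by (intro crossing_or_far[OF p'(1) p(1)]) auto
      then show ?thesis using w(1) by (auto simp: crossing_event_def far_event_def)
    qed
    then show "\<omega> \<in> (\<Union>N. \<Inter>n\<in>{N..}. ?E n)" by auto
  qed
  ultimately show ?thesis unfolding measure_not_percolates_def by (rule null_sets_subset)
qed

end

section \<open>Multiscale blocks of sites\<close>

text \<open>\<open>S\<close> is the set of vacant sites, and \<open>c\<close> at level
  \<open>n\<close> stands for the sites whose coordinates divided by \<open>3 ^ n\<close> give
  \<open>c\<close>. Tolerating one bad subbox is what squares the bound for badness from level to
  level.\<close>

fun bad :: "(nat \<times> nat) set \<Rightarrow> nat \<Rightarrow> nat \<times> nat \<Rightarrow> bool" where
  "bad S 0 c \<longleftrightarrow> c \<in> S"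
| "bad S (Suc n) c \<longleftrightarrow> (\<exists>i<3. \<exists>j<3. \<exists>i'<3. \<exists>j'<3. (i, j) \<noteq> (i', j') \<and>
      bad S n (3 * fst c + i, 3 * snd c + j) \<and> bad S n (3 * fst c + i', 3 * snd c + j'))"

text \<open>The sites that remain when bad subboxes are discarded at every level below
  \<open>n\<close>. In a good box they all avoid \<open>S\<close> and are connected to one another,
  by \<open>core_good\<close> and \<open>joined_props\<close>.\<close>

fun core :: "(nat \<times> nat) set \<Rightarrow> nat \<Rightarrow> nat \<times> nat \<Rightarrow> (nat \<times> nat) set" where
  "core S 0 c = {c}"
| "core S (Suc n) c = (\<Union>i\<in>{..<3}. \<Union>j\<in>{..<3}.
      if bad S n (3 * fst c + i, 3 * snd c + j) then {} else core S n (3 * fst c + i, 3 * snd c + j))"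

lemma core_sub:
  assumes "i < 3" "j < 3" "\<not> bad S n (3 * fst c + i, 3 * snd c + j)"
  shows "core S n (3 * fst c + i, 3 * snd c + j) \<subseteq> core S (Suc n) c"
proof
  fix s assume "s \<in> core S n (3 * fst c + i, 3 * snd c + j)"
  then show "s \<in> core S (Suc n) c"
    unfolding core.simps using assms by (intro UN_I[of i] UN_I[of j]) auto
qed

lemma less3: "(i::nat) < 3 \<longleftrightarrow> i = 0 \<or> i = 1 \<or> i = 2"
  by auto

text \<open>
  A row and a column without bad cells meet in a cell to which every good cell is related.
\<close>
lemma grid3_connected:
  fixes good :: "nat \<Rightarrow> nat \<Rightarrow> bool" and E :: "nat \<times> nat \<Rightarrow> nat \<times> nat \<Rightarrow> bool"
  assumes one: "\<And>i j i' j'. i < 3 \<Longrightarrow> j < 3 \<Longrightarrow> i' < 3 \<Longrightarrow> j' < 3 \<Longrightarrow> \<not> good i j \<Longrightarrow> \<not> good i' j' \<Longrightarrow> i = i' \<and> j = j'"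
    and refl: "\<And>i j. i < 3 \<Longrightarrow> j < 3 \<Longrightarrow> good i j \<Longrightarrow> E (i, j) (i, j)"
    and sym: "\<And>u v. E u v \<Longrightarrow> E v u"
    and trans: "\<And>i j u v. good i j \<Longrightarrow> E u (i, j) \<Longrightarrow> E (i, j) v \<Longrightarrow> E u v"
    and right: "\<And>i j. i < 2 \<Longrightarrow> j < 3 \<Longrightarrow> good i j \<Longrightarrow> good (Suc i) j \<Longrightarrow> E (i, j) (Suc i, j)"
    and up: "\<And>i j. i < 3 \<Longrightarrow> j < 2 \<Longrightarrow> good i j \<Longrightarrow> good i (Suc j) \<Longrightarrow> E (i, j) (i, Suc j)"
    and u: "i < 3" "j < 3" "good i j" and v: "i' < 3" "j' < 3" "good i' j'"
  shows "E (i, j) (i', j')"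
proof -
  have row: "E (i, j) (i', j)" if clean: "\<And>i. i < 3 \<Longrightarrow> good i j" and "j < 3" "i < 3" "i' < 3" for i i' j
  proof -
    have 1: "E (0, j) (1, j)" "E (1, j) (2, j)"
      using right[of 0 j] right[of 1 j] that by (auto simp: numeral_2_eq_2)
    have 2: "E (0, j) (2, j)" by (rule trans[OF _ 1]) (use clean in auto)
    show ?thesis
      using that(3,4) refl[of 0 j] refl[of 1 j] refl[of 2 j] clean \<open>j < 3\<close> 1 2 sym[OF 1(1)] sym[OF 1(2)] sym[OF 2]
      unfolding less3 by (elim disjE) auto
  qed
  have col: "E (i, j) (i, j')" if clean: "\<And>j. j < 3 \<Longrightarrow> good i j" and "i < 3" "j < 3" "j' < 3" for i j j'
  proof -
    have 1: "E (i, 0) (i, 1)" "E (i, 1) (i, 2)"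
      using up[of i 0] up[of i 1] that by (auto simp: numeral_2_eq_2)
    have 2: "E (i, 0) (i, 2)" by (rule trans[OF _ 1]) (use clean in auto)
    show ?thesis
      using that(3,4) refl[of i 0] refl[of i 1] refl[of i 2] clean \<open>i < 3\<close> 1 2 sym[OF 1(1)] sym[OF 1(2)] sym[OF 2]
      unfolding less3 by (elim disjE) auto
  qed
  \<comment> \<open>At most one cell is bad; \<open>r\<close> avoids its first coordinate and
    \<open>c\<close> its second.\<close>
  obtain r c where rc: "r < 3" "\<And>j. j < 3 \<Longrightarrow> good r j" "c < 3" "\<And>i. i < 3 \<Longrightarrow> good i c"
  proof (cases "\<exists>i<3. \<exists>j<3. \<not> good i j")
    case True
    then obtain a b where ab: "a < 3" "b < 3" "\<not> good a b" by blast
    let ?r = "if a = 0 then 1 else 0 :: nat" and ?c = "if b = 0 then 1 else 0 :: nat"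
    have r: "?r < 3" "?r \<noteq> a" and c: "?c < 3" "?c \<noteq> b" by auto
    have "good ?r j" if "j < 3" for j using one[OF r(1) that ab(1,2) _ ab(3)] r(2) by blast
    moreover have "good i ?c" if "i < 3" for i using one[OF that c(1) ab(1,2) _ ab(3)] c(2) by blast
    ultimately show ?thesis using that[of ?r ?c] r c by blast
  next
    case False
    then show ?thesis using that[of 0 0] by auto
  qed
  have to: "E (i, j) (r, c)" if "i < 3" "j < 3" "good i j" for i j
  proof (cases "\<forall>k<3. good k j")
    case True
    then have "E (i, j) (r, j)" using row[of j i r] that rc by blast
    moreover have "E (r, j) (r, c)" using col[of r j c] rc that by blast
    ultimately show ?thesis using trans[of r j] rc that by blast
  next
    case False
    then obtain k where k: "k < 3" "\<not> good k j" by blast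
    \<comment> \<open>The only bad cell is \<open>(k, j)\<close> with \<open>k\<close> different
      from \<open>i\<close>, so the line with first coordinate \<open>i\<close> is clean.\<close>
    have "good i l" if "l < 3" for l using one[OF \<open>i < 3\<close> that k(1) \<open>j < 3\<close> _ k(2)] \<open>good i j\<close> k(2) by blast
    then have "E (i, j) (i, c)" using col[of i j c] rc that by blast
    moreover have "E (i, c) (r, c)" using row[of c i r] rc that by blast
    ultimately show ?thesis using trans[of i c] rc that by blast
  qed
  show ?thesis by (rule trans[OF _ to[OF u] sym[OF to[OF v]]]) (use rc in blast)
qed

locale site_connection =
  fixes S :: "(nat \<times> nat) set" and conn :: "nat \<times> nat \<Rightarrow> nat \<times> nat \<Rightarrow> bool"
  assumes conn_refl: "s \<notin> S \<Longrightarrow> conn s s" and conn_sym: "conn s t \<Longrightarrow> conn t s"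
    and conn_trans: "conn s t \<Longrightarrow> conn t u \<Longrightarrow> conn s u"
    and conn_right: "(a, b) \<notin> S \<Longrightarrow> (Suc a, b) \<notin> S \<Longrightarrow> conn (a, b) (Suc a, b)"
    and conn_up: "(a, b) \<notin> S \<Longrightarrow> (a, Suc b) \<notin> S \<Longrightarrow> conn (a, b) (a, Suc b)"
begin

definition joined :: "nat \<Rightarrow> nat \<times> nat \<Rightarrow> nat \<times> nat \<Rightarrow> bool" where
  "joined n c c' \<longleftrightarrow> (\<forall>s\<in>core S n c. \<forall>t\<in>core S n c'. conn s t)"

lemma bad_unique:
  assumes "\<not> bad S (Suc n) c" "i < 3" "j < 3" "i' < 3" "j' < 3"
    "bad S n (3 * fst c + i, 3 * snd c + j)" "bad S n (3 * fst c + i', 3 * snd c + j')"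
  shows "i = i' \<and> j = j'"
  using assms by auto

lemma core_nonempty: "\<not> bad S n c \<Longrightarrow> core S n c \<noteq> {}"
proof (induction n arbitrary: c)
  case (Suc n)
  have "\<not> bad S n (3 * fst c + 0, 3 * snd c + 0) \<or> \<not> bad S n (3 * fst c + 1, 3 * snd c + 0)"
    using bad_unique[OF Suc(2), of 0 0 1 0] by auto
  then obtain i :: nat where i: "i < 3" "\<not> bad S n (3 * fst c + i, 3 * snd c + 0)"
    by (metis one_less_numeral_iff semiring_norm(77) zero_less_numeral)
  then obtain s where "s \<in> core S n (3 * fst c + i, 3 * snd c + 0)" using Suc.IH by blast
  moreover have "(0::nat) < 3" by simp
  ultimately have "s \<in> core S (Suc n) c" using core_sub[OF i(1) _ i(2)] by blast
  then show ?case by blast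
qed simp

text \<open>One induction serves all three claims. Inside a box of the next level, adjacent good
  subboxes are joined by the second and third claim. Two neighbouring boxes are then joined through
  one pair of adjacent good subboxes and the first claim for both boxes.\<close>

lemma joined_props:
  "(\<not> bad S n c \<longrightarrow> joined n c c) \<and>
   (\<not> bad S n (a, b) \<longrightarrow> \<not> bad S n (Suc a, b) \<longrightarrow> joined n (a, b) (Suc a, b)) \<and>
   (\<not> bad S n (a, b) \<longrightarrow> \<not> bad S n (a, Suc b) \<longrightarrow> joined n (a, b) (a, Suc b))"
proof (induction n arbitrary: c a b)
  case 0
  then show ?case using conn_refl conn_right conn_up by (auto simp: joined_def)
next
  case (Suc n)
  have self: "joined (Suc n) c c" if g: "\<not> bad S (Suc n) c" for c
  proof -
    let ?cell = "\<lambda>i j. (3 * fst c + i, 3 * snd c + j)"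
    let ?good = "\<lambda>i j. \<not> bad S n (?cell i j)"
    let ?E = "\<lambda>u v. joined n (?cell (fst u) (snd u)) (?cell (fst v) (snd v))"
    have "?E (i, j) (i', j')" if "i < 3" "j < 3" "?good i j" "i' < 3" "j' < 3" "?good i' j'" for i j i' j'
    proof (rule grid3_connected[of ?good ?E, OF _ _ _ _ _ _ that])
      show "i = i' \<and> j = j'" if "i < 3" "j < 3" "i' < 3" "j' < 3" "\<not> ?good i j" "\<not> ?good i' j'" for i j i' j'
        using bad_unique[OF g that(1-4)] that(5,6) by blast
      show "?E (i, j) (i, j)" if "?good i j" for i j using Suc.IH that by simp
      show "?E v u" if "?E u v" for u v using that conn_sym unfolding joined_def by blast
      show "?E u v" if "?good i j" "?E u (i, j)" "?E (i, j) v" for i j u v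
        using core_nonempty[OF that(1)] that(2,3) conn_trans unfolding joined_def fst_conv snd_conv by blast
      show "?E (i, j) (Suc i, j)" if "?good i j" "?good (Suc i) j" for i j
        using Suc.IH[THEN conjunct2, THEN conjunct1, of "3 * fst c + i" "3 * snd c + j"] that by simp
      show "?E (i, j) (i, Suc j)" if "?good i j" "?good i (Suc j)" for i j
        using Suc.IH[THEN conjunct2, THEN conjunct2, of "3 * fst c + i" "3 * snd c + j"] that by simp
    qed
    then show ?thesis by (fastforce simp: joined_def split: if_splits)
  qed
  note sub = core_sub
  have join: "joined (Suc n) c c'" if g: "\<not> bad S (Suc n) c" "\<not> bad S (Suc n) c'"
    and u: "core S n u \<subseteq> core S (Suc n) c" "core S n u' \<subseteq> core S (Suc n) c'" "\<not> bad S n u" "\<not> bad S n u'" "joined n u u'"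
    for c c' u u'
  proof -
    obtain x where x: "x \<in> core S n u" using core_nonempty[OF u(3)] by blast
    obtain y where y: "y \<in> core S n u'" using core_nonempty[OF u(4)] by blast
    note xy = x y
    have "conn x y" using u(5) xy by (auto simp: joined_def)
    show ?thesis unfolding joined_def
    proof (intro ballI)
      fix s t assume st: "s \<in> core S (Suc n) c" "t \<in> core S (Suc n) c'"
      have "conn s x" using self[OF g(1), unfolded joined_def] st(1) subsetD[OF u(1) xy(1)] by blast
      moreover have "conn y t" using self[OF g(2), unfolded joined_def] st(2) subsetD[OF u(2) xy(2)] by blast
      ultimately show "conn s t" using \<open>conn x y\<close> conn_trans by blast
    qed
  qed
  have right: "joined (Suc n) (a, b) (Suc a, b)" if g: "\<not> bad S (Suc n) (a, b)" "\<not> bad S (Suc n) (Suc a, b)"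
  proof -
    \<comment> \<open>Three pairs of subboxes face each other across the common side. Each of the
      two boxes has at most one bad subbox, so one pair is good on both sides.\<close>
    obtain j where j: "j < 3" "\<not> bad S n (3 * a + 2, 3 * b + j)" "\<not> bad S n (3 * Suc a + 0, 3 * b + j)"
    proof -
      note b1 = bad_unique[OF g(1), of 2 _ 2, unfolded fst_conv snd_conv] and b2 = bad_unique[OF g(2), of 0 _ 0, unfolded fst_conv snd_conv]
      show ?thesis
        using b1[of 0 1] b1[of 0 2] b1[of 1 2] b2[of 0 1] b2[of 0 2] b2[of 1 2] that[of 0] that[of 1] that[of 2] by force
    qed
    have "joined n (3 * a + 2, 3 * b + j) (3 * Suc a + 0, 3 * b + j)"
    proof -
      have e: "3 * Suc a + 0 = Suc (3 * a + 2)" by simp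
      show ?thesis using Suc.IH[THEN conjunct2, THEN conjunct1, of "3 * a + 2" "3 * b + j"] j(2,3) unfolding e by blast
    qed
    then show ?thesis using j
      by (intro join[OF g sub[of 2 j S n "(a, b)", unfolded fst_conv snd_conv] sub[of 0 j S n "(Suc a, b)", unfolded fst_conv snd_conv]]) auto
  qed
  have up: "joined (Suc n) (a, b) (a, Suc b)" if g: "\<not> bad S (Suc n) (a, b)" "\<not> bad S (Suc n) (a, Suc b)"
  proof -
    obtain j where j: "j < 3" "\<not> bad S n (3 * a + j, 3 * b + 2)" "\<not> bad S n (3 * a + j, 3 * Suc b + 0)"
    proof -
      note b1 = bad_unique[OF g(1), of _ 2 _ 2, unfolded fst_conv snd_conv] and b2 = bad_unique[OF g(2), of _ 0 _ 0, unfolded fst_conv snd_conv]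
      show ?thesis
        using b1[of 0 1] b1[of 0 2] b1[of 1 2] b2[of 0 1] b2[of 0 2] b2[of 1 2] that[of 0] that[of 1] that[of 2] by force
    qed
    have "joined n (3 * a + j, 3 * b + 2) (3 * a + j, 3 * Suc b + 0)"
    proof -
      have e: "3 * Suc b + 0 = Suc (3 * b + 2)" by simp
      show ?thesis using Suc.IH[THEN conjunct2, THEN conjunct2, of "3 * a + j" "3 * b + 2"] j(2,3) unfolding e by blast
    qed
    then show ?thesis using j
      by (intro join[OF g sub[of j 2 S n "(a, b)", unfolded fst_conv snd_conv] sub[of j 0 S n "(a, Suc b)", unfolded fst_conv snd_conv]]) auto
  qed
  show ?case using self right up by blast
qed

lemma core_fst: "s \<in> core S n c \<Longrightarrow> 3 ^ n * fst c \<le> fst s"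
proof (induction n arbitrary: c)
  case (Suc n)
  then obtain i j where "s \<in> core S n (3 * fst c + i, 3 * snd c + j)" by (auto split: if_splits)
  from Suc.IH[OF this] show ?case by (simp add: algebra_simps)
qed simp

lemma core_good: "s \<in> core S n c \<Longrightarrow> \<not> bad S n c \<Longrightarrow> s \<notin> S"
proof (induction n arbitrary: c)
  case (Suc n)
  then obtain i j where "s \<in> core S n (3 * fst c + i, 3 * snd c + j)" "\<not> bad S n (3 * fst c + i, 3 * snd c + j)"
    by (auto split: if_splits)
  then show ?case by (rule Suc.IH)
qed simp

text \<open>The boxes at the origin are nested, and so are their cores from level \<open>N\<close>
  on. A good subbox in the last column of the box of level \<open>Suc n\<close> has first
  coordinates of at least \<open>2 * 3 ^ n\<close>, so the connection runs to infinity.\<close>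

lemma unbounded_connection:
  assumes good: "\<And>n. N \<le> n \<Longrightarrow> \<not> bad S n (0, 0)"
  shows "\<exists>s. s \<notin> S \<and> (\<forall>k. \<exists>t. t \<notin> S \<and> conn s t \<and> k \<le> fst t)"
proof -
  obtain s where s: "s \<in> core S N (0, 0)" using core_nonempty good by blast
  \<comment> \<open>The box at the origin is the subbox with offset \<open>(0, 0)\<close> of the
    next one and is good, so its core is kept.\<close>
  have s_in: "s \<in> core S n (0, 0)" if "N \<le> n" for n
    using that
  proof (induction n rule: dec_induct)
    case (step n)
    then show ?case using core_sub[of 0 0 S n "(0, 0)"] good[of n] by (auto simp del: core.simps)
  qed (rule s)
  have "\<exists>t. t \<notin> S \<and> conn s t \<and> k \<le> fst t" for k
  proof -
    define n where "n = max N k"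
    have n: "N \<le> n" "N \<le> Suc n" "k \<le> n" by (auto simp: n_def)
    have g: "\<not> bad S (Suc n) (0, 0)" using good n by blast
    have "\<not> bad S n (2, 0) \<or> \<not> bad S n (2, 1)"
      using bad_unique[OF g, of 2 0 2 1] by (auto simp: numeral_2_eq_2)
    then obtain j where j: "j < 3" "\<not> bad S n (2, j)"
      by (metis one_less_numeral_iff semiring_norm(77) zero_less_numeral)
    then obtain t where t: "t \<in> core S n (2, j)" using core_nonempty by blast
    then have t': "t \<in> core S (Suc n) (0, 0)"
      using core_sub[of 2 j S n "(0, 0)"] j by (auto simp: numeral_2_eq_2 simp del: core.simps)
    have "joined (Suc n) (0, 0) (0, 0)" using joined_props g by blast
    then have "conn s t" using s_in[OF n(2)] t' by (auto simp: joined_def)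
    moreover have "k \<le> fst t"
    proof -
      have "n < 3 ^ n" by (rule less_exp[THEN less_le_trans]) (simp add: power_mono)
      then show ?thesis using core_fst[OF t] n(3) by simp
    qed
    ultimately show ?thesis using core_good[OF t j(2)] by blast
  qed
  then show ?thesis using core_good[OF s good[OF order_refl]] by blast
qed

end

section \<open>Counting the witnesses of a bad box\<close>

text \<open>Minimal causes of badness: an ordered pair of distinct subboxes is chosen at each level,
  independently in the two branches, down to single sites.\<close>

fun bad_witnesses :: "nat \<Rightarrow> nat \<times> nat \<Rightarrow> (nat \<times> nat) set set" where
  "bad_witnesses 0 c = {{c}}"
| "bad_witnesses (Suc n) c = (\<Union>(u, v)\<in>{(u, v). u \<in> {3 * fst c..<3 * fst c + 3} \<times> {3 * snd c..<3 * snd c + 3} \<and>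
      v \<in> {3 * fst c..<3 * fst c + 3} \<times> {3 * snd c..<3 * snd c + 3} \<and> u \<noteq> v}.
      (\<lambda>(A, B). A \<union> B) ` (bad_witnesses n u \<times> bad_witnesses n v))"

lemma bad_witness: "bad S n c \<Longrightarrow> \<exists>A\<in>bad_witnesses n c. A \<subseteq> S"
proof (induction n arbitrary: c)
  case (Suc n)
  then obtain i j i' j' where u: "i < 3" "j < 3" "i' < 3" "j' < 3" "(i, j) \<noteq> (i', j')"
    "bad S n (3 * fst c + i, 3 * snd c + j)" "bad S n (3 * fst c + i', 3 * snd c + j')" by auto
  obtain A B where AB: "A \<in> bad_witnesses n (3 * fst c + i, 3 * snd c + j)" "A \<subseteq> S"
    "B \<in> bad_witnesses n (3 * fst c + i', 3 * snd c + j')" "B \<subseteq> S"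
    using Suc.IH[OF u(6)] Suc.IH[OF u(7)] by blast
  have "A \<union> B \<in> bad_witnesses (Suc n) c"
    unfolding bad_witnesses.simps
    by (rule UN_I[of "((3 * fst c + i, 3 * snd c + j), (3 * fst c + i', 3 * snd c + j'))"])
       (use u AB in \<open>auto intro!: image_eqI[of _ _ "(A, B)"]\<close>)
  then show ?case using AB by blast
qed simp

text \<open>The two halves of a witness lie in different subboxes, so their sizes add up. The exact
  size \<open>2 ^ n\<close> becomes the exponent in the bound for vacant cells.\<close>

lemma bad_witness_props:
  "A \<in> bad_witnesses n c \<Longrightarrow> finite A \<and> card A = 2 ^ n \<and> A \<subseteq> {s. fst s div 3 ^ n = fst c \<and> snd s div 3 ^ n = snd c}"
proof (induction n arbitrary: A c)
  case (Suc n)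
  then obtain u v A1 A2 where u: "u \<in> {3 * fst c..<3 * fst c + 3} \<times> {3 * snd c..<3 * snd c + 3}"
    "v \<in> {3 * fst c..<3 * fst c + 3} \<times> {3 * snd c..<3 * snd c + 3}" "u \<noteq> v"
    and A: "A1 \<in> bad_witnesses n u" "A2 \<in> bad_witnesses n v" "A = A1 \<union> A2" by auto
  note p = Suc.IH[OF A(1)] Suc.IH[OF A(2)]
  have "A1 \<inter> A2 = {}"
  proof (rule ccontr)
    assume "A1 \<inter> A2 \<noteq> {}"
    then obtain s where "s \<in> A1" "s \<in> A2" by blast
    then have "fst u = fst v" "snd u = snd v" using p by fastforce+
    then show False using u(3) by (simp add: prod_eq_iff)
  qed
  then have "card A = 2 ^ Suc n" "finite A" using p A(3) by (simp_all add: card_Un_disjoint)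
  moreover have "A \<subseteq> {s. fst s div 3 ^ Suc n = fst c \<and> snd s div 3 ^ Suc n = snd c}"
  proof
    fix s assume "s \<in> A"
    then obtain w where w: "w = u \<or> w = v" "fst s div 3 ^ n = fst w" "snd s div 3 ^ n = snd w"
      using p A(3) by blast
    then have "fst w div 3 = fst c" "snd w div 3 = snd c" using u by auto
    then show "s \<in> {s. fst s div 3 ^ Suc n = fst c \<and> snd s div 3 ^ Suc n = snd c}"
      unfolding mem_Collect_eq power_Suc2 div_mult2_eq w(2,3) by simp
  qed
  ultimately show ?case by blast
qed auto

text \<open>Among 9 subboxes there are fewer than \<open>9 * 9 = 81\<close> ordered pairs of
  distinct ones, so a bound \<open>w\<close> for level \<open>n\<close> gives
  \<open>81 * w\<^sup>2\<close> for the next. The factor 81 on the left turns this into plain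
  squaring.\<close>

lemma card_bad_witnesses: "finite (bad_witnesses n c) \<and> 81 * card (bad_witnesses n c) \<le> 81 ^ 2 ^ n"
proof (induction n arbitrary: c)
  case (Suc n)
  let ?B = "{3 * fst c..<3 * fst c + 3} \<times> {3 * snd c..<3 * snd c + 3}"
  let ?I = "{(u, v). u \<in> ?B \<and> v \<in> ?B \<and> u \<noteq> v}"
  have I: "?I \<subseteq> ?B \<times> ?B" by auto
  have fin: "finite ?I" by (rule finite_subset[OF I]) simp
  have "card ?I \<le> card (?B \<times> ?B)" by (rule card_mono[OF _ I]) simp
  also have "\<dots> = 81" by (simp add: card_cartesian_product)
  finally have cI: "card ?I \<le> 81" .
  let ?W = "\<lambda>(u, v). (\<lambda>(A, B). A \<union> B) ` (bad_witnesses n u \<times> bad_witnesses n v)"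
  have W: "81 * 81 * card (?W p) \<le> 81 ^ 2 ^ Suc n" for p
  proof -
    obtain u v where p: "p = (u, v)" by (cases p)
    have "card (?W p) \<le> card (bad_witnesses n u \<times> bad_witnesses n v)"
      unfolding p prod.case using Suc.IH by (intro card_image_le) simp
    also have "\<dots> = card (bad_witnesses n u) * card (bad_witnesses n v)" by (rule card_cartesian_product)
    finally have "81 * 81 * card (?W p) \<le> (81 * card (bad_witnesses n u)) * (81 * card (bad_witnesses n v))" by simp
    also have "\<dots> \<le> 81 ^ 2 ^ n * 81 ^ 2 ^ n" using Suc.IH by (intro mult_le_mono) auto
    also have "\<dots> = 81 ^ 2 ^ Suc n" by (simp add: mult_2 flip: power_add)
    finally show ?thesis .
  qed
  have eq: "bad_witnesses (Suc n) c = (\<Union>p\<in>?I. ?W p)" by simp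
  define b where "b = card (bad_witnesses (Suc n) c)"
  define f where "f p = card (?W p)" for p
  have "b \<le> (\<Sum>p\<in>?I. f p)"
    unfolding eq b_def f_def using fin by (intro card_UN_le)
  then have "81 * 81 * b \<le> (\<Sum>p\<in>?I. 81 * 81 * f p)"
    by (simp add: sum_distrib_left[symmetric])
  also have "\<dots> \<le> of_nat (card ?I) * 81 ^ 2 ^ Suc n"
    using W by (intro sum_bounded_above) (simp add: f_def)
  also have "\<dots> \<le> 81 * 81 ^ 2 ^ Suc n" using cI by (intro mult_le_mono1) simp
  finally have "81 * card (bad_witnesses (Suc n) c) \<le> 81 ^ 2 ^ Suc n" by (simp add: b_def del: bad_witnesses.simps)
  moreover have "finite (bad_witnesses (Suc n) c)" unfolding eq using fin Suc.IH by auto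
  ultimately show ?case by blast
qed simp

section \<open>Percolation\<close>

text \<open>A planar lattice of mesh \<open>\<rho>\<close> along two coordinate axes; two axes are
  available because the dimension is at least 2.\<close>

definition ctr :: "'a::euclidean_space \<Rightarrow> 'a \<Rightarrow> real \<Rightarrow> nat \<times> nat \<Rightarrow> 'a" where
  "ctr e1 e2 \<rho> s = \<rho> *\<^sub>R (real (fst s) *\<^sub>R e1 + real (snd s) *\<^sub>R e2)"

lemma ctr_inner:
  assumes "e1 \<in> Basis" "e2 \<in> Basis" "e1 \<noteq> e2"
  shows "ctr e1 e2 \<rho> s \<bullet> e1 = \<rho> * real (fst s)" "ctr e1 e2 \<rho> s \<bullet> e2 = \<rho> * real (snd s)"
  using assms by (simp_all add: ctr_def inner_add_left inner_Basis)

lemma dist_ctr_ge: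
  assumes e: "e1 \<in> Basis" "e2 \<in> Basis" "e1 \<noteq> e2" and r: "0 \<le> \<rho>" and st: "s \<noteq> t"
  shows "\<rho> \<le> dist (ctr e1 e2 \<rho> s) (ctr e1 e2 \<rho> t)"
proof -
  let ?d = "ctr e1 e2 \<rho> s - ctr e1 e2 \<rho> t"
  have i: "?d \<bullet> e1 = \<rho> * (real (fst s) - real (fst t))" "?d \<bullet> e2 = \<rho> * (real (snd s) - real (snd t))"
    using ctr_inner[OF e] by (simp_all add: inner_diff_left right_diff_distrib)
  have "\<bar>?d \<bullet> e1\<bar> \<le> norm ?d" "\<bar>?d \<bullet> e2\<bar> \<le> norm ?d" using Basis_le_norm e by auto
  moreover have "fst s \<noteq> fst t \<or> snd s \<noteq> snd t" using st by (auto simp: prod_eq_iff)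
  then have "1 \<le> \<bar>real (fst s) - real (fst t)\<bar> \<or> 1 \<le> \<bar>real (snd s) - real (snd t)\<bar>" by linarith
  then have "\<rho> \<le> \<bar>?d \<bullet> e1\<bar> \<or> \<rho> \<le> \<bar>?d \<bullet> e2\<bar>"
    unfolding i abs_mult using r by (auto simp: mult_le_cancel_left1)
  ultimately show ?thesis by (auto simp: dist_norm)
qed

text \<open>Each touched cluster is represented by one of its points; these points do not touch one another.\<close>
lemma card_touched_clusters:
  fixes A X :: "('a::euclidean_space \<times> real) set"
  assumes A: "finite A" and I: "finite I" and s: "0 < s" "0 \<le> r"
    and near: "\<And>p b. p \<in> A \<Longrightarrow> b \<in> X \<Longrightarrow> touch p b \<Longrightarrow> s \<le> snd p \<and> (\<exists>i\<in>I. dist (fst p) (y i) \<le> r + snd p)"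
  shows "card {C \<in> clusters touch A. \<exists>p\<in>C. \<exists>b\<in>X. touch p b} \<le> card I * nat \<lceil>((r + 2 * s) / s) ^ DIM('a)\<rceil>"
proof -
  let ?T = "{C \<in> clusters touch A. \<exists>p\<in>C. \<exists>b\<in>X. touch p b}" and ?K = "nat \<lceil>((r + 2 * s) / s) ^ DIM('a)\<rceil>"
  define f where "f C = (SOME p. p \<in> C \<and> (\<exists>b\<in>X. touch p b))" for C
  have f: "f C \<in> C \<and> (\<exists>b\<in>X. touch (f C) b)" if "C \<in> ?T" for C
    unfolding f_def by (rule someI_ex) (use that in blast)
  have fA: "f C \<in> A" if "C \<in> ?T" for C using f[OF that] touch.clusters_sub that by blast
  have nt: "\<not> touch (f C) (f D)" if "C \<in> ?T" "D \<in> ?T" "C \<noteq> D" for C D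
  proof
    assume "touch (f C) (f D)"
    then have "cluster touch A (f C) = cluster touch A (f D)"
      by (intro touch.cluster_eq touch.linked_step fA that(1,2))
    moreover have "C = cluster touch A (f C)"
      using touch.clusters_cluster[of C A "f C"] f[OF that(1)] that(1) by blast
    moreover have "D = cluster touch A (f D)"
      using touch.clusters_cluster[of D A "f D"] f[OF that(2)] that(2) by blast
    ultimately show False using that(3) by simp
  qed
  have self: "touch (f C) (f C)" if "C \<in> ?T" for C
  proof -
    have "s \<le> snd (f C)" using near[OF fA[OF that]] f[OF that] by blast
    then show ?thesis using s by (simp add: touch_def)
  qed
  have inj: "inj_on f ?T" using nt self by (metis (no_types, lifting) inj_onI)
  let ?F = "\<lambda>i. {p \<in> f ` ?T. dist (fst p) (y i) \<le> r + snd p}"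
  have fT: "finite (f ` ?T)" using touch.finite_clusters[OF A] by simp
  have "f ` ?T \<subseteq> (\<Union>i\<in>I. ?F i)"
  proof
    fix p assume p: "p \<in> f ` ?T"
    then obtain C where C: "C \<in> ?T" "p = f C" by blast
    obtain b where "b \<in> X" "touch (f C) b" using f[OF C(1)] by blast
    then obtain i where "i \<in> I" "dist (fst p) (y i) \<le> r + snd p" using near[OF fA[OF C(1)]] C(2) by blast
    then show "p \<in> (\<Union>i\<in>I. ?F i)" using p by (intro UN_I[of i]) simp_all
  qed
  then have "card (f ` ?T) \<le> card (\<Union>i\<in>I. ?F i)" using I fT by (intro card_mono) auto
  also have "\<dots> \<le> (\<Sum>i\<in>I. card (?F i))" by (rule card_UN_le[OF I])
  also have "\<dots> \<le> (\<Sum>i\<in>I. ?K)"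
  proof (rule sum_mono)
    fix i assume "i \<in> I"
    have "real (card (?F i)) \<le> ((r + 2 * s) / s) ^ DIM('a)"
    proof (rule card_packing[OF s])
      show "finite (?F i)" using fT by simp
      show "s \<le> snd p" if "p \<in> ?F i" for p
      proof -
        obtain C where C: "C \<in> ?T" "p = f C" using \<open>p \<in> ?F i\<close> by blast
        then show ?thesis using near[OF fA[OF C(1)]] f[OF C(1)] by blast
      qed
      show "dist (fst p) (y i) \<le> r + snd p" if "p \<in> ?F i" for p using that by blast
      show "\<not> touch p p'" if pp: "p \<in> ?F i" "p' \<in> ?F i" "p \<noteq> p'" for p p'
      proof -
        obtain C D where "C \<in> ?T" "p = f C" "D \<in> ?T" "p' = f D" using pp(1,2) by blast
        then show ?thesis using nt[of C D] pp(3) by blast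
      qed
    qed
    then show "card (?F i) \<le> ?K" by linarith
  qed
  finally have "card (f ` ?T) \<le> card I * ?K" by simp
  then show ?thesis by (simp add: card_image[OF inj])
qed

context gibbs
begin

text \<open>\<open>G\<close> is the union of the cells over \<open>A\<close>, and \<open>H\<close>
  collects the balls of radius at most \<open>s0\<close> that could touch a ball of a cell. The
  cells are disjoint, the mesh being \<open>\<rho>\<close> and their radius
  \<open>\<rho> / 4\<close>, so the mass of \<open>G\<close> is additive, while subadditivity
  suffices for \<open>H\<close>. All exponents are linear in \<open>card A\<close>, whence the
  power.\<close>

lemma vacant_cells_bound:
  fixes e1 e2 :: 'a
  assumes e: "e1 \<in> Basis" "e2 \<in> Basis" "e1 \<noteq> e2"
    and r: "0 < s0" "s0 < \<rho>" "\<rho> \<le> \<rho>1"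
    and cell: "\<And>x. emeasure \<mu> (cball x (\<rho> / 4) \<times> {\<rho>..\<rho>1}) = ennreal g" "0 \<le> g"
    and small: "\<And>x. emeasure \<mu> (cball x (\<rho> / 4 + \<rho>1 + s0) \<times> {0..s0}) \<le> ennreal h" "0 \<le> h"
    and A: "finite A"
  shows "measure P {\<omega> \<in> configurations. \<forall>s\<in>A. atoms \<omega> \<inter> cball (ctr e1 e2 \<rho> s) (\<rho> / 4) \<times> {\<rho>..\<rho>1} = {}} \<le>
    (exp (q * h - g) * q ^ nat \<lceil>((\<rho> / 4 + \<rho>1 + 2 * s0) / s0) ^ DIM('a)\<rceil>) ^ card A"
proof -
  let ?c = "ctr e1 e2 \<rho>" and ?K = "nat \<lceil>((\<rho> / 4 + \<rho>1 + 2 * s0) / s0) ^ DIM('a)\<rceil>"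
  define cl where "cl s = cball (?c s) (\<rho> / 4) \<times> {\<rho>..\<rho>1}" for s
  \<comment> \<open>The radius adds \<open>\<rho> / 4\<close> for the position in the cell,
    \<open>\<rho>1\<close> for the largest ball of the cell and \<open>s0\<close> for the small ball
    that touches it.\<close>
  define nb where "nb s = cball (?c s) (\<rho> / 4 + \<rho>1 + s0) \<times> {0..s0}" for s
  define G where "G = (\<Union>s\<in>A. cl s)"
  define H where "H = (\<Union>s\<in>A. nb s)"
  define \<Lambda> where "\<Lambda> = (\<Union>s\<in>A. cball (?c s) (\<rho> / 4 + \<rho>1 + s0))"
  have cl: "cl s \<in> sets point_space" and nb: "nb s \<in> sets point_space" for s
    unfolding cl_def nb_def using r by (auto intro!: rect_in_sets)
  have G: "G \<in> sets point_space" and H: "H \<in> sets point_space"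
    using A cl nb by (auto simp: G_def H_def)
  have L: "\<Lambda> \<in> sets borel" "bounded \<Lambda>" using A by (auto simp: \<Lambda>_def)
  have sub: "cl s \<subseteq> cball (?c s) (\<rho> / 4 + \<rho>1 + s0) \<times> UNIV" "nb s \<subseteq> cball (?c s) (\<rho> / 4 + \<rho>1 + s0) \<times> UNIV" for s
    using r by (auto simp: cl_def nb_def)
  have GL: "G \<subseteq> \<Lambda> \<times> UNIV" "H \<subseteq> \<Lambda> \<times> UNIV"
    unfolding G_def H_def \<Lambda>_def using sub by blast+
  have GH: "G \<inter> H = {}" using r by (auto simp: G_def H_def cl_def nb_def)
  have "disjoint_family_on cl A"
    unfolding disjoint_family_on_def
  proof (intro ballI impI)
    fix s t assume "s \<in> A" "t \<in> A" "s \<noteq> t"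
    then have "\<rho> \<le> dist (?c s) (?c t)" using r by (intro dist_ctr_ge[OF e]) auto
    then have "cball (?c s) (\<rho> / 4) \<inter> cball (?c t) (\<rho> / 4) = {}" using r by (intro disjoint_cballI) simp
    then show "cl s \<inter> cl t = {}" by (auto simp: cl_def)
  qed
  then have "emeasure \<mu> G = (\<Sum>s\<in>A. emeasure \<mu> (cl s))"
    unfolding G_def using A cl by (intro sum_emeasure[symmetric]) (auto simp: sets_mu)
  also have "\<dots> = (\<Sum>s\<in>A. ennreal g)" by (simp add: cl_def cell(1))
  also have "\<dots> = ennreal (real (card A) * g)" using cell(2) by (simp add: ennreal_of_nat_eq_real_of_nat ennreal_mult')
  finally have eG: "emeasure \<mu> G = ennreal (real (card A) * g)" .
  then have mG: "measure \<mu> G = real (card A) * g" using cell(2) by (simp add: measure_def)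
  have "emeasure \<mu> H \<le> (\<Sum>s\<in>A. emeasure \<mu> (nb s))"
    unfolding H_def using A nb by (intro emeasure_subadditive_finite) (auto simp: sets_mu)
  also have "\<dots> \<le> (\<Sum>s\<in>A. ennreal h)" using small(1) by (intro sum_mono) (simp add: nb_def)
  also have "\<dots> = ennreal (real (card A) * h)" using small(2) by (simp add: ennreal_of_nat_eq_real_of_nat ennreal_mult')
  finally have eH: "emeasure \<mu> H \<le> ennreal (real (card A) * h)" .
  then have mH: "measure \<mu> H \<le> real (card A) * h" using small(2) by (simp add: measure_def enn2real_leI)
  have "{\<omega> \<in> configurations. \<forall>s\<in>A. atoms \<omega> \<inter> cl s = {}} = {\<omega> \<in> configurations. atoms \<omega> \<inter> G = {}}"
    by (auto simp: G_def)
  also have "measure P \<dots> \<le> exp (q * measure \<mu> H - measure \<mu> G) * q ^ (card A * ?K)"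
  proof (rule vacant_bound[OF L G GL(1) _ H GL(2) _ GH])
    show "emeasure \<mu> G < \<infinity>" by (simp add: eG)
    show "emeasure \<mu> H < \<infinity>" using eH by (rule le_less_trans) simp
    fix A' X assume A': "finite A'" "A' \<subseteq> compl H" "X \<subseteq> G"
    have "card {C \<in> clusters touch A'. \<exists>p\<in>C. \<exists>b\<in>X. touch p b} \<le>
        card A * nat \<lceil>((\<rho> / 4 + \<rho>1 + 2 * s0) / s0) ^ DIM('a)\<rceil>"
    proof (rule card_touched_clusters[OF A'(1) A r(1)])
      show "0 \<le> \<rho> / 4 + \<rho>1" using r by simp
      fix p b assume pb: "p \<in> A'" "b \<in> X" "touch p b"
      then obtain s where s: "s \<in> A" "b \<in> cl s" using A'(3) by (auto simp: G_def)
      have "dist (fst p) (?c s) \<le> dist (fst p) (fst b) + dist (fst b) (?c s)" by (rule dist_triangle)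
      also have "\<dots> \<le> (snd p + \<rho>1) + \<rho> / 4"
        using pb(3) s(2) by (auto simp: touch_def cl_def dist_commute)
      finally have d: "dist (fst p) (?c s) \<le> \<rho> / 4 + \<rho>1 + snd p" by simp
      \<comment> \<open>Otherwise \<open>p\<close> would belong to \<open>H\<close>, which
        \<open>A'\<close> avoids.\<close>
      moreover have "s0 \<le> snd p"
      proof (rule ccontr)
        assume "\<not> s0 \<le> snd p"
        then have "p \<in> nb s" using d A'(2) pb(1) by (cases p) (auto simp: nb_def dist_commute)
        then show False using A'(2) pb(1) s(1) by (auto simp: H_def)
      qed
      ultimately show "s0 \<le> snd p \<and> (\<exists>i\<in>A. dist (fst p) (?c i) \<le> \<rho> / 4 + \<rho>1 + snd p)" using s(1) by blast
    qed
    then show "card {C \<in> clusters touch A'. \<exists>p\<in>C. \<exists>b\<in>X. touch p b} \<le> card A * ?K" .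
  qed
  also have "\<dots> \<le> exp (real (card A) * (q * h - g)) * q ^ (card A * ?K)"
  proof (rule mult_right_mono)
    have "q * measure \<mu> H \<le> q * (real (card A) * h)" using mH q by (intro mult_left_mono) auto
    then show "exp (q * measure \<mu> H - measure \<mu> G) \<le> exp (real (card A) * (q * h - g))"
      by (simp add: mG algebra_simps)
  qed (use q in simp)
  also have "\<dots> = (exp (q * h - g) * q ^ ?K) ^ card A"
    by (simp add: exp_of_nat_mult power_mult_distrib mult.commute flip: power_mult)
  finally show ?thesis unfolding cl_def .
qed

text \<open>By Borel-Cantelli the boxes at the origin are good from some level on. One point is
  picked in every occupied cell, and picks in neighbouring cells touch, so an infinite connection of
  sites becomes an unbounded cluster.\<close>

lemma supercritical:
  fixes e1 e2 :: 'a
  assumes e: "e1 \<in> Basis" "e2 \<in> Basis" "e1 \<noteq> e2"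
    and r: "0 < s0" "s0 < \<rho>" "\<rho> \<le> \<rho>1"
    and cell: "\<And>x. emeasure \<mu> (cball x (\<rho> / 4) \<times> {\<rho>..\<rho>1}) = ennreal g" "0 \<le> g"
    and small: "\<And>x. emeasure \<mu> (cball x (\<rho> / 4 + \<rho>1 + s0) \<times> {0..s0}) \<le> ennreal h" "0 \<le> h"
    and kappa: "81 * (exp (q * h - g) * q ^ nat \<lceil>((\<rho> / 4 + \<rho>1 + 2 * s0) / s0) ^ DIM('a)\<rceil>) \<le> 1 / 2"
  shows "measure_percolates P"
proof -
  interpret P: prob_space P by (rule P(1))
  let ?c = "ctr e1 e2 \<rho>"
  define \<kappa> where "\<kappa> = exp (q * h - g) * q ^ nat \<lceil>((\<rho> / 4 + \<rho>1 + 2 * s0) / s0) ^ DIM('a)\<rceil>"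
  have k0: "0 \<le> \<kappa>" using q by (simp add: \<kappa>_def)
  define cl where "cl s = cball (?c s) (\<rho> / 4) \<times> {\<rho>..\<rho>1}" for s
  define V :: "(nat \<times> nat) set \<Rightarrow> ('a \<times> real) measure set" where "V A = {\<omega> \<in> configurations. \<forall>s\<in>A. atoms \<omega> \<inter> cl s = {}}" for A
  define B where "B n = (\<Union>A\<in>bad_witnesses n (0, 0). V A)" for n
  have V: "V A \<in> sets P" if "finite A" for A
  proof -
    have cl: "cl s \<in> sets point_space" for s unfolding cl_def using r by (auto intro!: rect_in_sets)
    have "V A = {\<omega> \<in> space config_space. \<forall>s\<in>A. \<omega> \<in> {\<omega> \<in> configurations. atoms \<omega> \<inter> cl s = {}}}"
      by (auto simp: V_def space_config_space)
    also have "\<dots> \<in> sets config_space"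
      by (intro sets.sets_Collect_finite_All that) (auto intro: sets_vacant[OF cl] simp: space_config_space)
    finally show ?thesis by (simp add: P(2))
  qed
  have PV: "measure P (V A) \<le> \<kappa> ^ card A" if "finite A" for A
    unfolding V_def cl_def \<kappa>_def by (rule vacant_cells_bound[OF e r cell small that])
  have B: "B n \<in> sets P" for n
    unfolding B_def using card_bad_witnesses[of n "(0, 0)"] bad_witness_props V by (intro sets.finite_UN) blast+
  have PB: "measure P (B n) \<le> (1 / 2) ^ n" for n
  proof -
    let ?W = "bad_witnesses n (0, 0)"
    have W: "finite ?W" "81 * card ?W \<le> 81 ^ 2 ^ n" using card_bad_witnesses by auto
    have "measure P (B n) \<le> (\<Sum>A\<in>?W. measure P (V A))"
      unfolding B_def using W(1) V bad_witness_props by (intro measure_UNION_le) blast+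
    also have "\<dots> \<le> (\<Sum>A\<in>?W. \<kappa> ^ 2 ^ n)"
    proof (rule sum_mono)
      fix A assume "A \<in> ?W"
      then have "finite A" "card A = 2 ^ n" using bad_witness_props by blast+
      then show "measure P (V A) \<le> \<kappa> ^ 2 ^ n" using PV[of A] by simp
    qed
    also have "\<dots> = real (card ?W) * \<kappa> ^ 2 ^ n" by simp
    also have "\<dots> \<le> 81 ^ 2 ^ n * \<kappa> ^ 2 ^ n"
    proof (rule mult_right_mono)
      have "card ?W \<le> 81 ^ 2 ^ n" using W(2) by linarith
      then have "real (card ?W) \<le> real (81 ^ 2 ^ n)" by (rule of_nat_mono)
      then show "real (card ?W) \<le> 81 ^ 2 ^ n" by simp
    qed (use k0 in simp)
    also have "\<dots> = (81 * \<kappa>) ^ 2 ^ n" by (simp add: power_mult_distrib)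
    also have "\<dots> \<le> (1 / 2) ^ 2 ^ n" using kappa k0 by (intro power_mono) (auto simp: \<kappa>_def)
    \<comment> \<open>A geometric series is all that Borel-Cantelli needs, so the exponent
      \<open>2 ^ n\<close> is lowered to \<open>n\<close>.\<close>
    also have "\<dots> \<le> (1 / 2) ^ n" by (intro power_decreasing) (auto intro: less_imp_le less_exp)
    finally show ?thesis .
  qed
  have "summable (\<lambda>n. measure P (B n))"
    by (rule summable_comparison_test'[OF summable_geometric[of "1 / 2 :: real"], of 0]) (use PB in auto)
  then have "AE \<omega> in P. \<forall>\<^sub>F n in sequentially. \<omega> \<in> space P - B n"
    using B by (intro borel_cantelli_AE1) (auto simp: P.emeasure_eq_measure)
  then have "AE \<omega> in P. percolates \<omega>"
    using AE_space
  proof eventually_elim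
    case (elim \<omega>)
    then have w: "\<omega> \<in> configurations" by (simp add: space_P)
    obtain N where N: "\<And>n. N \<le> n \<Longrightarrow> \<omega> \<notin> B n" using elim(1) by (auto simp: eventually_sequentially)
    define S where "S = {s. atoms \<omega> \<inter> cl s = {}}"
    have good: "\<not> bad S n (0, 0)" if "N \<le> n" for n
    proof
      assume "bad S n (0, 0)"
      then obtain A where "A \<in> bad_witnesses n (0, 0)" "A \<subseteq> S" using bad_witness by blast
      then have "\<omega> \<in> B n" using w by (auto simp: B_def V_def S_def)
      then show False using N that by blast
    qed
    define pt where "pt s = (SOME p. p \<in> atoms \<omega> \<inter> cl s)" for s
    have pt: "pt s \<in> atoms \<omega> \<inter> cl s" if "s \<notin> S" for s
      unfolding pt_def by (rule someI_ex) (use that in \<open>auto simp: S_def\<close>)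
    let ?conn = "\<lambda>s t. linked touch (atoms \<omega>) (pt s) (pt t)"
    \<comment> \<open>The centres are at most \<open>\<rho> / 4 + \<rho> + \<rho> / 4\<close> apart,
      while both radii are at least \<open>\<rho>\<close>.\<close>
    have near: "?conn s t" if st: "s \<notin> S" "t \<notin> S" "dist (?c s) (?c t) \<le> \<rho>" for s t
    proof (rule touch.linked_step)
      have "dist (fst (pt s)) (fst (pt t)) \<le> dist (fst (pt s)) (?c s) + dist (?c s) (?c t) + dist (?c t) (fst (pt t))"
        using dist_triangle[of "fst (pt s)" "fst (pt t)" "?c s"] dist_triangle[of "?c s" "fst (pt t)" "?c t"] by simp
      also have "\<dots> \<le> \<rho> / 4 + \<rho> + \<rho> / 4"
        using pt[OF st(1)] pt[OF st(2)] st(3) by (auto simp: cl_def mem_Times_iff dist_commute intro!: add_mono)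
      also have "\<dots> \<le> \<rho> + \<rho>" using r by simp
      also have "\<dots> \<le> snd (pt s) + snd (pt t)"
        using pt[OF st(1)] pt[OF st(2)] by (auto simp: cl_def mem_Times_iff intro!: add_mono)
      finally show "touch (pt s) (pt t)" by (simp add: touch_def)
    qed (use pt st in auto)
    have ne: "norm e1 = 1" "norm e2 = 1" using e by auto
    interpret site_connection S ?conn
    proof
      show "?conn s s" for s by simp
      show "?conn t s" if "?conn s t" for s t using that by (rule touch.linked_sym)
      show "?conn s u" if "?conn s t" "?conn t u" for s t u using that by (rule touch.linked_trans)
      show "?conn (a, b) (Suc a, b)" if "(a, b) \<notin> S" "(Suc a, b) \<notin> S" for a b
      proof (rule near[OF that])
        have "?c (a, b) - ?c (Suc a, b) = - \<rho> *\<^sub>R e1" by (simp add: ctr_def algebra_simps)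
        then show "dist (?c (a, b)) (?c (Suc a, b)) \<le> \<rho>" using ne r by (simp add: dist_norm)
      qed
      show "?conn (a, b) (a, Suc b)" if "(a, b) \<notin> S" "(a, Suc b) \<notin> S" for a b
      proof (rule near[OF that])
        have "?c (a, b) - ?c (a, Suc b) = - \<rho> *\<^sub>R e2" by (simp add: ctr_def algebra_simps)
        then show "dist (?c (a, b)) (?c (a, Suc b)) \<le> \<rho>" using ne r by (simp add: dist_norm)
      qed
    qed
    obtain s where s: "s \<notin> S" "\<And>k. \<exists>t. t \<notin> S \<and> ?conn s t \<and> k \<le> fst t"
      using unbounded_connection[OF good] by blast
    have "\<exists>p'\<in>atoms \<omega>. linked touch (atoms \<omega>) (pt s) p' \<and> real n < norm (fst p') + snd p'" for n :: nat
    proof -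
      obtain k :: nat where k: "real n / \<rho> < real k" using reals_Archimedean2 by blast
      obtain t where t: "t \<notin> S" "?conn s t" "k \<le> fst t" using s(2) by blast
      have "real n < \<rho> * real k" using k r by (simp add: field_simps)
      also have "\<dots> \<le> \<rho> * real (fst t)" using t(3) r by simp
      also have "\<dots> \<le> norm (?c t)" using ctr_inner(1)[OF e, of \<rho> t] Basis_le_norm[OF e(1), of "?c t"] by simp
      also have "\<dots> \<le> norm (fst (pt t)) + dist (?c t) (fst (pt t))"
        by (metis dist_0_norm dist_commute dist_triangle)
      also have "\<dots> \<le> norm (fst (pt t)) + snd (pt t)"
        using pt[OF t(1)] r by (auto simp: cl_def mem_Times_iff)
      finally show ?thesis using pt[OF t(1)] t(2) by blast
    qed
    then show "percolates \<omega>" using percolates_iff[OF w] pt[OF s(1)] by blast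
  qed
  moreover note sets_percolates
  ultimately have "P.prob {\<omega> \<in> space P. percolates \<omega>} = 1"
    by (subst P.prob_Collect_eq_1) auto
  then show ?thesis by (simp add: measure_percolates_def P.emeasure_eq_measure)
qed

end

section \<open>The random cluster model\<close>

abbreviation intensity :: "real \<Rightarrow> real measure \<Rightarrow> ('a::euclidean_space \<times> real) measure" where
  "intensity z Q \<equiv> scale_measure (ennreal z) (lborel \<Otimes>\<^sub>M Q)"

lemma crcm_gibbs:
  fixes P :: "('a::euclidean_space \<times> real) measure measure"
  assumes "crcm z Q q P" "1 \<le> q" "sets Q = sets mark_space"
  shows "\<exists>\<pi>. gibbs (intensity z Q) \<pi> q P"
proof -
  from assms(1) obtain \<pi> where \<pi>: "prob_space P" "sets P = sets config_space" "marked_poisson_law z Q \<pi>"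
    "\<forall>\<Lambda>. bounded \<Lambda> \<and> \<Lambda> \<in> sets borel \<longrightarrow>
        (AE \<omega> in P. 0 < crcm_partition \<pi> q \<Lambda> (config_restrict (- \<Lambda>) \<omega>) \<and>
                    crcm_partition \<pi> q \<Lambda> (config_restrict (- \<Lambda>) \<omega>) < \<infinity>) \<and>
        (\<forall>f :: ('a \<times> real) measure \<Rightarrow> real.
          f \<in> borel_measurable config_space \<and> (\<exists>C. \<forall>\<omega> \<in> configurations. \<bar>f \<omega>\<bar> \<le> C) \<longrightarrow>
          (\<integral>\<omega>. f \<omega> \<partial>P) =
          (\<integral>\<omega>. (\<integral>\<omega>'. f (config_add (config_restrict \<Lambda> \<omega>') (config_restrict (- \<Lambda>) \<omega>)) *
                 (q powi ncc_local \<Lambda>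
                    (config_add (config_restrict \<Lambda> \<omega>') (config_restrict (- \<Lambda>) \<omega>)) /
                  enn2real (crcm_partition \<pi> q \<Lambda> (config_restrict (- \<Lambda>) \<omega>)))
               \<partial>law_restrict \<Lambda> \<pi>) \<partial>P))"
    unfolding crcm_def by (elim conjE exE) (rule that)
  have "gibbs (intensity z Q) \<pi> q P"
  proof (intro gibbs.intro poisson_process.intro gibbs_axioms.intro)
    show "poisson_process_law (intensity z Q) \<pi>" using \<pi>(3) by (simp add: marked_poisson_law_def)
    show "sets (intensity z Q) = sets (point_space :: ('a \<times> real) measure)"
      using sets_lborel_pair_mark[OF assms(3)] by simp
  qed (assumption | rule assms(2) \<pi>(1) \<pi>(2) \<pi>(4)[THEN spec, THEN mp] conjI)+
  then show ?thesis ..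
qed

section \<open>Estimates for the mark law and the choice of the thresholds\<close>

context
  fixes Q :: "real measure"
  assumes Q_prob: "prob_space Q" and Q_sets: "sets Q = sets mark_space"
begin

interpretation Q: prob_space Q by (rule Q_prob)

lemma space_Q: "space Q = {0..}"
  using sets_eq_imp_space_eq[OF Q_sets] by (simp add: mark_space_def space_restrict_space)

lemma in_sets_Q: "J \<in> sets borel \<Longrightarrow> J \<subseteq> {0..} \<Longrightarrow> J \<in> sets Q"
  unfolding Q_sets mark_space_def by (subst sets_restrict_space_iff) auto

lemma emeasure_intensity_rect:
  fixes A :: "'a::euclidean_space set"
  assumes "A \<in> sets borel" "J \<in> sets borel" "J \<subseteq> {0..}"
  shows "emeasure (intensity z Q) (A \<times> J) = ennreal z * (emeasure lborel A * emeasure Q J)"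
  using assms in_sets_Q[OF assms(2,3)] by (simp add: Q.emeasure_pair_measure_Times)

lemma emeasure_intensity_cball:
  fixes x :: "'a::euclidean_space"
  assumes "J \<in> sets borel" "J \<subseteq> {0..}" "0 \<le> z" "0 \<le> r"
  shows "emeasure (intensity z Q) (cball x r \<times> J) =
    ennreal (z * (unit_ball_vol (DIM('a)) * r ^ DIM('a) * measure Q J))"
  using assms emeasure_intensity_rect[of "cball x r" J z]
  by (simp add: emeasure_cball Q.emeasure_eq_measure ennreal_mult)

text \<open>The part of the moment of order \<open>d\<close> carried by radii above
  \<open>\<alpha>\<close>. It controls both the large balls centred in a window of size
  \<open>\<alpha>\<close> and the far balls that reach into it, and it tends to 0 along the scales
  when the moment is finite.\<close>

definition tail_moment :: "nat \<Rightarrow> real \<Rightarrow> ennreal" where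
  "tail_moment d \<alpha> = (\<integral>\<^sup>+ R. ennreal (R ^ d) * indicator {\<alpha><..} R \<partial>Q)"

lemma borel_measurable_Q: "f \<in> borel_measurable borel \<Longrightarrow> f \<in> borel_measurable Q"
  by (simp add: measurable_cong_sets[OF Q_sets] mark_space_def measurable_restrict_space1)

lemma tail_moment_le: "tail_moment d \<alpha> \<le> (\<integral>\<^sup>+ R. ennreal (R ^ d) \<partial>Q)"
  unfolding tail_moment_def by (intro nn_integral_mono) (auto simp: indicator_def)

lemma tail_moment_lim:
  assumes "(\<integral>\<^sup>+ R. ennreal (R ^ d) \<partial>Q) < \<infinity>"
  shows "(\<lambda>n. tail_moment d (10 ^ n)) \<longlonglongrightarrow> 0"
proof -
  have "(\<lambda>n. \<integral>\<^sup>+ R. ennreal (R ^ d) * indicator {10 ^ n<..} R \<partial>Q) \<longlonglongrightarrow> (\<integral>\<^sup>+ R. 0 \<partial>Q)"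
  proof (rule nn_integral_dominated_convergence[where w = "\<lambda>R. ennreal (R ^ d)"])
    show "AE R in Q. (\<lambda>n. ennreal (R ^ d) * indicator {10 ^ n<..} R) \<longlonglongrightarrow> 0"
    proof (rule AE_I2)
      fix R :: real
      obtain N where N: "R < 10 ^ N" using real_arch_pow[of 10 R] by auto
      have "ennreal (R ^ d) * indicator {10 ^ n<..} R = 0" if "N \<le> n" for n
      proof -
        have "(10::real) ^ N \<le> 10 ^ n" using that by (intro power_increasing) auto
        then have "R < 10 ^ n" using N by linarith
        then show ?thesis by (simp add: indicator_def)
      qed
      then show "(\<lambda>n. ennreal (R ^ d) * indicator {10 ^ n<..} R) \<longlonglongrightarrow> 0"
        by (intro tendsto_eventually) (auto simp: eventually_sequentially)
    qed
    show "AE R in Q. ennreal (R ^ d) * indicator {10 ^ n<..} R \<le> ennreal (R ^ d)" for n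
      by (intro AE_I2) (auto simp: indicator_def)
  qed (use assms in \<open>auto intro!: borel_measurable_Q\<close>)
  then show ?thesis by (simp add: tail_moment_def)
qed

lemma tail_moment_ge:
  assumes "0 < \<alpha>"
  shows "ennreal (\<alpha> ^ d) * emeasure Q {\<alpha><..} \<le> tail_moment d \<alpha>"
proof -
  have J: "{\<alpha><..} \<in> sets Q" using assms by (intro in_sets_Q) auto
  have "ennreal (\<alpha> ^ d) * emeasure Q {\<alpha><..} = (\<integral>\<^sup>+ R. ennreal (\<alpha> ^ d) * indicator {\<alpha><..} R \<partial>Q)"
    using J by (simp add: nn_integral_cmult_indicator)
  also have "\<dots> \<le> tail_moment d \<alpha>"
    unfolding tail_moment_def using assms
    by (intro nn_integral_mono) (auto simp: indicator_def intro!: ennreal_leI power_mono)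
  finally show ?thesis .
qed

text \<open>The window has volume of order \<open>\<alpha> ^ d\<close>, which is just what Markov's
  inequality \<open>tail_moment_ge\<close> absorbs.\<close>

lemma intensity_large_balls:
  fixes x :: "'a::euclidean_space"
  assumes z: "0 \<le> z" and a: "0 < \<alpha>"
  shows "emeasure (intensity z Q) (cball x (100 * \<alpha>) \<times> {\<alpha><..}) \<le>
    ennreal (z * (unit_ball_vol (DIM('a)) * 100 ^ DIM('a))) * tail_moment (DIM('a)) \<alpha>"
proof -
  let ?v = "unit_ball_vol (DIM('a))" and ?d = "DIM('a)"
  have "emeasure (intensity z Q) (cball x (100 * \<alpha>) \<times> {\<alpha><..}) =
      ennreal z * (ennreal (?v * (100 * \<alpha>) ^ ?d) * emeasure Q {\<alpha><..})"
    using a by (subst emeasure_intensity_rect) (auto simp: emeasure_cball)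
  also have "ennreal (?v * (100 * \<alpha>) ^ ?d) = ennreal (?v * 100 ^ ?d) * ennreal (\<alpha> ^ ?d)"
    using a by (simp add: power_mult_distrib mult.assoc flip: ennreal_mult)
  also have "ennreal z * (ennreal (?v * 100 ^ ?d) * ennreal (\<alpha> ^ ?d) * emeasure Q {\<alpha><..}) =
      ennreal (z * (?v * 100 ^ ?d)) * (ennreal (\<alpha> ^ ?d) * emeasure Q {\<alpha><..})"
    using z by (simp add: ennreal_mult' mult.assoc)
  also have "\<dots> \<le> ennreal (z * (?v * 100 ^ ?d)) * tail_moment ?d \<alpha>"
    by (intro mult_left_mono tail_moment_ge[OF a]) simp
  finally show ?thesis .
qed

lemma intensity_far_balls:
  assumes z: "0 \<le> z" and a: "0 < \<alpha>"
  shows "emeasure (intensity z Q) {v \<in> UNIV \<times> {0..} :: ('a::euclidean_space \<times> real) set.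
      10 * \<alpha> < norm (fst v) \<and> norm (fst v) \<le> 8 * \<alpha> + snd v} \<le>
    ennreal (z * (unit_ball_vol (DIM('a)) * 100 ^ DIM('a))) * tail_moment (DIM('a)) \<alpha>"
proof -
  let ?v = "unit_ball_vol (DIM('a))" and ?d = "DIM('a)"
  let ?P = "point_space :: ('a \<times> real) measure"
  let ?T = "{v \<in> UNIV \<times> {0..} :: ('a \<times> real) set. 10 * \<alpha> < norm (fst v) \<and> norm (fst v) \<le> 8 * \<alpha> + snd v}"
  let ?T' = "{v \<in> space ?P. norm (fst v) \<le> 5 * snd v \<and> \<alpha> < snd v}"
  interpret pair_sigma_finite "lborel :: 'a measure" Q ..
  have s: "sets (lborel \<Otimes>\<^sub>M Q) = sets ?P" by (rule sets_lborel_pair_mark[OF Q_sets])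
  have T': "?T' \<in> sets ?P" by measurable
  \<comment> \<open>The two conditions give \<open>2 * \<alpha> < snd v\<close>, hence
    \<open>8 * \<alpha> + snd v \<le> 5 * snd v\<close>.\<close>
  have "?T \<subseteq> ?T'" using a by (auto simp: space_point_space)
  then have "emeasure (intensity z Q) ?T \<le> emeasure (intensity z Q) ?T'"
    using T' s by (intro emeasure_mono) auto
  also have "\<dots> = ennreal z * emeasure (lborel \<Otimes>\<^sub>M Q) ?T'" by simp
  also have "emeasure (lborel \<Otimes>\<^sub>M Q) ?T' = (\<integral>\<^sup>+ R. emeasure lborel ((\<lambda>x. (x, R)) -` ?T') \<partial>Q)"
    using T' s by (intro emeasure_pair_measure_alt2) simp
  also have "\<dots> = (\<integral>\<^sup>+ R. ennreal (?v * 5 ^ ?d) * (ennreal (R ^ ?d) * indicator {\<alpha><..} R) \<partial>Q)"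
  proof (rule nn_integral_cong)
    fix R assume "R \<in> space Q"
    then have R: "0 \<le> R" by (simp add: space_Q)
    have "(\<lambda>x. (x, R)) -` ?T' = (if \<alpha> < R then cball 0 (5 * R) else {})"
      using R by (auto simp: space_point_space)
    then show "emeasure lborel ((\<lambda>x. (x, R)) -` ?T') = ennreal (?v * 5 ^ ?d) * (ennreal (R ^ ?d) * indicator {\<alpha><..} R)"
      using R by (auto simp: emeasure_cball power_mult_distrib mult.assoc indicator_def simp flip: ennreal_mult)
  qed
  also have "\<dots> = ennreal (?v * 5 ^ ?d) * tail_moment ?d \<alpha>"
    unfolding tail_moment_def using in_sets_Q[of "{\<alpha><..}"] a
    by (intro nn_integral_cmult borel_measurable_times_ennreal borel_measurable_Q borel_measurable_indicator) auto
  \<comment> \<open>The constant 5 is enlarged to 100, so that a single sequence bounds the large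
    balls and the far balls.\<close>
  also have "ennreal z * (ennreal (?v * 5 ^ ?d) * tail_moment ?d \<alpha>) \<le>
      ennreal z * (ennreal (?v * 100 ^ ?d) * tail_moment ?d \<alpha>)"
    by (intro mult_left_mono mult_right_mono ennreal_leI power_mono) auto
  also have "\<dots> = ennreal (z * (?v * 100 ^ ?d)) * tail_moment ?d \<alpha>"
    using z by (simp add: ennreal_mult mult.assoc)
  finally show ?thesis .
qed

lemma no_percolation_small_intensity:
  assumes q: "1 \<le> q" and moment: "(\<integral>\<^sup>+ R. ennreal (R ^ DIM('a::euclidean_space)) \<partial>Q) < \<infinity>"
  shows "\<exists>z0>0. \<forall>z. 0 < z \<and> z < z0 \<longrightarrow>
    (\<forall>P :: ('a \<times> real) measure measure. crcm z Q q P \<longrightarrow> measure_not_percolates P)"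
proof -
  let ?v = "unit_ball_vol (DIM('a))" and ?d = "DIM('a)"
  obtain K1 where K1: "finite K1" "K1 \<subseteq> sphere (0::'a) 10" "sphere 0 10 \<subseteq> (\<Union>k\<in>K1. cball k 1)"
    using sphere_net[where 'a = 'a, of 10] by (elim exE conjE)
  obtain K2 where K2: "finite K2" "K2 \<subseteq> sphere (0::'a) 80" "sphere 0 80 \<subseteq> (\<Union>k\<in>K2. cball k 1)"
    using sphere_net[where 'a = 'a, of 80] by (elim exE conjE)
  define N where "N = real (card K1 * card K2)"
  \<comment> \<open>Makes \<open>N * \<delta> \<le> 1 / 4\<close>, the smallness that
    \<open>subcritical\<close> asks for.\<close>
  define \<delta> where "\<delta> = 1 / (4 * (N + 1))"
  have N: "0 \<le> N" by (simp add: N_def)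
  then have \<delta>: "0 < \<delta>" "N * \<delta> \<le> 1 / 4" by (auto simp: \<delta>_def field_simps)
  define I where "I n = enn2real (tail_moment ?d (10 ^ n))" for n
  define I0 where "I0 = enn2real (\<integral>\<^sup>+ R. ennreal (R ^ ?d) \<partial>Q)"
  have fin: "tail_moment ?d \<alpha> < \<infinity>" for \<alpha> using le_less_trans[OF tail_moment_le moment] .
  have I: "tail_moment ?d (10 ^ n) = ennreal (I n)" "0 \<le> I n" for n
    using fin[of "10 ^ n"] by (simp_all add: I_def)
  have I0: "I n \<le> I0" "0 \<le> I0" for n
    unfolding I_def I0_def using tail_moment_le moment by (auto intro!: enn2real_mono)
  have "(\<lambda>n. ennreal (I n)) \<longlonglongrightarrow> ennreal 0" using tail_moment_lim[OF moment] by (simp add: I)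
  then have Ilim: "I \<longlonglongrightarrow> 0" by (rule tendsto_ennrealD) (auto simp: I(2))
  have v: "0 < ?v" by simp
  \<comment> \<open>\<open>z * C\<close> dominates the mean number of points at the initial scale as
    well as the terms for large and far balls at all scales.\<close>
  define C where "C = ?v * 10 ^ ?d + ?v * 100 ^ ?d * I0"
  have C: "0 \<le> C" using v I0(2) by (simp add: C_def)
  \<comment> \<open>From \<open>z < z0\<close> follows
    \<open>q * (z * C) \<le> ln (1 + \<delta>)\<close>, so that
    \<open>exp (q * y) - 1 \<le> \<delta>\<close> whenever \<open>y \<le> z * C\<close>.\<close>
  define z0 where "z0 = ln (1 + \<delta>) / (q * (C + 1))"
  have "0 < z0" using \<delta> q C by (simp add: z0_def)
  moreover have "measure_not_percolates P" if z: "0 < z" "z < z0" and P: "crcm z Q q P"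
    for z and P :: "('a \<times> real) measure measure"
  proof -
    obtain \<pi> where "gibbs (intensity z Q) \<pi> q P" using crcm_gibbs[OF P q Q_sets] by blast
    then interpret gibbs "intensity z Q" \<pi> q P .
    have zC: "q * (z * C) \<le> ln (1 + \<delta>)"
    proof -
      have "z * (q * (C + 1)) \<le> z0 * (q * (C + 1))" using z q C by (intro mult_right_mono) auto
      also have "\<dots> = ln (1 + \<delta>)" using q C by (simp add: z0_def)
      finally have "q * (z * (C + 1)) \<le> ln (1 + \<delta>)" by (simp add: mult_ac)
      moreover have "q * (z * C) \<le> q * (z * (C + 1))" using q z by (intro mult_left_mono) auto
      ultimately show ?thesis by simp
    qed
    have small: "N * (exp (q * y) - 1) \<le> 1 / 4" if "y \<le> z * C" for y
    proof -
      have "q * y \<le> q * (z * C)" using that q by (intro mult_left_mono) auto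
      then have "q * y \<le> ln (1 + \<delta>)" using zC by (rule order_trans)
      then have "exp (q * y) \<le> 1 + \<delta>" using \<delta>(1) by (simp add: ln_ge_iff)
      then have "N * (exp (q * y) - 1) \<le> N * \<delta>" using N by (intro mult_left_mono) auto
      then show ?thesis using \<delta>(2) by simp
    qed
    let ?t = "\<lambda>n. z * (?v * 100 ^ ?d) * I n" and ?m = "z * (?v * 10 ^ ?d)"
    show ?thesis
    proof (rule subcritical[OF K1 K2, where t = ?t and m = ?m])
      show "emeasure (intensity z Q) (cball x (100 * 10 ^ n) \<times> {10 ^ n<..}) \<le> ennreal (?t n)" for n and x :: 'a
        using intensity_large_balls[of z "10 ^ n" x] z v I(2)[of n] by (simp add: I(1) ennreal_mult)
      show "emeasure (intensity z Q) {v \<in> UNIV \<times> {0..} :: ('a \<times> real) set. 10 * 10 ^ n < norm (fst v) \<and>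
          norm (fst v) \<le> 8 * 10 ^ n + snd v} \<le> ennreal (?t n)" for n
        using intensity_far_balls[of z "10 ^ n", where 'a = 'a] z v I(2)[of n] by (simp add: I(1) ennreal_mult)
      show "0 \<le> ?t n" for n using z I(2) by simp
      show "?t \<longlonglongrightarrow> 0" using Ilim by (rule tendsto_mult_right_zero)
      have "measure Q {0..} = 1" using Q.prob_space by (simp add: space_Q)
      then show "emeasure (intensity z Q) (cball x 10 \<times> {0..}) \<le> ennreal ?m" for x :: 'a
        using z by (subst emeasure_intensity_cball) auto
      show "0 \<le> ?m" using z by simp
      show "real (card K1 * card K2) * (exp (q * ?m) - 1) \<le> 1 / 4"
        unfolding N_def[symmetric] using z v I0(2) by (intro small mult_left_mono) (auto simp: C_def)
      show "real (card K1 * card K2) * (exp (q * ?t n) - 1) \<le> 1 / 4" for n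
      proof (unfold N_def[symmetric], rule small)
        have "?v * 100 ^ ?d * I n \<le> ?v * 100 ^ ?d * I0" using v I0(1) by (intro mult_left_mono) auto
        also have "\<dots> \<le> C" using v by (simp add: C_def)
        finally show "?t n \<le> z * C" using z by (simp add: mult.assoc)
      qed
    qed
  qed
  ultimately show ?thesis by blast
qed

text \<open>The positive radii are a countable union of compact intervals, so one of these has
  positive mass. In \<open>supercritical\<close> the lower end sets the mesh of the lattice, and the
  upper end keeps the neighbourhood of a cell bounded.\<close>

lemma mark_interval_exists:
  assumes "emeasure Q {0} = 0"
  shows "\<exists>\<rho> \<rho>1. 0 < \<rho> \<and> \<rho> \<le> \<rho>1 \<and> 0 < measure Q {\<rho>..\<rho>1}"
proof (rule ccontr)
  assume "\<not> ?thesis"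
  then have n: "measure Q {\<rho>..\<rho>1} = 0" if "0 < \<rho>" "\<rho> \<le> \<rho>1" for \<rho> \<rho>1
    using that measure_nonneg[of Q "{\<rho>..\<rho>1}"] by (metis less_eq_real_def)
  let ?J = "\<lambda>n::nat. {1 / real (Suc n)..real (Suc n)}"
  have J: "?J n \<in> null_sets Q" for n
  proof (rule null_setsI)
    have "1 / real (Suc n) \<le> real (Suc n)" by (simp add: field_simps)
    then show "emeasure Q (?J n) = 0" using n[of "1 / real (Suc n)" "real (Suc n)"] by (simp add: Q.emeasure_eq_measure)
    show "?J n \<in> sets Q" by (rule in_sets_Q) (auto intro: order_trans[rotated])
  qed
  then have "(\<Union>n. ?J n) \<in> null_sets Q" by (rule null_sets_UN)
  moreover have "{0} \<in> null_sets Q" using assms in_sets_Q[of "{0}"] by (intro null_setsI) auto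
  ultimately have U: "{0} \<union> (\<Union>n. ?J n) \<in> null_sets Q" by (intro null_sets.Un)
  have "space Q \<subseteq> {0} \<union> (\<Union>n. ?J n)"
  proof
    fix R assume "R \<in> space Q"
    then have R: "0 \<le> R" by (simp add: space_Q)
    show "R \<in> {0} \<union> (\<Union>n. ?J n)"
    proof (cases "R = 0")
      case False
      obtain n :: nat where n: "max R (1 / R) < real n" using reals_Archimedean2 by blast
      have "1 / real (Suc n) \<le> R" using n R False by (simp add: field_simps)
      moreover have "R \<le> real (Suc n)" using n by simp
      ultimately have "R \<in> ?J n" by simp
      then show ?thesis by blast
    qed simp
  qed
  then have "space Q \<in> null_sets Q" by (rule null_sets_subset[OF U sets.top])
  then show False using Q.emeasure_space_1 by auto
qed

text \<open>The intervals from 0 to \<open>1 / real (Suc n)\<close> decrease to \<open>{0}\<close>,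
  which has no mass.\<close>

lemma small_marks_negligible:
  assumes "emeasure Q {0} = 0" "0 < \<epsilon>" "0 < \<rho>"
  shows "\<exists>s0>0. s0 < \<rho> \<and> measure Q {0..s0} < \<epsilon>"
proof -
  let ?J = "\<lambda>n::nat. {0..1 / real (Suc n)}"
  have "(\<lambda>n. measure Q (?J n)) \<longlonglongrightarrow> measure Q (\<Inter>n. ?J n)"
  proof (rule Q.finite_Lim_measure_decseq)
    show "range ?J \<subseteq> sets Q" by (auto intro: in_sets_Q)
    show "decseq ?J" by (auto simp: decseq_def field_simps intro: order_trans)
  qed
  moreover have "(\<Inter>n. ?J n) = {0}"
  proof (intro equalityI subsetI)
    fix x assume x: "x \<in> (\<Inter>n. ?J n)"
    have "\<not> 0 < x"
    proof
      assume "0 < x"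
      then obtain n where "inverse (real (Suc n)) < x" using reals_Archimedean by blast
      moreover have "x \<in> ?J n" using x by blast
      ultimately show False by (simp add: inverse_eq_divide)
    qed
    moreover have "x \<in> ?J 0" using x by blast
    ultimately show "x \<in> {0}" by simp
  qed auto
  ultimately have "(\<lambda>n. measure Q (?J n)) \<longlonglongrightarrow> 0" using assms(1) by (simp add: measure_def)
  then have "\<forall>\<^sub>F n in sequentially. measure Q (?J n) < \<epsilon>" using assms(2) by (rule order_tendstoD)
  moreover have "(\<lambda>n. 1 / real (Suc n)) \<longlonglongrightarrow> 0" using LIMSEQ_inverse_real_of_nat by (simp add: inverse_eq_divide)
  then have "\<forall>\<^sub>F n in sequentially. 1 / real (Suc n) < \<rho>" using assms(3) by (rule order_tendstoD)
  ultimately have "\<forall>\<^sub>F n in sequentially. measure Q (?J n) < \<epsilon> \<and> 1 / real (Suc n) < \<rho>" by eventually_elim simp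
  then obtain n where "measure Q (?J n) < \<epsilon> \<and> 1 / real (Suc n) < \<rho>" by (auto simp: eventually_sequentially)
  then show ?thesis by (intro exI[of _ "1 / real (Suc n)"]) auto
qed

lemma percolation_large_intensity:
  assumes dim: "2 \<le> DIM('a::euclidean_space)" and q: "1 \<le> q" and zero: "emeasure Q {0} = 0"
  shows "\<exists>z1\<ge>0. \<forall>z>z1. (\<forall>P :: ('a \<times> real) measure measure. crcm z Q q P \<longrightarrow> measure_percolates P)"
proof -
  let ?v = "unit_ball_vol (DIM('a))" and ?d = "DIM('a)"
  obtain e1 :: 'a where e1: "e1 \<in> Basis" using nonempty_Basis by blast
  have "card (Basis - {e1}) \<noteq> 0" using dim e1 by (simp add: card_Diff_singleton)
  then have "Basis - {e1} \<noteq> {}" by (metis card.empty)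
  then obtain e2 :: 'a where e2: "e2 \<in> Basis" "e1 \<noteq> e2" by blast
  obtain \<rho> \<rho>1 where r: "0 < \<rho>" "\<rho> \<le> \<rho>1" and m: "0 < measure Q {\<rho>..\<rho>1}"
    using mark_interval_exists[OF zero] by blast
  define m where "m = measure Q {\<rho>..\<rho>1}"
  \<comment> \<open>Bounds \<open>\<rho> / 4 + \<rho>1 + s0\<close> in advance through
    \<open>s0 < \<rho>\<close>, so that \<open>\<epsilon>\<close>, from which \<open>s0\<close> is
    obtained, does not refer to \<open>s0\<close>.\<close>
  let ?R = "\<rho> / 4 + \<rho>1 + \<rho>"
  \<comment> \<open>Chosen so that \<open>q * ?h \<le> ?g / 2\<close> below: the price of removing
    the small balls consumes at most half of the gain from the cells.\<close>
  define \<epsilon> where "\<epsilon> = (\<rho> / 4) ^ ?d * m / (2 * q * ?R ^ ?d)"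
  have "0 < \<epsilon>" using r q m by (simp add: \<epsilon>_def m_def)
  then obtain s0 where s0: "0 < s0" "s0 < \<rho>" "measure Q {0..s0} < \<epsilon>"
    using small_marks_negligible[OF zero _ r(1)] by blast
  define K where "K = nat \<lceil>((\<rho> / 4 + \<rho>1 + 2 * s0) / s0) ^ ?d\<rceil>"
  define g0 where "g0 = ?v * (\<rho> / 4) ^ ?d * m"
  have v: "0 < ?v" by simp
  have g0: "0 < g0" using r m v by (simp add: g0_def m_def)
  \<comment> \<open>\<open>K\<close> does not depend on \<open>z\<close>, so for large
    \<open>z\<close> the factor \<open>exp (- (z * g0 / 2))\<close> beats \<open>q ^ K\<close>. The
    constant is \<open>162 = 2 * 81\<close>, which gives the \<open>1 / 2\<close> required by
    \<open>supercritical\<close>.\<close>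
  define z1 where "z1 = 2 * ln (162 * q ^ K) / g0"
  have qK: "1 \<le> q ^ K" using q by simp
  have "0 \<le> z1" using g0 qK by (simp add: z1_def)
  moreover have "measure_percolates P" if z: "z1 < z" and P: "crcm z Q q P"
    for z and P :: "('a \<times> real) measure measure"
  proof -
    obtain \<pi> where "gibbs (intensity z Q) \<pi> q P" using crcm_gibbs[OF P q Q_sets] by blast
    then interpret gibbs "intensity z Q" \<pi> q P .
    have z0: "0 \<le> z" using z \<open>0 \<le> z1\<close> by simp
    let ?g = "z * g0" and ?h = "z * (?v * (\<rho> / 4 + \<rho>1 + s0) ^ ?d * measure Q {0..s0})"
    have hg: "q * ?h \<le> ?g / 2"
    proof -
      have "(\<rho> / 4 + \<rho>1 + s0) ^ ?d * measure Q {0..s0} \<le> ?R ^ ?d * \<epsilon>"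
        using r s0 by (intro mult_mono power_mono) auto
      also have "\<dots> = (\<rho> / 4) ^ ?d * m / (2 * q)" using r q by (simp add: \<epsilon>_def)
      finally have "q * ((\<rho> / 4 + \<rho>1 + s0) ^ ?d * measure Q {0..s0}) \<le> q * ((\<rho> / 4) ^ ?d * m / (2 * q))"
        using q by (intro mult_left_mono) auto
      also have "\<dots> = (\<rho> / 4) ^ ?d * m / 2" using q by simp
      finally have "z * ?v * (q * ((\<rho> / 4 + \<rho>1 + s0) ^ ?d * measure Q {0..s0})) \<le> z * ?v * ((\<rho> / 4) ^ ?d * m / 2)"
        using z0 v by (intro mult_left_mono) auto
      then show ?thesis by (simp add: g0_def mult_ac)
    qed
    show ?thesis
    proof (rule supercritical[OF e1 e2 s0(1,2) r(2), where g = ?g and h = ?h])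
      show "emeasure (intensity z Q) (cball x (\<rho> / 4) \<times> {\<rho>..\<rho>1}) = ennreal ?g" for x :: 'a
        using r z0 by (subst emeasure_intensity_cball) (auto simp: g0_def m_def)
      show "emeasure (intensity z Q) (cball x (\<rho> / 4 + \<rho>1 + s0) \<times> {0..s0}) \<le> ennreal ?h" for x :: 'a
        using r z0 s0 by (subst emeasure_intensity_cball) auto
      show "0 \<le> ?g" "0 \<le> ?h" using z0 g0 v r s0 by auto
      have "ln (162 * q ^ K) \<le> z * g0 / 2" using z g0 by (simp add: z1_def field_simps)
      then have "exp (ln (162 * q ^ K)) \<le> exp (z * g0 / 2)" by simp
      then have "162 * q ^ K \<le> exp (z * g0 / 2)" using qK by simp
      then have "162 * q ^ K * exp (- (z * g0 / 2)) \<le> exp (z * g0 / 2) * exp (- (z * g0 / 2))"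
        by (intro mult_right_mono) auto
      then have 1: "162 * q ^ K * exp (- (z * g0 / 2)) \<le> 1" by (simp flip: exp_add)
      have "exp (q * ?h - ?g) * q ^ K \<le> exp (- (z * g0 / 2)) * q ^ K"
        using hg qK by (intro mult_right_mono) auto
      then show "81 * (exp (q * ?h - ?g) * q ^ nat \<lceil>((\<rho> / 4 + \<rho>1 + 2 * s0) / s0) ^ DIM('a)\<rceil>) \<le> 1 / 2"
        unfolding K_def[symmetric] using 1 by (simp add: mult_ac)
    qed
  qed
  ultimately show ?thesis by blast
qed

end

theorem theorem2:
  fixes q :: real and Q :: "real measure"
  assumes dim: "2 \<le> DIM('a::euclidean_space)"
    and q: "1 \<le> q"
    and Q_prob: "prob_space Q" "sets Q = sets mark_space"
    and Q_nontrivial: "Q \<noteq> return mark_space 0"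
    and Q_moment: "(\<integral>\<^sup>+ R. ennreal (R ^ DIM('a)) \<partial>Q) < \<infinity>"
  shows "(\<exists>z0>0. \<forall>z. 0 < z \<and> z < z0 \<longrightarrow>
            (\<forall>P :: ('a \<times> real) measure measure. crcm z Q q P \<longrightarrow> measure_not_percolates P)) \<and>
         (emeasure Q {0} = 0 \<longrightarrow>
          (\<exists>z1\<ge>0. \<forall>z>z1.
            (\<forall>P :: ('a \<times> real) measure measure. crcm z Q q P \<longrightarrow> measure_percolates P)))"
  using no_percolation_small_intensity[OF Q_prob q Q_moment] percolation_large_intensity[OF Q_prob dim q]
  by blast

end
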